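(* Let $s\ge 6$ be even, $N\ge 2s$, and let $x,y\in SO(3)$ with $\omega(y^{-1}x)\ge \frac{\pi}{2(N+1)}$. Then for all $i,n\in\{1,2,3\}$, $$|X_n^y\sigma_N(x,y)|\le \frac{c_{1,s}}{(N+1)^{s-1}\omega(y^{-1}x)^s},\qquad |X_i^xX_n^y\sigma_N(x,y)|\le \frac{c_{2,s}}{(N+1)^{s-2}\omega(y^{-1}x)^s}.$$
   Context: $SO(3)=\{x\in\mathbb R^{3\times 3}: x^Tx=I,\ \det x=1\}$; $\omega(x)=\arccos((\operatorname{tr}x-1)/2)\in[0,\pi]$ is the rotation angle. Let $\mathcal L_1,\mathcal L_2,\mathcal L_3$ be the generators of $\mathfrak{so}(3)$ with $e^{t\mathcal L_1},e^{t\mathcal L_2},e^{t\mathcal L_3}$ the rotations by angle $t$ about the first, second, third coordinate axis (e.g. $\mathcal L_3=\begin{pmatrix}0&-1&0\\1&0&0\\0&0&0\end{pmatrix}$, and cyclically). For differentiable $f$ on $SO(3)$, $X_if(x)=\frac{d}{dt}f(xe^{t\mathcal L_i})\big|_{t=0}$; for functions of two variables $X_i^x$, $X_i^y$ act on the first resp. second variable. Kernel: for even $s\ge 6$ let $g_{s-1}(x)=\frac{(-1)^{s-1}}{(s-2)!}\int_{-1}^{x}\sum_{k=0}^{s-1}(-1)^k\chi_{(\cos(\frac{(k+1)\pi}{s}),\cos(\frac{k\pi}{s})]}(t)(x-t)^{s-2}\,dt$ for $x\in[-1,1]$ and $g_{s-1}(x)=0$ otherwise (the perfect B-spline, supported in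 $[-1,1]$), and $\tilde g_{s-1}(x)=g_{s-1}(2x)$. For $N\in\mathbb N$ put $\|\tilde g_{s-1}\|_{1,N}=\sum_{k=-N}^N\tilde g_{s-1}(\frac{k}{2(N+1)})$, $\tilde\sigma_N(t)=\|\tilde g_{s-1}\|_{1,N}^{-1}\sum_{k=-N}^{N}\tilde g_{s-1}(\frac{k}{2(N+1)})e^{ikt}$, and $\sigma_N(x,y)=\tilde\sigma_N(\omega(y^{-1}x))$ for $x,y\in SO(3)$ (this is a finite linear combination of products $D^l_{k,m}(x)\overline{D^l_{k,m}(y)}$, $l\le N$, of Wigner D-functions, hence smooth). Constants: $c_{1,s}=1.02\,(s-1)!\,2^s\cdot 2s$, $c_{2,s}=1.02\,(s-1)!\,2^s(4s+1)$. *)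

theory Defs
  imports "HOL-Analysis.Analysis"
begin

type_synonym mat3 = "real^3^3"

definition SO3 :: "mat3 set" where
  "SO3 = {x. transpose x ** x = mat 1 \<and> det x = 1}"

definition rot_angle :: "mat3 \<Rightarrow> real" where
  "rot_angle x = arccos ((trace x - 1) / 2)"

text \<open>exp(t L_i): rotation by angle t about the i-th coordinate axis (i = 1,2,3)\<close>
definition rot :: "nat \<Rightarrow> real \<Rightarrow> mat3" where
  "rot i t =
    (if i = 1 then vector [vector [1, 0, 0], vector [0, cos t, - sin t], vector [0, sin t, cos t]]
     else if i = 2 then vector [vector [cos t, 0, sin t], vector [0, 1, 0], vector [- sin t, 0, cos t]]
     else vector [vector [cos t, - sin t, 0], vector [sin t, cos t, 0], vector [0, 0, 1]])"

definition Xy :: "nat \<Rightarrow> (mat3 \<Rightarrow> mat3 \<Rightarrow> complex) \<Rightarrow> mat3 \<Rightarrow> mat3 \<Rightarrow> complex" where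
  "Xy n F x y = vector_derivative (\<lambda>u. F x (y ** rot n u)) (at 0)"

definition Xx :: "nat \<Rightarrow> (mat3 \<Rightarrow> mat3 \<Rightarrow> complex) \<Rightarrow> mat3 \<Rightarrow> mat3 \<Rightarrow> complex" where
  "Xx i F x y = vector_derivative (\<lambda>t. F (x ** rot i t) y) (at 0)"

text \<open>perfect B-spline g_{s-1}; the argument m stands for s-1, i.e. s = m+1\<close>
definition pbspline :: "nat \<Rightarrow> real \<Rightarrow> real" where
  "pbspline m x = (let s = m + 1 in
     if -1 \<le> x \<and> x \<le> 1 then
       (-1) ^ (s - 1) / fact (s - 2) *
       integral {-1..x} (\<lambda>t. \<Sum>k<s. (-1) ^ k *
          indicator {cos (real (k + 1) * pi / real s)<..cos (real k * pi / real s)} t * (x - t) ^ (s - 2))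
     else 0)"

definition pbspline_t :: "nat \<Rightarrow> real \<Rightarrow> real" where
  "pbspline_t m x = pbspline m (2 * x)"

definition pbnorm :: "nat \<Rightarrow> nat \<Rightarrow> real" where
  "pbnorm m N = (\<Sum>k\<in>{-int N..int N}. pbspline_t m (real_of_int k / (2 * (real N + 1))))"

definition sigma_t :: "nat \<Rightarrow> nat \<Rightarrow> real \<Rightarrow> complex" where
  "sigma_t s N t = (\<Sum>k\<in>{-int N..int N}.
      complex_of_real (pbspline_t (s - 1) (real_of_int k / (2 * (real N + 1))))
        * exp (\<i> * complex_of_real (real_of_int k * t))) / complex_of_real (pbnorm (s - 1) N)"

definition sigma :: "nat \<Rightarrow> nat \<Rightarrow> mat3 \<Rightarrow> mat3 \<Rightarrow> complex" where
  "sigma s N x y = sigma_t s N (rot_angle (matrix_inv y ** x))"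

definition c1 :: "nat \<Rightarrow> real" where
  "c1 s = 1.02 * fact (s - 1) * 2 ^ s * (2 * real s)"

definition c2 :: "nat \<Rightarrow> real" where
  "c2 s = 1.02 * fact (s - 1) * 2 ^ s * (4 * real s + 1)"

end

theory Submission
  imports Defs
begin

text \<open>
  The perfect B-spline is the truncated power combination
  \<open>g(x) = \<Sum>k<2s. (-1)^k (x - cos (k\<pi>/s))\<^sub>+^(s-1) / (s-1)!\<close>: its \<open>s\<close>-th derivative consists of \<open>2s\<close>
  signed unit point masses, and the moments of these masses of order less than \<open>s\<close> vanish.  Integrating
  by parts \<open>s\<close> times therefore bounds the Fourier transforms of \<open>g\<close>, \<open>x g\<close> and \<open>x\<^sup>2 g\<close> by a constant times
  \<open>\<bar>\<xi>\<bar>^(-s)\<close>.  By Poisson summation the numerator of the kernel and its first two derivatives are sums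
  of these transforms over the points \<open>(N+1)(t - 2\<pi>l)\<close>; for \<open>0 < t \<le> \<pi>\<close> only \<open>l = 0\<close> and (when \<open>t\<close> is
  close to \<open>\<pi>\<close>) \<open>l = 1\<close> matter.  The normalising sum is up to a factor \<open>0.9999\<close> at least
  \<open>(N+1) \<integral> g = (N+1) 4 / (2^s (s-1)!)\<close>.

  On the group, the kernel is an even trigonometric polynomial of the rotation angle \<open>\<omega>\<close>, hence a
  polynomial in \<open>cos \<omega> = (trace z - 1) / 2\<close> with \<open>z = y\<^sup>T x\<close>, which makes the invariant derivatives
  explicit even where \<open>\<omega>\<close> itself is not differentiable.  With \<open>\<tau>\<close> the kernel as a function of the angle
  they are bounded by \<open>\<bar>\<tau>'\<bar>\<close> and by \<open>\<bar>\<tau>''\<bar> + \<bar>\<tau>'\<bar> (cot (\<omega>/2) + 1) / 2\<close>.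
\<close>

section \<open>Poisson summation\<close>

text \<open>The obstacle is the second moment. Differentiating \<open>x^2 g\<close> to order
  \<open>s\<close> produces, by the Leibniz rule, the coefficient \<open>s (s - 1)\<close> in front
  of the transform of the spline of degree 1, whereas the constant in the claim is linear in
  \<open>s\<close>. The estimate closes because that spline is a zigzag with slopes 1 and -1 between
  neighbouring nodes, and is therefore only of size \<open>tan (pi / (2 s))\<close>.

  The alternating sign at the node \<open>cos (k pi / s)\<close> is a character of the group of
  2s-th roots of unity. Orthogonality of characters gives both the vanishing moments and the value
  \<open>4 s / 2^s\<close> of the first one that survives, and the latter gives the integral of
  \<open>g\<close>.

  The numbers leave some room. The first derivative needs
  \<open>2.01 / 0.9999 <= 2.04 = 2 * 1.02\<close>. The second needs about
  \<open>1.982 * 2.0103 <= 4.08 = 4 * 1.02\<close>; the worst case is \<open>t\<close> beyond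
  \<open>pi / 2\<close>, where the alias is charged in full, while the factor in front of the first
  derivative is small there.\<close>

lemma has_vector_derivative_cis [derivative_intros]:
  "((\<lambda>x. cis (\<xi> * x)) has_vector_derivative \<i> * of_real \<xi> * cis (\<xi> * x)) (at x within S)"
  unfolding has_vector_derivative_def
  by (rule has_derivative_eq_rhs, (rule derivative_intros)+)
     (auto simp: fun_eq_iff scaleR_conv_of_real algebra_simps)

lemma tendsto_vector_difference_quotient:
  fixes f :: "real \<Rightarrow> 'a::real_normed_vector"
  assumes "(f has_vector_derivative d) (at z within S)"
  shows "((\<lambda>x. (f x - f z) /\<^sub>R (x - z)) \<longlongrightarrow> d) (at z within S)"
proof -
  have "((\<lambda>y. norm (f y - f z - (y - z) *\<^sub>R d) / norm (y - z)) \<longlongrightarrow> 0) (at z within S)"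
    using assms by (simp add: has_vector_derivative_def has_derivative_iff_norm)
  moreover have "norm (f y - f z - (y - z) *\<^sub>R d) / norm (y - z) = norm ((f y - f z) /\<^sub>R (y - z) - d)"
    if "y \<noteq> z" for y
  proof -
    have "(f y - f z) /\<^sub>R (y - z) - d = (f y - f z - (y - z) *\<^sub>R d) /\<^sub>R (y - z)"
      using that by (simp add: scaleR_diff_right)
    then show ?thesis by (simp add: divide_inverse mult.commute)
  qed
  then have "\<forall>\<^sub>F y in at z within S. norm (f y - f z - (y - z) *\<^sub>R d) / norm (y - z)
      = norm ((f y - f z) /\<^sub>R (y - z) - d)"
    by (auto simp: eventually_at_filter)
  ultimately have "((\<lambda>y. norm ((f y - f z) /\<^sub>R (y - z) - d)) \<longlongrightarrow> 0) (at z within S)"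
    by (rule Lim_transform_eventually)
  then show ?thesis
    by (rule LIM_zero_cancel[OF tendsto_norm_zero_cancel])
qed

text \<open>For a polynomial one integration by parts gives decay of order
  \<open>1 / \<bar>\<xi>\<bar>\<close>, and Weierstrass approximation carries this over to
  \<open>H\<close>. Mere continuity matters because the quotient to which this is applied is known
  to be continuous only.\<close>

lemma riemann_lebesgue:
  fixes H :: "real \<Rightarrow> complex"
  assumes H: "continuous_on {a..b} H" and ab: "a \<le> b"
  shows "((\<lambda>\<xi>. integral {a..b} (\<lambda>x. H x * cis (\<xi> * x))) \<longlongrightarrow> 0) at_infinity"
proof (rule tendstoI)
  fix e :: real assume e: "e > 0"
  \<comment> \<open>The approximation error integrates to at most
    \<open>d * (b - a) \<le> e / 2\<close>; the summand 1 keeps the denominator positive when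
    \<open>a = b\<close>.\<close>
  define d where "d = e / (2 * (b - a + 1))"
  have d: "d > 0" using e ab by (simp add: d_def)
  from Stone_Weierstrass_polynomial_function[OF _ H d] obtain p where
    p: "polynomial_function p" and pH: "\<And>x. x \<in> {a..b} \<Longrightarrow> norm (H x - p x) < d" by auto
  from has_vector_derivative_polynomial_function[OF p] obtain p' where
    p': "polynomial_function p'" and dp: "\<And>x. (p has_vector_derivative p' x) (at x)" by blast
  have cp: "continuous_on {a..b} p" "continuous_on {a..b} p'"
    using p p' by (auto intro: continuous_on_polymonial_function)
  define C where "C = norm (p a) + norm (p b) + integral {a..b} (\<lambda>x. norm (p' x))"
  have pbound: "norm (integral {a..b} (\<lambda>x. p x * cis (\<xi> * x))) \<le> C / \<bar>\<xi>\<bar>" if "\<xi> \<noteq> 0" for \<xi>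
  proof -
    have "((\<lambda>x. p x * (\<i> * of_real \<xi> * cis (\<xi> * x)) + p' x * cis (\<xi> * x)) has_integral
            (p b * cis (\<xi> * b) - p a * cis (\<xi> * a))) {a..b}"
      by (intro fundamental_theorem_of_calculus ab has_vector_derivative_mult
           has_vector_derivative_cis has_vector_derivative_at_within[OF dp])
    moreover have "((\<lambda>x. p' x * cis (\<xi> * x)) has_integral
        integral {a..b} (\<lambda>x. p' x * cis (\<xi> * x))) {a..b}"
      by (intro integrable_integral integrable_continuous_real continuous_intros cp)
    ultimately have "((\<lambda>x. (p x * (\<i> * of_real \<xi> * cis (\<xi> * x)) + p' x * cis (\<xi> * x)) - p' x * cis (\<xi> * x))
        has_integral (p b * cis (\<xi> * b) - p a * cis (\<xi> * a)
          - integral {a..b} (\<lambda>x. p' x * cis (\<xi> * x)))) {a..b}"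
      by (rule has_integral_diff)
    then have "((\<lambda>x. \<i> * of_real \<xi> * (p x * cis (\<xi> * x))) has_integral
        (p b * cis (\<xi> * b) - p a * cis (\<xi> * a)
          - integral {a..b} (\<lambda>x. p' x * cis (\<xi> * x)))) {a..b}"
      unfolding add_diff_cancel_right' by (simp only: mult_ac)
    from integral_unique[OF this]
    have eq: "\<i> * of_real \<xi> * integral {a..b} (\<lambda>x. p x * cis (\<xi> * x)) =
       p b * cis (\<xi> * b) - p a * cis (\<xi> * a) - integral {a..b} (\<lambda>x. p' x * cis (\<xi> * x))"
      unfolding integral_mult_right .
    have "norm (integral {a..b} (\<lambda>x. p' x * cis (\<xi> * x))) \<le> integral {a..b} (\<lambda>x. norm (p' x))"
      by (rule integral_norm_bound_integral)
         (auto intro!: integrable_continuous_real continuous_intros cp simp: norm_mult)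
    then have "norm (\<i> * of_real \<xi> * integral {a..b} (\<lambda>x. p x * cis (\<xi> * x))) \<le> C"
      unfolding eq C_def
      using norm_triangle_ineq4[of "p b * cis (\<xi> * b)" "p a * cis (\<xi> * a)"]
        norm_triangle_ineq4[of "p b * cis (\<xi> * b) - p a * cis (\<xi> * a)" "integral {a..b} (\<lambda>x. p' x * cis (\<xi> * x))"]
      by (simp add: norm_mult)
    then show ?thesis using that by (simp add: norm_mult field_simps)
  qed
  have C: "C \<ge> 0" unfolding C_def by (intro add_nonneg_nonneg integral_nonneg integrable_continuous_real continuous_intros cp) auto
  have diff: "norm (integral {a..b} (\<lambda>x. H x * cis (\<xi> * x)) - integral {a..b} (\<lambda>x. p x * cis (\<xi> * x))) \<le> e / 2" for \<xi>
  proof -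
    have "integral {a..b} (\<lambda>x. H x * cis (\<xi> * x)) - integral {a..b} (\<lambda>x. p x * cis (\<xi> * x))
        = integral {a..b} (\<lambda>x. (H x - p x) * cis (\<xi> * x))"
      by (subst Henstock_Kurzweil_Integration.integral_diff[symmetric])
         (auto intro!: integrable_continuous_real continuous_intros cp H simp: left_diff_distrib)
    also have "norm \<dots> \<le> d * (b - a)"
      by (rule integral_bound[OF ab])
         (use pH in \<open>auto intro!: continuous_intros cp H less_imp_le simp: norm_mult\<close>)
    also have "\<dots> \<le> e / 2" using e ab by (simp add: d_def field_simps)
    finally show ?thesis .
  qed
  show "\<forall>\<^sub>F \<xi> in at_infinity. dist (integral {a..b} (\<lambda>x. H x * cis (\<xi> * x))) 0 < e"
    unfolding eventually_at_infinity
  proof (intro exI[of _ "2 * C / e + 1"] allI impI)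
    fix \<xi> :: real assume \<xi>: "norm \<xi> \<ge> 2 * C / e + 1"
    have pos: "\<bar>\<xi>\<bar> > 2 * C / e" "\<bar>\<xi>\<bar> > 0" using \<xi> divide_nonneg_pos[of "2 * C" e] C e unfolding real_norm_def by linarith+
    have "C / \<bar>\<xi>\<bar> < e / 2" using pos e by (simp add: field_simps)
    moreover have "\<xi> \<noteq> 0" using pos by simp
    ultimately show "dist (integral {a..b} (\<lambda>x. H x * cis (\<xi> * x))) 0 < e"
      using pbound[of \<xi>] diff[of \<xi>] \<open>\<xi> \<noteq> 0\<close>
        norm_triangle_sub[of "integral {a..b} (\<lambda>x. H x * cis (\<xi> * x))" "integral {a..b} (\<lambda>x. p x * cis (\<xi> * x))"]
      unfolding dist_norm diff_zero by linarith
  qed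
qed

text \<open>Chernoff's argument: dividing \<open>\<phi> - \<phi> 0\<close> by \<open>cis (2 * pi * x) - 1\<close> turns the partial sums of the
  Fourier series into a telescoping sum, whose two end terms vanish by Riemann--Lebesgue.\<close>
lemma fourier_series_at_0:
  fixes \<phi> :: "real \<Rightarrow> complex"
  assumes cont: "continuous_on {0..1} \<phi>" and per: "\<phi> 0 = \<phi> 1"
    and d0: "(\<phi> has_vector_derivative d0) (at 0 within {0..1})"
    and d1: "(\<phi> has_vector_derivative d1) (at 1 within {0..1})"
  shows "(\<lambda>J. \<Sum>j\<in>{-int J..int J}. integral {0..1} (\<lambda>x. \<phi> x * cis (-(2 * pi * j) * x)))
           \<longlonglongrightarrow> \<phi> 0"
proof -
  define q where "q x = cis (2 * pi * x) - 1" for x :: real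
  \<comment> \<open>\<open>q\<close> vanishes at both ends of the interval, with derivative
    \<open>2 * pi * \<i>\<close> there, and by \<open>per\<close> so does the numerator; the two end
    values are the limits of the quotient.\<close>
  define H where "H x = (if x = 0 then d0 / (2 * pi * \<i>) else if x = 1 then d1 / (2 * pi * \<i>)
     else (\<phi> x - \<phi> 0) / q x)" for x
  have q0: "q x \<noteq> 0" if "x \<in> {0<..<1}" for x
  proof
    assume "q x = 0"
    then have "cis (2 * pi * x) = 1" by (simp add: q_def)
    then have "cos (2 * pi * x) = 1" by (metis cis.sel(1) one_complex.sel(1))
    then obtain n :: int where "2 * pi * x = n * 2 * pi" by (auto simp: cos_one_2pi_int)
    then have "x = n" by simp
    with that have "0 < n" "n < 1" by simp_all
    then show False by linarith
  qed
  have qd: "(q has_vector_derivative 2 * pi * \<i> * cis (2 * pi * x)) (at x within S)" for x S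
    using has_vector_derivative_diff_const[of "\<lambda>x. cis (2 * pi * x)" 1] has_vector_derivative_cis[of "2 * pi" x S]
    unfolding q_def by (simp add: mult_ac)
  have lim: "((\<lambda>x. (\<phi> x - \<phi> 0) / q x) \<longlongrightarrow> d / (2 * pi * \<i>)) (at z within {0..1})"
    if dz: "(\<phi> has_vector_derivative d) (at z within {0..1})" and z: "z = 0 \<or> z = 1" for z d
  proof -
    have qz: "q z = 0" "cis (2 * pi * z) = 1" and pz: "\<phi> z = \<phi> 0"
      using z per by (auto simp: q_def)
    have "((\<lambda>x. (\<phi> x - \<phi> z) /\<^sub>R (x - z)) \<longlongrightarrow> d) (at z within {0..1})"
      by (rule tendsto_vector_difference_quotient[OF dz])
    moreover have "((\<lambda>x. (q x - q z) /\<^sub>R (x - z)) \<longlongrightarrow> 2 * pi * \<i> * cis (2 * pi * z)) (at z within {0..1})"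
      by (rule tendsto_vector_difference_quotient[OF qd])
    ultimately have "((\<lambda>x. ((\<phi> x - \<phi> z) /\<^sub>R (x - z)) / ((q x - q z) /\<^sub>R (x - z))) \<longlongrightarrow>
        d / (2 * pi * \<i> * cis (2 * pi * z))) (at z within {0..1})"
      by (rule tendsto_divide) (simp add: qz)
    then have "((\<lambda>x. ((\<phi> x - \<phi> 0) /\<^sub>R (x - z)) / (q x /\<^sub>R (x - z))) \<longlongrightarrow>
        d / (2 * pi * \<i>)) (at z within {0..1})" by (simp add: qz pz)
    then show ?thesis
      by (rule Lim_transform_eventually) (auto simp: eventually_at_filter scaleR_conv_of_real)
  qed
  have contH: "continuous_on {0..1} H"
    unfolding continuous_on_eq_continuous_within
  proof
    fix z :: real assume z: "z \<in> {0..1}"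
    show "continuous (at z within {0..1}) H"
    proof (cases "z = 0 \<or> z = 1")
      case True
      have ev: "\<forall>\<^sub>F x in at z within {0..1}. (\<phi> x - \<phi> 0) / q x = H x"
        unfolding eventually_at
        by (rule exI[of _ "1/2"]) (use True in \<open>auto simp: H_def dist_real_def\<close>)
      have "((\<lambda>x. (\<phi> x - \<phi> 0) / q x) \<longlongrightarrow> H z) (at z within {0..1})"
        using True lim[OF d0] lim[OF d1] by (auto simp: H_def)
      then have "(H \<longlongrightarrow> H z) (at z within {0..1})"
        using ev by (rule Lim_transform_eventually)
      then show ?thesis by (simp add: continuous_within)
    next
      case False
      then have zin: "z \<in> {0<..<1}" using z by auto
      have "continuous_on {0<..<1} (\<lambda>x. (\<phi> x - \<phi> 0) / q x)"
        using q0 by (intro continuous_intros continuous_on_subset[OF cont])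
          (auto simp: q_def intro!: continuous_intros)
      then have "continuous_on {0<..<1} H"
        by (rule continuous_on_eq) (auto simp: H_def)
      then have "isCont H z" using zin by (simp add: continuous_on_eq_continuous_at)
      then show ?thesis by (rule continuous_at_imp_continuous_within)
    qed
  qed
  define c where "c \<xi> = integral {0..1} (\<lambda>x. H x * cis (\<xi> * x))" for \<xi>
  have fac: "\<phi> x = \<phi> 0 + q x * H x" if "x \<in> {0..1}" for x
    using that q0[of x] per by (cases "x = 0 \<or> x = 1") (auto simp: H_def q_def)
  have const: "integral {0..1} (\<lambda>x. cis (-(2 * pi * j) * x)) = (if j = 0 then 1 else 0)" for j :: int
  proof (cases "j = 0")
    case False
    have "((\<lambda>x. \<i> * of_real (-(2 * pi * j)) * cis (-(2 * pi * j) * x)) has_integral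
      (cis (-(2 * pi * j) * 1) - cis (-(2 * pi * j) * 0))) {0..1}"
      by (intro fundamental_theorem_of_calculus has_vector_derivative_cis) auto
    moreover have "cis (2 * pi * of_int j) = 1"
      using cis_multiple_2pi[of "of_int j"] by simp
    then have "cis (-(2 * pi * j) * 1) = 1" by (simp flip: cis_inverse)
    ultimately have "((\<lambda>x. \<i> * of_real (-(2 * pi * j)) * cis (-(2 * pi * j) * x)) has_integral 0) {0..1}"
      by (simp only: cis_zero mult_zero_right diff_self)
    from integral_unique[OF this]
    have "\<i> * of_real (-(2 * pi * j)) * integral {0..1} (\<lambda>x. cis (-(2 * pi * j) * x)) = 0"
      unfolding integral_mult_right .
    with False show ?thesis by simp
  qed simp
  have coeff: "integral {0..1} (\<lambda>x. \<phi> x * cis (-(2 * pi * j) * x)) =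
     (if j = 0 then \<phi> 0 else 0) + (c (-(2 * pi * (j - 1))) - c (-(2 * pi * j)))" for j :: int
  proof -
    have "integral {0..1} (\<lambda>x. \<phi> x * cis (-(2 * pi * j) * x)) =
      integral {0..1} (\<lambda>x. \<phi> 0 * cis (-(2 * pi * j) * x) +
        (H x * cis (-(2 * pi * (j - 1)) * x) - H x * cis (-(2 * pi * j) * x)))"
    proof (rule integral_cong)
      fix x :: real assume x: "x \<in> {0..1}"
      \<comment> \<open>Multiplying by \<open>q\<close> amounts to subtracting a coefficient of
        \<open>H\<close> from the one whose frequency is shifted by \<open>2 * pi\<close>, which is
        what telescopes in \<open>tele\<close>.\<close>
      have eq: "cis (-(2 * pi * (j - 1)) * x) = cis (2 * pi * x) * cis (-(2 * pi * j) * x)"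
        by (simp add: cis_mult algebra_simps)
      show "\<phi> x * cis (-(2 * pi * j) * x) = \<phi> 0 * cis (-(2 * pi * j) * x) +
        (H x * cis (-(2 * pi * (j - 1)) * x) - H x * cis (-(2 * pi * j) * x))"
        unfolding eq by (subst fac[OF x]) (simp only: q_def ring_distribs mult_ac mult_1_right mult_1_left)
    qed
    have i1: "(\<lambda>x. \<phi> 0 * cis (r * x)) integrable_on {0..1}" for r
      by (intro integrable_continuous_real continuous_intros)
    have i2: "(\<lambda>x. H x * cis (r * x)) integrable_on {0..1}" for r
      by (intro integrable_continuous_real continuous_intros contH)
    note \<open>integral {0..1} (\<lambda>x. \<phi> x * cis (-(2 * pi * j) * x)) = _\<close>
    also have "integral {0..1} (\<lambda>x. \<phi> 0 * cis (-(2 * pi * j) * x) +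
        (H x * cis (-(2 * pi * (j - 1)) * x) - H x * cis (-(2 * pi * j) * x))) = \<phi> 0 * integral {0..1} (\<lambda>x. cis (-(2 * pi * j) * x)) +
        (c (-(2 * pi * (j - 1))) - c (-(2 * pi * j)))"
      unfolding c_def
      by (simp only: Henstock_Kurzweil_Integration.integral_add[OF i1 integrable_diff[OF i2 i2]]
          Henstock_Kurzweil_Integration.integral_diff[OF i2 i2] integral_mult_right)
    finally show ?thesis unfolding const by simp
  qed
  have tele: "(\<Sum>j\<in>{-int J..int J}. c (-(2 * pi * (j - 1))) - c (-(2 * pi * j)))
      = c (2 * pi * (1 + real J)) - c (-(2 * pi * real J))" for J
  proof (induction J)
    case (Suc J)
    have "{-int (Suc J)..int (Suc J)} = insert (-int (Suc J)) (insert (int (Suc J)) {-int J..int J})"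
      by auto
    then show ?case using Suc by (simp add: algebra_simps)
  qed (simp add: algebra_simps)
  have rl: "(c \<longlongrightarrow> 0) at_infinity"
    unfolding c_def by (rule riemann_lebesgue[OF contH]) simp
  have f1: "filterlim (\<lambda>J. 2 * pi * (1 + real J)) at_infinity sequentially"
    by (intro filterlim_at_top_imp_at_infinity filterlim_tendsto_pos_mult_at_top[OF tendsto_const]
        filterlim_at_top_add_at_top filterlim_real_sequentially filterlim_tendsto_add_at_top[OF tendsto_const]) auto
  have f2: "filterlim (\<lambda>J. -(2 * pi * real J)) at_infinity sequentially"
    by (intro filterlim_at_bot_imp_at_infinity filterlim_uminus_at_bot_at_top[THEN filterlim_compose]
        filterlim_tendsto_pos_mult_at_top[OF tendsto_const] filterlim_real_sequentially) auto
  have "(\<lambda>J. \<phi> 0 + (c (2 * pi * (1 + real J)) - c (-(2 * pi * real J)))) \<longlonglongrightarrow> \<phi> 0 + (0 - 0)"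
    by (intro tendsto_intros filterlim_compose[OF rl f1] filterlim_compose[OF rl f2])
  moreover have "(\<Sum>j\<in>{-int J..int J}. integral {0..1} (\<lambda>x. \<phi> x * cis (-(2 * pi * j) * x)))
     = \<phi> 0 + (c (2 * pi * (1 + real J)) - c (-(2 * pi * real J)))" for J
    unfolding coeff sum.distrib tele by (simp add: sum.delta)
  ultimately show ?thesis by simp
qed


lemma integral_eq_sum_unit_intervals:
  fixes F :: "real \<Rightarrow> complex"
  assumes "continuous_on UNIV F"
  shows "integral {a..a + real k} F = (\<Sum>n<k. integral {0..1} (\<lambda>x. F (x + (a + real n))))"
proof (induction k)
  case (Suc k)
  have "integral {a..a + real (Suc k)} F
      = integral {a..a + real k} F + integral {a + real k..a + real (Suc k)} F"
    by (rule Henstock_Kurzweil_Integration.integral_combine[symmetric])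
       (auto intro!: integrable_continuous_real continuous_on_subset[OF assms])
  also have "integral {a + real k..a + real (Suc k)} F = integral {0..1} (\<lambda>x. F (x + (a + real k)))"
    using integral_shift_Icc_real[of 0 1 F "a + real k"]
    by (simp add: algebra_simps o_def)
  finally show ?case using Suc by simp
qed simp

text \<open>The sum of the \<open>2 * M\<close> unit translates of \<open>f\<close> that tile the
  interval takes the place of the periodisation. Its values at 0 and 1 differ by the telescoping sum
  \<open>f M - f (- M)\<close>, which \<open>ends\<close> makes zero, and differentiability supplies
  the one-sided derivatives for \<open>fourier_series_at_0\<close>.\<close>

theorem poisson_summation:
  fixes f :: "real \<Rightarrow> complex" and M :: nat
  assumes diff: "\<And>x. f differentiable at x"
    and ends: "f (- real M) = 0" "f (real M) = 0"
  shows "(\<lambda>J. \<Sum>j\<in>{-int J..int J}. integral {- real M..real M} (\<lambda>x. f x * cis (-(2 * pi * j) * x)))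
           \<longlonglongrightarrow> (\<Sum>n<2 * M. f (real n - real M))"
proof -
  define \<Phi> where "\<Phi> x = (\<Sum>n<2 * M. f (x + (- real M + real n)))" for x
  have contf: "continuous_on UNIV f"
    using diff by (simp add: differentiable_imp_continuous_on differentiable_on_def)
  have contT: "continuous_on A (\<lambda>x. f (x + b))" for A b
    by (rule continuous_on_compose2[OF contf]) (auto intro!: continuous_intros)
  have dPhi: "\<Phi> differentiable (at x within S)" for x S
  proof -
    have "(\<lambda>x. f (x + b)) differentiable at x within S" for b
      by (rule differentiable_compose[OF differentiable_at_withinI[OF diff]])
         (auto intro!: derivative_intros)
    then show ?thesis unfolding \<Phi>_def by (intro differentiable_sum) auto
  qed
  have "\<Phi> 1 - \<Phi> 0 = (\<Sum>n<2 * M. f (- real M + real (Suc n)) - f (- real M + real n))"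
    unfolding \<Phi>_def sum_subtractf by (simp add: algebra_simps)
  also have "\<dots> = f (- real M + real (2 * M)) - f (- real M + real 0)"
    by (rule sum_lessThan_telescope)
  finally have per: "\<Phi> 0 = \<Phi> 1" using ends by simp
  have "(\<lambda>J. \<Sum>j\<in>{-int J..int J}. integral {0..1} (\<lambda>x. \<Phi> x * cis (-(2 * pi * j) * x))) \<longlonglongrightarrow> \<Phi> 0"
    by (rule fourier_series_at_0[OF _ per vector_derivative_works[THEN iffD1, OF dPhi]
          vector_derivative_works[THEN iffD1, OF dPhi]])
       (auto intro!: dPhi differentiable_imp_continuous_on simp: differentiable_on_def)
  moreover have "integral {0..1} (\<lambda>x. \<Phi> x * cis (-(2 * pi * j) * x))
      = integral {- real M..real M} (\<lambda>x. f x * cis (-(2 * pi * j) * x))" for j :: int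
  proof -
    have shift: "cis (-(2 * pi * j) * x) = cis (-(2 * pi * j) * (x + (- real M + real n)))" for x and n :: nat
    proof -
      have "cis (-(2 * pi * j) * (- real M + real n)) = cis (2 * pi * of_int (j * (int M - int n)))"
        by (simp add: algebra_simps)
      also have "\<dots> = 1" by (rule cis_multiple_2pi) auto
      finally have one: "cis (-(2 * pi * j) * (- real M + real n)) = 1" .
      have "cis (-(2 * pi * j) * (x + (- real M + real n)))
          = cis (-(2 * pi * j) * x) * cis (-(2 * pi * j) * (- real M + real n))"
        unfolding cis_mult by (rule arg_cong[where f = cis], rule distrib_left)
      then show ?thesis unfolding one by (simp only: mult_1_right)
    qed
    have eq: "(\<lambda>x. \<Phi> x * cis (-(2 * pi * j) * x)) =
       (\<lambda>x. \<Sum>n<2 * M. f (x + (- real M + real n)) * cis (-(2 * pi * j) * (x + (- real M + real n))))"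
      unfolding \<Phi>_def sum_distrib_right by (intro ext sum.cong refl arg_cong2[where f = "(*)"] shift)
    have "integral {0..1} (\<lambda>x. \<Phi> x * cis (-(2 * pi * j) * x)) = (\<Sum>n<2 * M.
      integral {0..1} (\<lambda>x. f (x + (- real M + real n)) * cis (-(2 * pi * j) * (x + (- real M + real n)))))"
      unfolding eq by (intro integral_sum integrable_continuous_real continuous_intros contT finite_lessThan)
    also have "\<dots> = integral {- real M..- real M + real (2 * M)} (\<lambda>x. f x * cis (-(2 * pi * j) * x))"
      by (rule integral_eq_sum_unit_intervals[where F = "\<lambda>x. f x * cis (-(2 * pi * j) * x)", symmetric])
         (intro continuous_intros contf)
    finally show ?thesis by simp
  qed
  moreover have "\<Phi> 0 = (\<Sum>n<2 * M. f (real n - real M))"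
    by (simp add: \<Phi>_def)
  ultimately show ?thesis by simp
qed

section \<open>The perfect B-spline and its Fourier moments\<close>

text \<open>The real parts of the 2s-th roots of unity: \<open>k\<close> and
  \<open>2 * s - k\<close> give the same point, and for \<open>k \<le> s\<close> these are the
  extremal points of the Chebyshev polynomial of degree \<open>s\<close>.\<close>

definition node :: "nat \<Rightarrow> nat \<Rightarrow> real" where
  "node s k = cos (real k * (pi / real s))"

lemma abs_node_le_1: "\<bar>node s k\<bar> \<le> 1"
  by (simp add: node_def)

section \<open>Alternating power sums over the nodes\<close>

lemma sum_cis_root_of_unity:
  assumes a: "a \<le> 2 * s" and s: "s > 0"
  shows "(\<Sum>k<2 * s. cis (real k * (pi * real a / real s))) = (if a = 0 \<or> a = 2 * s then 2 * of_nat s else 0)"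
proof -
  define r where "r = cis (pi * real a / real s)"
  have rk: "cis (real k * (pi * real a / real s)) = r ^ k" for k
    unfolding r_def by (rule Complex.DeMoivre[symmetric])
  show ?thesis
  proof (cases "a = 0 \<or> a = 2 * s")
    case True
    then have "pi * real a / real s = 0 \<or> pi * real a / real s = 2 * pi" using s by auto
    then have "r = 1" unfolding r_def by (elim disjE) (simp_all only: cis_zero cis_2pi)
    then show ?thesis using True unfolding rk by simp
  next
    case False
    have "r \<noteq> 1"
    proof
      assume "r = 1"
      then have "cos (pi * real a / real s) = 1" unfolding r_def by (metis cis.sel(1) one_complex.sel(1))
      then obtain n :: int where "pi * real a / real s = n * 2 * pi" by (auto simp: cos_one_2pi_int)
      then have "pi * real a = pi * (n * 2 * real s)" using s by (simp add: field_simps)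
      then have "real a = real_of_int (n * 2 * int s)" by simp
      then have "real_of_int (int a) = real_of_int (n * (2 * int s))" by simp
      then have n: "int a = n * (2 * int s)" unfolding of_int_eq_iff .
      have pos: "0 < 2 * int s" using s by simp
      have "0 * (2 * int s) < n * (2 * int s)" "n * (2 * int s) < 1 * (2 * int s)"
        using False a by (simp_all add: n[symmetric])
      then have "0 < n" "n < 1" unfolding mult_less_cancel_right_pos[OF pos] by simp_all
      then show False by simp
    qed
    moreover have "r ^ (2 * s) = 1"
    proof -
      have "real (2 * s) * (pi * real a / real s) = 2 * pi * real a" using s by simp
      then have "r ^ (2 * s) = cis (2 * pi * real a)"
        unfolding r_def by (subst Complex.DeMoivre) (simp only:)
      also have "\<dots> = 1" by (rule cis_multiple_2pi) auto
      finally show ?thesis .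
    qed
    ultimately have "(\<Sum>k<2 * s. r ^ k) = 0"
      by (simp add: geometric_sum)
    then show ?thesis using False unfolding rk by simp
  qed
qed

text \<open>The sign is \<open>cis (k * pi)\<close> and twice the node is
  \<open>cis \<theta> + cis (-\<theta>)\<close>, so the binomial expansion yields the frequencies
  \<open>2 * q + s - p\<close> in units of \<open>pi / s\<close>. They lie between 0 and
  \<open>2 * s\<close>, and only the two extremes survive the sum over roots of unity; both require
  \<open>p = s\<close>.\<close>

lemma alternating_node_power:
  assumes p: "p \<le> s" and s: "s > 0"
  shows "complex_of_real (\<Sum>k<2 * s. (-1) ^ k * (2 * node s k) ^ p) =
    (\<Sum>q\<le>p. of_nat (p choose q) *
       (if 2 * q + s - p = 0 \<or> 2 * q + s - p = 2 * s then 2 * of_nat s else 0))"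
proof -
  have "complex_of_real ((-1) ^ k * (2 * node s k) ^ p) =
     (\<Sum>q\<le>p. of_nat (p choose q) * cis (real k * (pi * real (2 * q + s - p) / real s)))" for k
  proof -
    define \<theta> where "\<theta> = real k * (pi / real s)"
    have "complex_of_real (2 * node s k) = cis \<theta> + cis (-\<theta>)"
      by (simp add: node_def \<theta>_def complex_eq_iff)
    then have "complex_of_real ((2 * node s k) ^ p) = (cis \<theta> + cis (-\<theta>)) ^ p"
      by (simp only: of_real_power)
    also have "\<dots> = (\<Sum>q\<le>p. of_nat (p choose q) * cis \<theta> ^ q * cis (-\<theta>) ^ (p - q))"
      by (rule binomial_ring)
    finally have e1: "complex_of_real ((2 * node s k) ^ p) = \<dots>" .
    have sgn: "(-1::complex) ^ k = cis (real k * pi)" by (simp only: Complex.DeMoivre[symmetric] cis_pi)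
    have term_eq: "cis (real k * pi) * (of_nat (p choose q) * cis \<theta> ^ q * cis (-\<theta>) ^ (p - q))
       = of_nat (p choose q) * cis (real k * (pi * real (2 * q + s - p) / real s))" if "q \<le> p" for q
    proof -
      have "real k * pi + (real q * \<theta> + real (p - q) * (-\<theta>)) = real k * (pi * real (2 * q + s - p) / real s)"
        using that p s by (simp add: \<theta>_def of_nat_diff field_simps)
      then have "cis (real k * pi) * (cis \<theta> ^ q * cis (-\<theta>) ^ (p - q)) = cis (real k * (pi * real (2 * q + s - p) / real s))"
        unfolding Complex.DeMoivre cis_mult by (simp only:)
      then show ?thesis by (simp only: mult.assoc mult.left_commute[of "cis (real k * pi)"])
    qed
    have "complex_of_real ((-1) ^ k * (2 * node s k) ^ p) = (-1) ^ k * complex_of_real ((2 * node s k) ^ p)"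
      by simp
    also have "\<dots> = (\<Sum>q\<le>p. cis (real k * pi) * (of_nat (p choose q) * cis \<theta> ^ q * cis (-\<theta>) ^ (p - q)))"
      unfolding e1 sgn sum_distrib_left ..
    also have "\<dots> = (\<Sum>q\<le>p. of_nat (p choose q) * cis (real k * (pi * real (2 * q + s - p) / real s)))"
      by (intro sum.cong refl term_eq) simp
    finally show ?thesis .
  qed
  then have "complex_of_real (\<Sum>k<2 * s. (-1) ^ k * (2 * node s k) ^ p) =
    (\<Sum>k<2 * s. \<Sum>q\<le>p. of_nat (p choose q) * cis (real k * (pi * real (2 * q + s - p) / real s)))"
    unfolding of_real_sum by (intro sum.cong refl)
  also have "\<dots> = (\<Sum>q\<le>p. of_nat (p choose q) * (\<Sum>k<2 * s. cis (real k * (pi * real (2 * q + s - p) / real s))))"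
    unfolding sum_distrib_left by (rule sum.swap)
  also have "\<dots> = (\<Sum>q\<le>p. of_nat (p choose q) *
       (if 2 * q + s - p = 0 \<or> 2 * q + s - p = 2 * s then 2 * of_nat s else 0))"
    by (intro sum.cong refl arg_cong2[where f = "(*)"] sum_cis_root_of_unity s) (use p in auto)
  finally show ?thesis .
qed

lemma alternating_node_power_eq_0:
  assumes "p < s"
  shows "(\<Sum>k<2 * s. (-1) ^ k * node s k ^ p) = 0"
proof -
  have "complex_of_real (\<Sum>k<2 * s. (-1) ^ k * (2 * node s k) ^ p) = 0"
    by (subst alternating_node_power) (use assms in \<open>auto intro!: sum.neutral\<close>)
  then have "(\<Sum>k<2 * s. (-1) ^ k * (2 * node s k) ^ p) = 0"
    by (simp only: of_real_eq_0_iff)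
  moreover have "(\<Sum>k<2 * s. (-1) ^ k * (2 * node s k) ^ p) = 2 ^ p * (\<Sum>k<2 * s. (-1) ^ k * node s k ^ p)"
    by (simp add: power_mult_distrib sum_distrib_left mult_ac)
  ultimately show ?thesis by simp
qed

lemma alternating_node_power_self:
  assumes "s > 0"
  shows "(\<Sum>k<2 * s. (-1) ^ k * node s k ^ s) = 4 * real s / 2 ^ s"
proof -
  have "complex_of_real (\<Sum>k<2 * s. (-1) ^ k * (2 * node s k) ^ s) =
     (\<Sum>q\<le>s. of_nat (s choose q) * (if q = 0 \<or> q = s then 2 * of_nat s else 0))"
    by (subst alternating_node_power) (use assms in auto)
  also have "\<dots> = (\<Sum>q\<in>{0, s}. of_nat (s choose q) * (if q = 0 \<or> q = s then 2 * of_nat s else 0))"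
    by (rule sum.mono_neutral_right) auto
  also have "\<dots> = complex_of_real (4 * real s)"
    using assms by simp
  finally have "(\<Sum>k<2 * s. (-1) ^ k * (2 * node s k) ^ s) = 4 * real s"
    by (simp only: of_real_eq_iff)
  moreover have "(\<Sum>k<2 * s. (-1) ^ k * (2 * node s k) ^ s) = 2 ^ s * (\<Sum>k<2 * s. (-1) ^ k * node s k ^ s)"
    by (simp add: power_mult_distrib sum_distrib_left mult_ac)
  ultimately show ?thesis by (simp add: field_simps)
qed

text \<open>Translated form of the vanishing moments. It removes the boundary terms at 1 in the
  integrations by parts, makes the spline vanish to the right of 1, and gives its symmetry.\<close>

lemma alternating_diff_node_power_eq_0:
  assumes "p < s"
  shows "(\<Sum>k<2 * s. (-1) ^ k * (x - node s k) ^ p) = 0"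
proof -
  have "(\<Sum>k<2 * s. (-1) ^ k * (x - node s k) ^ p)
    = (\<Sum>k<2 * s. \<Sum>q\<le>p. (-1) ^ k * (of_nat (p choose q) * (- node s k) ^ q * x ^ (p - q)))"
    by (subst diff_conv_add_uminus, subst add.commute, subst binomial_ring) (simp add: sum_distrib_left)
  also have "\<dots> = (\<Sum>q\<le>p. of_nat (p choose q) * (-1) ^ q * x ^ (p - q) * (\<Sum>k<2 * s. (-1) ^ k * node s k ^ q))"
    unfolding sum_distrib_left
    by (subst sum.swap, intro sum.cong refl, subst power_minus) (simp add: mult_ac)
  also have "\<dots> = 0"
    using assms by (intro sum.neutral ballI) (simp add: alternating_node_power_eq_0)
  finally show ?thesis .
qed

lemma alternating_one_diff_node_power_self:
  assumes "s > 0" "even s"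
  shows "(\<Sum>k<2 * s. (-1) ^ k * (1 - node s k) ^ s) = 4 * real s / 2 ^ s"
proof -
  have "(\<Sum>k<2 * s. (-1) ^ k * (1 - node s k) ^ s)
    = (\<Sum>k<2 * s. \<Sum>q\<le>s. (-1) ^ k * (of_nat (s choose q) * (- node s k) ^ q * 1 ^ (s - q)))"
    by (subst diff_conv_add_uminus, subst add.commute, subst binomial_ring) (simp add: sum_distrib_left)
  also have "\<dots> = (\<Sum>q\<le>s. of_nat (s choose q) * (-1) ^ q * (\<Sum>k<2 * s. (-1) ^ k * node s k ^ q))"
    unfolding sum_distrib_left
    by (subst sum.swap, intro sum.cong refl, subst power_minus) (simp add: mult_ac)
  also have "\<dots> = (\<Sum>q\<in>{s}. of_nat (s choose q) * (-1) ^ q * (\<Sum>k<2 * s. (-1) ^ k * node s k ^ q))"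
    by (rule sum.mono_neutral_right) (auto simp: alternating_node_power_eq_0)
  finally show ?thesis
    using assms alternating_node_power_self[of s] by simp
qed

section \<open>Pointwise bounds for the splines of degree 0 and 1\<close>

lemma node_less_cos_iff:
  assumes s: "s > 0" and \<phi>: "0 \<le> \<phi>" and j: "real j * (pi / real s) \<le> \<phi>" "\<phi> < real (Suc j) * (pi / real s)"
    and js: "j < s" and k: "k < 2 * s"
  shows "node s k < cos \<phi> \<longleftrightarrow> j < k \<and> k + j < 2 * s"
proof -
  define u where "u = pi / real s"
  have u: "u > 0" and us: "real s * u = pi" using s by (auto simp: u_def)
  have "real (Suc j) * u \<le> real s * u"
    using js u by (intro mult_right_mono) auto
  then have \<phi>\<pi>: "\<phi> < pi" using j us by (simp add: u_def)
  have low: "node s i < cos \<phi> \<longleftrightarrow> j < i" if "i \<le> s" for i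
  proof -
    have "real i * u \<le> real s * u" using that u by (intro mult_right_mono) auto
    then have i\<pi>: "real i * u \<le> pi" using us by simp
    have "node s i < cos \<phi> \<longleftrightarrow> \<phi> < real i * u"
      unfolding node_def u_def[symmetric] using \<phi> \<phi>\<pi> i\<pi> u by (intro cos_mono_less_eq) auto
    also have "\<dots> \<longleftrightarrow> j < i"
    proof
      assume "\<phi> < real i * u"
      then have "real j * u < real i * u" using j by (simp add: u_def)
      then show "j < i" using u by simp
    next
      assume "j < i"
      then have "real (Suc j) * u \<le> real i * u" using u by (intro mult_right_mono) auto
      then show "\<phi> < real i * u" using j by (simp add: u_def)
    qed
    finally show ?thesis .
  qed
  show ?thesis
  proof (cases "k \<le> s")
    case True
    then show ?thesis using low[of k] js by auto
  next
    case False
    \<comment> \<open>Beyond \<open>s\<close> the nodes run back along the interval, so the question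
      is reduced to the mirrored index. The nodes to the left of \<open>cos \<phi>\<close> thus form
      a block of consecutive indices symmetric about \<open>s\<close>.\<close>
    have "real k * u = 2 * pi - real (2 * s - k) * u"
      using k us by (simp add: of_nat_diff algebra_simps)
    then have "node s k = node s (2 * s - k)"
      unfolding node_def u_def[symmetric] by simp
    then show ?thesis using low[of "2 * s - k"] False k js by auto
  qed
qed

lemma sum_alternating_sign: "(\<Sum>k\<in>{a..<a + (2 * n + 1)}. (-1) ^ k) = ((-1) ^ a :: real)"
  by (induction n) (auto simp: sum.atLeastLessThan_Suc)

text \<open>The factor \<open>2 * cos (\<beta> / 2)\<close> splits each cosine into its two shifts
  by half a step, and the alternating signs make these telescope.\<close>

lemma sum_alternating_cos:
  "(\<Sum>k\<in>{a..<a + m}. (-1) ^ k * cos (real k * \<beta>)) * (2 * cos (\<beta> / 2))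
    = (-1) ^ a * cos ((real a - 1 / 2) * \<beta>) - (-1) ^ (a + m) * cos ((real (a + m) - 1 / 2) * \<beta>)"
proof (induction m)
  case (Suc m)
  have "cos (real (a + m) * \<beta>) * (2 * cos (\<beta> / 2)) =
     cos ((real (a + m) - 1 / 2) * \<beta>) + cos ((real (a + Suc m) - 1 / 2) * \<beta>)"
  proof -
    have "cos ((real (a + m) - 1 / 2) * \<beta>) = cos (real (a + m) * \<beta> - \<beta> / 2)"
         "cos ((real (a + Suc m) - 1 / 2) * \<beta>) = cos (real (a + m) * \<beta> + \<beta> / 2)"
      by (rule arg_cong[where f = cos], simp add: algebra_simps)+
    then show ?thesis by (simp only: cos_add cos_diff)
  qed
  with Suc show ?case by (simp add: algebra_simps)
qed simp

text \<open>The strict inequality gives \<open>trunc_pow 0 0 = 0\<close>, so that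
  \<open>spline s 0\<close> sees exactly the nodes strictly to the left of its argument.\<close>

definition trunc_pow :: "nat \<Rightarrow> real \<Rightarrow> real" where
  "trunc_pow m y = (if y > 0 then y ^ m / fact m else 0)"

text \<open>\<open>spline s (s - 1)\<close> is the perfect B-spline and \<open>spline s m\<close> its derivative of order \<open>s - 1 - m\<close>.
  The index \<open>k\<close> runs once around the circle, so every inner node is counted twice.\<close>
definition spline :: "nat \<Rightarrow> nat \<Rightarrow> real \<Rightarrow> real" where
  "spline s m x = (\<Sum>k<2 * s. (-1) ^ k * trunc_pow m (x - node s k))"

lemma obtain_angle_cell:
  assumes s: "s > 0" and x: "-1 < x" "x \<le> 1"
  obtains \<phi> j where "x = cos \<phi>" "0 \<le> \<phi>" "real j * (pi / real s) \<le> \<phi>"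
    "\<phi> < real (Suc j) * (pi / real s)" "j < s"
proof -
  define \<phi> where "\<phi> = arccos x"
  define u where "u = pi / real s"
  define j where "j = nat \<lfloor>\<phi> / u\<rfloor>"
  have u: "u > 0" and us: "real s * u = pi" using s by (auto simp: u_def)
  have \<phi>: "x = cos \<phi>" "0 \<le> \<phi>" "\<phi> < pi"
    using x arccos_less_arccos[of "-1" x] by (auto simp: \<phi>_def arccos_lbound)
  have q: "\<phi> / u \<ge> 0" using \<phi> u by simp
  have j1: "real j \<le> \<phi> / u" "\<phi> / u < real j + 1"
    using q by (auto simp: j_def)
  have "real j * u \<le> \<phi>" "\<phi> < real (Suc j) * u"
    using j1 u by (simp_all add: field_simps)
  moreover have "j < s"
  proof -
    have "real j * u < real s * u" using \<open>real j * u \<le> \<phi>\<close> \<phi> us by simp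
    then show ?thesis using u by simp
  qed
  ultimately show ?thesis using \<phi> unfolding u_def by (intro that)
qed

text \<open>The contributing indices form a block of odd length, so the alternating signs add up to
  a single sign. The value is therefore 1 or -1 throughout, which is what makes the B-spline
  perfect.\<close>

lemma abs_spline_0_le:
  assumes s: "s > 0" and x: "-1 < x" "x \<le> 1"
  shows "\<bar>spline s 0 x\<bar> \<le> 1"
proof -
  obtain \<phi> j where *: "x = cos \<phi>" "0 \<le> \<phi>" "real j * (pi / real s) \<le> \<phi>"
    "\<phi> < real (Suc j) * (pi / real s)" "j < s" using obtain_angle_cell[OF s x] .
  have "spline s 0 x = (\<Sum>k<2 * s. if j < k \<and> k + j < 2 * s then (-1) ^ k else 0)"
    unfolding spline_def trunc_pow_def using node_less_cos_iff[OF s *(2-5)] *(1)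
    by (intro sum.cong) auto
  also have "\<dots> = (\<Sum>k\<in>{Suc j..<Suc j + (2 * (s - 1 - j) + 1)}. (-1) ^ k)"
    unfolding sum.inter_filter[symmetric, OF finite_lessThan]
    using *(5) by (intro sum.cong) auto
  also have "\<dots> = (-1) ^ Suc j" by (rule sum_alternating_sign)
  finally show ?thesis by simp
qed

text \<open>With \<open>\<alpha>\<close> the midpoint angle of the cell of \<open>x\<close> and
  \<open>u\<close> half its width, the spline equals \<open>x - cos \<alpha> / cos u\<close> up to
  sign. The resulting bound of order \<open>1 / s\<close> is what later offsets the coefficient
  \<open>s * (s - 1)\<close>.\<close>

lemma abs_spline_1_le:
  assumes s: "s \<ge> 2" and x: "-1 < x" "x \<le> 1"
  shows "\<bar>spline s 1 x\<bar> \<le> tan (pi / (2 * real s))"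
proof -
  have s0: "s > 0" using s by simp
  obtain \<phi> j where *: "x = cos \<phi>" "0 \<le> \<phi>" "real j * (pi / real s) \<le> \<phi>"
    "\<phi> < real (Suc j) * (pi / real s)" "j < s" using obtain_angle_cell[OF s0 x] .
  define u where "u = pi / (2 * real s)"
  define \<alpha> where "\<alpha> = (real j + 1 / 2) * (pi / real s)"
  define \<delta> where "\<delta> = \<phi> - \<alpha>"
  have u: "0 < u" "u < pi / 2" using s by (auto simp: u_def field_simps)
  have cu: "cos u > 0" and su: "sin u > 0" using u by (auto intro: cos_gt_zero sin_gt_zero)
  define m where "m = 2 * (s - 1 - j) + 1"
  have m: "Suc j + m = 2 * s - j" using *(5) by (simp add: m_def)
  define S where "S = (\<Sum>k\<in>{Suc j..<Suc j + m}. (-1) ^ k * cos (real k * (pi / real s)))"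
  have "spline s 1 x = (\<Sum>k<2 * s. if j < k \<and> k + j < 2 * s then (-1) ^ k * (x - node s k) else 0)"
    unfolding spline_def trunc_pow_def using node_less_cos_iff[OF s0 *(2-5)] *(1)
    by (intro sum.cong) auto
  also have "\<dots> = (\<Sum>k\<in>{Suc j..<Suc j + m}. (-1) ^ k * (x - node s k))"
    unfolding sum.inter_filter[symmetric, OF finite_lessThan] m
    using *(5) by (intro sum.cong) auto
  also have "\<dots> = x * (\<Sum>k\<in>{Suc j..<Suc j + m}. (-1) ^ k) - S"
    unfolding S_def sum_distrib_left sum_subtractf[symmetric] node_def by (intro sum.cong) (auto simp: algebra_simps)
  also have "(\<Sum>k\<in>{Suc j..<Suc j + m}. (-1) ^ k) = ((-1) ^ Suc j :: real)"
    using sum_alternating_sign[of "Suc j" "s - 1 - j"] unfolding m_def .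
  finally have spl: "spline s 1 x = x * (-1) ^ Suc j - S" .
  \<comment> \<open>By the symmetry of the block about \<open>s\<close>, the telescoped sum ends at
    the angles \<open>\<alpha>\<close> and \<open>2 * pi - \<alpha>\<close>, which have the same
    cosine.\<close>
  have "S * (2 * cos u) = (-1) ^ Suc j * cos ((real (Suc j) - 1 / 2) * (pi / real s))
      - (-1) ^ (Suc j + m) * cos ((real (Suc j + m) - 1 / 2) * (pi / real s))"
    using sum_alternating_cos[where a = "Suc j" and m = m and \<beta> = "pi / real s"] unfolding S_def u_def
    by (simp only: divide_divide_eq_left mult.commute[of 2 "real s"])
  also have "cos ((real (Suc j) - 1 / 2) * (pi / real s)) = cos \<alpha>"
    by (rule arg_cong[where f = cos]) (simp add: \<alpha>_def algebra_simps)
  also have "(real (Suc j + m) - 1 / 2) * (pi / real s) = 2 * pi - \<alpha>"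
    unfolding m using *(5) by (simp add: \<alpha>_def of_nat_diff field_simps)
  also have "(-1) ^ (Suc j + m) = ((-1) ^ j :: real)"
    by (simp add: m_def power_add power_mult)
  also have "cos (2 * pi - \<alpha>) = cos \<alpha>" by (rule cos_2pi_minus)
  finally have "S * (2 * cos u) = (-1) ^ Suc j * cos \<alpha> - (-1) ^ j * cos \<alpha>" .
  then have S: "S * cos u = (-1) ^ Suc j * cos \<alpha>" unfolding power_Suc by linarith
  have \<delta>: "\<bar>\<delta>\<bar> \<le> u"
    using *(3,4) s by (auto simp: \<delta>_def \<alpha>_def u_def abs_le_iff field_simps)
  have cd: "cos u \<le> cos \<delta>"
    using cos_monotone_0_pi_le[of "\<bar>\<delta>\<bar>" u] \<delta> u by simp
  \<comment> \<open>The quantity squared is the real part of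
    \<open>cis \<alpha> * (cis \<delta> * cos u - 1)\<close>. The second factor has real part
    \<open>p\<close> and imaginary part \<open>q\<close>, so its squared modulus is a bound.\<close>
  have "(x * cos u - cos \<alpha>)\<^sup>2 \<le> (sin u)\<^sup>2"
  proof -
    have xe: "x = cos \<alpha> * cos \<delta> - sin \<alpha> * sin \<delta>"
      unfolding *(1) by (simp add: \<delta>_def flip: cos_add)
    define p q where "p = cos \<delta> * cos u - 1" and "q = sin \<delta> * cos u"
    have "x * cos u - cos \<alpha> = cos \<alpha> * p - sin \<alpha> * q"
      unfolding xe p_def q_def by (simp add: algebra_simps)
    moreover have "(c * p - d * q)\<^sup>2 + (d * p + c * q)\<^sup>2 = (c\<^sup>2 + d\<^sup>2) * (p\<^sup>2 + q\<^sup>2)" for c d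
      by (simp add: power2_eq_square algebra_simps)
    ultimately have "(x * cos u - cos \<alpha>)\<^sup>2 + (sin \<alpha> * p + cos \<alpha> * q)\<^sup>2 = p\<^sup>2 + q\<^sup>2"
      by simp
    then have "(x * cos u - cos \<alpha>)\<^sup>2 \<le> p\<^sup>2 + q\<^sup>2"
      using zero_le_power2[of "sin \<alpha> * p + cos \<alpha> * q"] by linarith
    also have "\<dots> = ((cos \<delta>)\<^sup>2 + (sin \<delta>)\<^sup>2) * (cos u)\<^sup>2 + 1 - 2 * cos \<delta> * cos u"
      unfolding p_def q_def by algebra
    also have "\<dots> \<le> 1 - (cos u)\<^sup>2"
      using mult_right_mono[OF cd less_imp_le[OF cu]] by (simp only: sin_cos_squared_add2) (simp add: power2_eq_square)
    also have "\<dots> = (sin u)\<^sup>2" by (simp add: sin_squared_eq)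
    finally show ?thesis .
  qed
  then have "\<bar>x * cos u - cos \<alpha>\<bar> \<le> sin u"
    using su abs_le_square_iff[of "x * cos u - cos \<alpha>" "sin u"] by simp
  moreover have "spline s 1 x * cos u = (-1) ^ Suc j * (x * cos u - cos \<alpha>)"
    unfolding spl using S by (simp add: algebra_simps)
  then have "\<bar>spline s 1 x * cos u\<bar> = \<bar>x * cos u - cos \<alpha>\<bar>"
    by (simp only: abs_mult abs_power_minus power_abs abs_minus abs_one power_one mult_1)
  ultimately have "\<bar>spline s 1 x\<bar> * cos u \<le> sin u"
    using cu by (simp add: abs_mult)
  then show ?thesis using cu by (simp add: tan_def u_def pos_le_divide_eq)
qed

section \<open>Fourier transforms of powers times splines\<close>

definition node_moment :: "nat \<Rightarrow> nat \<Rightarrow> real \<Rightarrow> real \<Rightarrow> complex" where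
  "node_moment j m \<xi> a = integral {a..1} (\<lambda>x. of_real (x ^ j * ((x - a) ^ m / fact m)) * cis (\<xi> * x))"

lemma node_moment_has_integral:
  "((\<lambda>x. of_real (x ^ j * ((x - a) ^ m / fact m)) * cis (\<xi> * x)) has_integral node_moment j m \<xi> a) {a..1}"
  unfolding node_moment_def
  by (intro integrable_integral integrable_continuous_real continuous_intros) auto

lemma node_moment_by_parts:
  fixes P P' :: "real \<Rightarrow> real"
  assumes a: "a \<le> 1" and P: "\<And>x. (P has_real_derivative P' x) (at x)"
    and I: "((\<lambda>x. of_real (P x) * cis (\<xi> * x)) has_integral I) {a..1}"
    and I': "((\<lambda>x. of_real (P' x) * cis (\<xi> * x)) has_integral I') {a..1}"
  shows "I' + \<i> * of_real \<xi> * I = of_real (P 1) * cis \<xi> - of_real (P a) * cis (\<xi> * a)"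
proof -
  have d: "((\<lambda>x. of_real (P x)) has_vector_derivative complex_of_real (P' x)) (at x within {a..1})" for x
    using P[of x] by (intro has_vector_derivative_of_real)
      (metis has_field_derivative_at_within has_real_derivative_iff_has_vector_derivative)
  have "((\<lambda>x. of_real (P x) * (\<i> * of_real \<xi> * cis (\<xi> * x)) + of_real (P' x) * cis (\<xi> * x)) has_integral
     (of_real (P 1) * cis (\<xi> * 1) - of_real (P a) * cis (\<xi> * a))) {a..1}"
    by (intro fundamental_theorem_of_calculus a has_vector_derivative_mult has_vector_derivative_cis d)
  moreover have "((\<lambda>x. \<i> * of_real \<xi> * (of_real (P x) * cis (\<xi> * x)) + of_real (P' x) * cis (\<xi> * x)) has_integral
      (\<i> * of_real \<xi> * I + I')) {a..1}"
    by (intro has_integral_add has_integral_mult_right I I')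
  moreover have "(\<lambda>x. \<i> * of_real \<xi> * (of_real (P x) * cis (\<xi> * x)) + of_real (P' x) * cis (\<xi> * x)) =
     (\<lambda>x. of_real (P x) * (\<i> * of_real \<xi> * cis (\<xi> * x)) + of_real (P' x) * cis (\<xi> * x))"
    by (simp add: mult_ac)
  ultimately show ?thesis
    by (simp add: has_integral_unique add.commute)
qed

text \<open>The integrand jumps at \<open>a\<close>, so in contrast to
  \<open>node_moment_Suc\<close> the lower boundary term survives; it becomes the transform of a
  point mass. When \<open>j = 0\<close> the truncated \<open>j - 1\<close> is multiplied by
  0.\<close>

lemma node_moment_0:
  assumes "a \<le> 1"
  shows "of_nat j * node_moment (j - 1) 0 \<xi> a + \<i> * of_real \<xi> * node_moment j 0 \<xi> a
    = cis \<xi> - of_real (a ^ j) * cis (\<xi> * a)"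
proof -
  have I: "((\<lambda>x. of_real (x ^ j) * cis (\<xi> * x)) has_integral node_moment j 0 \<xi> a) {a..1}" for j
    using node_moment_has_integral[of j a 0 \<xi>] by simp
  have "((\<lambda>x. of_real (real j * x ^ (j - 1)) * cis (\<xi> * x)) has_integral of_nat j * node_moment (j - 1) 0 \<xi> a) {a..1}"
    using has_integral_mult_right[OF I[of "j - 1"], of "of_nat j"] by (simp add: mult_ac)
  from node_moment_by_parts[OF assms _ I this]
  show ?thesis by (simp add: DERIV_pow)
qed

lemma node_moment_Suc:
  assumes "a \<le> 1"
  shows "of_nat j * node_moment (j - 1) (Suc m) \<xi> a + \<i> * of_real \<xi> * node_moment j (Suc m) \<xi> a
    = of_real ((1 - a) ^ Suc m / fact (Suc m)) * cis \<xi> - node_moment j m \<xi> a"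
proof -
  let ?P = "\<lambda>x. x ^ j * ((x - a) ^ Suc m / fact (Suc m))"
  let ?P' = "\<lambda>x. real j * (x ^ (j - 1) * ((x - a) ^ Suc m / fact (Suc m))) + x ^ j * ((x - a) ^ m / fact m)"
  have d: "(?P has_real_derivative ?P' x) (at x)" for x
  proof -
    have "((\<lambda>x. x - a) has_real_derivative 1) (at x)"
      by (auto intro!: derivative_eq_intros)
    from DERIV_cdivide[OF DERIV_power_Suc[OF this, of m], of "fact (Suc m)"]
    have "((\<lambda>x. (x - a) ^ Suc m / fact (Suc m)) has_real_derivative (1 + real m) * (x - a) ^ m / fact (Suc m)) (at x)"
      by simp
    moreover have "(1 + real m) * (x - a) ^ m / fact (Suc m) = (x - a) ^ m / fact m"
      unfolding fact_Suc of_nat_Suc by (rule mult_divide_mult_cancel_left) linarith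
    ultimately have "((\<lambda>x. (x - a) ^ Suc m / fact (Suc m)) has_real_derivative (x - a) ^ m / fact m) (at x)"
      by simp
    from DERIV_mult[OF DERIV_pow[of j x] this] show ?thesis by (simp add: mult_ac)
  qed
  have "((\<lambda>x. of_nat j * (of_real (x ^ (j - 1) * ((x - a) ^ Suc m / fact (Suc m))) * cis (\<xi> * x)) +
       of_real (x ^ j * ((x - a) ^ m / fact m)) * cis (\<xi> * x))
     has_integral of_nat j * node_moment (j - 1) (Suc m) \<xi> a + node_moment j m \<xi> a) {a..1}"
    by (intro has_integral_add has_integral_mult_right node_moment_has_integral)
  then have "((\<lambda>x. of_real (?P' x) * cis (\<xi> * x)) has_integral
      of_nat j * node_moment (j - 1) (Suc m) \<xi> a + node_moment j m \<xi> a) {a..1}"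
    by (rule has_integral_eq[rotated]) (simp only: of_real_add of_real_mult of_real_of_nat_eq distrib_right mult.assoc)
  from node_moment_by_parts[OF assms d node_moment_has_integral this]
  show ?thesis by (simp add: algebra_simps)
qed

text \<open>\<open>spline_moment s j (Suc m) \<xi>\<close> is the Fourier transform at \<open>\<xi>\<close> of \<open>x ^ j * spline s m x\<close>; the index \<open>0\<close>
  stands for the derivative of \<open>spline s 0\<close>, a sum of point masses, so that the recursion
  \<open>spline_moment_rec\<close> is uniform in \<open>m\<close>.\<close>
fun spline_moment :: "nat \<Rightarrow> nat \<Rightarrow> nat \<Rightarrow> real \<Rightarrow> complex" where
  "spline_moment s j 0 \<xi> = (\<Sum>k<2 * s. (-1) ^ k * (of_real (node s k ^ j) * cis (\<xi> * node s k)))"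
| "spline_moment s j (Suc m) \<xi> = (\<Sum>k<2 * s. (-1) ^ k * node_moment j m \<xi> (node s k))"

lemma node_le_1: "node s k \<le> 1" and node_ge_m1: "node s k \<ge> -1"
  using abs_node_le_1[of s k] by auto

text \<open>Integration by parts, where differentiating \<open>x ^ j\<close> gives the term with
  \<open>j - 1\<close>. Each truncated power leaves a boundary term at 1, but these add up to a
  multiple of an alternating moment of order \<open>m < s\<close>, which is zero.\<close>

lemma spline_moment_rec:
  assumes "m < s"
  shows "(- \<i> * of_real \<xi>) * spline_moment s j (Suc m) \<xi>
     = spline_moment s j m \<xi> + of_nat j * spline_moment s (j - 1) (Suc m) \<xi>"
proof -
  have zero: "(\<Sum>k<2 * s. (-1) ^ k * complex_of_real (c * (1 - node s k) ^ m)) = 0" for c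
  proof -
    have "(\<Sum>k<2 * s. (-1) ^ k * complex_of_real (c * (1 - node s k) ^ m))
       = complex_of_real (c * (\<Sum>k<2 * s. (-1) ^ k * (1 - node s k) ^ m))"
      by (simp add: sum_distrib_left mult_ac)
    then show ?thesis using alternating_diff_node_power_eq_0[OF assms, of 1] by simp
  qed
  have neg: "A + B = - C \<Longrightarrow> - B = C + A" for A B C :: complex
    by (simp add: add_eq_0_iff2 eq_neg_iff_add_eq_0 add_ac)
  show ?thesis
  proof (cases m)
    case 0
    have "of_nat j * spline_moment s (j - 1) (Suc m) \<xi> + (\<i> * of_real \<xi>) * spline_moment s j (Suc m) \<xi>
      = (\<Sum>k<2 * s. (-1) ^ k * (of_nat j * node_moment (j - 1) 0 \<xi> (node s k) + \<i> * of_real \<xi> * node_moment j 0 \<xi> (node s k)))"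
      by (simp add: 0 sum_distrib_left sum.distrib[symmetric] ring_distribs mult_ac)
    also have "\<dots> = (\<Sum>k<2 * s. (-1) ^ k * complex_of_real (1 * (1 - node s k) ^ m) * cis \<xi>
        - (-1) ^ k * (of_real (node s k ^ j) * cis (\<xi> * node s k)))"
      by (intro sum.cong refl) (simp only: node_moment_0[OF node_le_1], simp add: 0 ring_distribs)
    also have "\<dots> = (\<Sum>k<2 * s. (-1) ^ k * complex_of_real (1 * (1 - node s k) ^ m)) * cis \<xi> - spline_moment s j m \<xi>"
      by (simp add: 0 sum_subtractf sum_distrib_right)
    also have "\<dots> = - spline_moment s j m \<xi>" unfolding zero by simp
    finally show ?thesis unfolding mult_minus_left by (rule neg)
  next
    case (Suc n)
    have "of_nat j * spline_moment s (j - 1) (Suc m) \<xi> + (\<i> * of_real \<xi>) * spline_moment s j (Suc m) \<xi>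
      = (\<Sum>k<2 * s. (-1) ^ k * (of_nat j * node_moment (j - 1) (Suc n) \<xi> (node s k) + \<i> * of_real \<xi> * node_moment j (Suc n) \<xi> (node s k)))"
      by (simp add: Suc sum_distrib_left sum.distrib[symmetric] ring_distribs mult_ac)
    also have "\<dots> = (\<Sum>k<2 * s. (-1) ^ k * complex_of_real ((1 / fact m) * (1 - node s k) ^ m) * cis \<xi>
        - (-1) ^ k * node_moment j n \<xi> (node s k))"
      by (intro sum.cong refl) (simp only: node_moment_Suc[OF node_le_1], simp add: Suc right_diff_distrib)
    also have "\<dots> = (\<Sum>k<2 * s. (-1) ^ k * complex_of_real ((1 / fact m) * (1 - node s k) ^ m)) * cis \<xi> - spline_moment s j m \<xi>"
      unfolding sum_subtractf sum_distrib_right by (simp add: Suc)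
    also have "\<dots> = - spline_moment s j m \<xi>" unfolding zero by simp
    finally show ?thesis unfolding mult_minus_left by (rule neg)
  qed
qed

lemma spline_moment_has_integral:
  "((\<lambda>x. of_real (x ^ j * spline s m x) * cis (\<xi> * x)) has_integral spline_moment s j (Suc m) \<xi>) {-1..1}"
proof -
  have "((\<lambda>x. of_real (x ^ j * trunc_pow m (x - a)) * cis (\<xi> * x)) has_integral node_moment j m \<xi> a) {-1..1}"
    if a: "-1 \<le> a" "a \<le> 1" for a
  proof -
    have "((\<lambda>x. of_real (x ^ j * trunc_pow m (x - a)) * cis (\<xi> * x)) has_integral 0) {-1..a}"
      by (rule has_integral_is_0) (auto simp: trunc_pow_def)
    moreover have "((\<lambda>x. of_real (x ^ j * trunc_pow m (x - a)) * cis (\<xi> * x)) has_integral node_moment j m \<xi> a) {a..1}"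
      \<comment> \<open>For \<open>m = 0\<close> the integrands can disagree at \<open>a\<close>:
        there \<open>trunc_pow\<close> is 0 while the power is 1.\<close>
      by (rule has_integral_spike_finite[OF _ _ node_moment_has_integral, of "{a}"]) (auto simp: trunc_pow_def)
    ultimately show ?thesis
      using has_integral_combine[OF a, of _ 0 "node_moment j m \<xi> a"] by simp
  qed
  note nm = this
  have "((\<lambda>x. \<Sum>k<2 * s. (-1) ^ k * (of_real (x ^ j * trunc_pow m (x - node s k)) * cis (\<xi> * x))) has_integral
     spline_moment s j (Suc m) \<xi>) {-1..1}"
    unfolding spline_moment.simps
    by (intro has_integral_sum finite_lessThan has_integral_mult_right nm node_ge_m1 node_le_1)
  then show ?thesis
    by (rule has_integral_eq[rotated]) (simp add: spline_def sum_distrib_left sum_distrib_right mult_ac)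
qed

lemma spline_eq_0_left: 
  assumes "x \<le> -1"
  shows "spline s m x = 0"
proof -
  have "\<not> x - node s k > 0" for k using node_ge_m1[of s k] assms by simp
  then show ?thesis unfolding spline_def trunc_pow_def by simp
qed

lemma norm_spline_moment_le:
  assumes b: "\<And>x. -1 < x \<Longrightarrow> x \<le> 1 \<Longrightarrow> \<bar>x ^ j * spline s m x\<bar> \<le> b x"
    and b0: "b (-1) \<ge> 0" and B: "(b has_integral B) {-1..1}"
  shows "cmod (spline_moment s j (Suc m) \<xi>) \<le> B"
proof -
  have bd: "cmod (of_real (x ^ j * spline s m x) * cis (\<xi> * x)) \<le> b x" if "x \<in> {-1..1}" for x
    using b[of x] b0 that spline_eq_0_left[of "-1" s m]
    unfolding norm_mult norm_of_real norm_cis by (cases "x = -1") auto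
  have "cmod (integral {-1..1} (\<lambda>x. of_real (x ^ j * spline s m x) * cis (\<xi> * x))) \<le> integral {-1..1} b"
    by (rule integral_norm_bound_integral[OF _ _ bd])
       (use spline_moment_has_integral B in \<open>blast intro: has_integral_integrable\<close>)+
  then show ?thesis
    unfolding integral_unique[OF spline_moment_has_integral] integral_unique[OF B] .
qed

lemma norm_spline_moment_0: "cmod (spline_moment s j 0 \<xi>) \<le> 2 * real s"
proof -
  have "cmod (spline_moment s j 0 \<xi>) \<le> (\<Sum>k<2 * s. 1)"
    unfolding spline_moment.simps
  proof (rule sum_norm_le)
    fix k
    have "\<bar>node s k\<bar> ^ j \<le> 1" using abs_node_le_1 by (intro power_le_one) auto
    then show "cmod ((-1) ^ k * (of_real (node s k ^ j) * cis (\<xi> * node s k))) \<le> 1"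
      by (simp add: norm_mult norm_power power_abs)
  qed
  then show ?thesis by simp
qed

lemma norm_spline_moment_0_1:
  assumes "s > 0"
  shows "cmod (spline_moment s 0 1 \<xi>) \<le> 2"
  unfolding One_nat_def
  by (rule norm_spline_moment_le[where b = "\<lambda>_. 1"])
     (use abs_spline_0_le[OF assms] has_integral_const_real[of "1::real" "-1" 1] in auto)

lemma norm_spline_moment_1_1:
  assumes "s > 0"
  shows "cmod (spline_moment s 1 1 \<xi>) \<le> 1"
proof -
  have "((\<lambda>x::real. - x) has_integral ((- 0\<^sup>2 / 2) - (- (-1)\<^sup>2 / 2))) {-1..0}"
    by (rule fundamental_theorem_of_calculus)
       (auto intro!: derivative_eq_intros simp flip: has_real_derivative_iff_has_vector_derivative)
  then have 1: "((\<lambda>x::real. \<bar>x\<bar>) has_integral 1 / 2) {-1..0}"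
    by (rule has_integral_eq[rotated, THEN has_integral_eq_rhs]) auto
  have "((\<lambda>x::real. x) has_integral (1\<^sup>2 / 2 - 0\<^sup>2 / 2)) {0..1}"
    by (rule fundamental_theorem_of_calculus)
       (auto intro!: derivative_eq_intros simp flip: has_real_derivative_iff_has_vector_derivative)
  then have 2: "((\<lambda>x::real. \<bar>x\<bar>) has_integral 1 / 2) {0..1}"
    by (rule has_integral_eq[rotated, THEN has_integral_eq_rhs]) auto
  have "((\<lambda>x::real. \<bar>x\<bar>) has_integral 1 / 2 + 1 / 2) {-1..1}"
    by (rule has_integral_combine[OF _ _ 1 2]) auto
  then have B: "((\<lambda>x::real. \<bar>x\<bar>) has_integral 1) {-1..1}" by simp
  have "cmod (spline_moment s 1 (Suc 0) \<xi>) \<le> 1"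
  proof (rule norm_spline_moment_le[OF _ _ B])
    fix x :: real assume "-1 < x" "x \<le> 1"
    from abs_spline_0_le[OF assms this] show "\<bar>x ^ 1 * spline s 0 x\<bar> \<le> \<bar>x\<bar>"
      by (simp add: abs_mult mult_left_le)
  qed simp
  then show ?thesis by simp
qed

lemma norm_spline_moment_0_2:
  assumes "s \<ge> 2"
  shows "cmod (spline_moment s 0 2 \<xi>) \<le> 2 * tan (pi / (2 * real s))"
proof -
  have "pi / (2 * real s) < pi / 2" "0 < pi / (2 * real s)" using assms by (auto simp: field_simps)
  then have "tan (pi / (2 * real s)) \<ge> 0" using tan_gt_zero[of "pi / (2 * real s)"] by simp
  moreover have "((\<lambda>_. tan (pi / (2 * real s))) has_integral 2 * tan (pi / (2 * real s))) {-1..1::real}"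
    using has_integral_const_real[of "tan (pi / (2 * real s))" "-1" 1] by simp
  ultimately have "cmod (spline_moment s 0 (Suc 1) \<xi>) \<le> 2 * tan (pi / (2 * real s))"
    by (intro norm_spline_moment_le[where b = "\<lambda>_. tan (pi / (2 * real s))"])
       (use abs_spline_1_le[OF assms] in auto)
  then show ?thesis by (simp add: numeral_2_eq_2)
qed

declare spline_moment.simps [simp del]

context
  fixes s :: nat and \<xi> :: real and z :: complex
  defines "z \<equiv> - \<i> * of_real \<xi>"
begin

lemma spline_moment_rec_0:
  "m < s \<Longrightarrow> z * (c * spline_moment s 0 (Suc m) \<xi>) = c * spline_moment s 0 m \<xi>"
  using spline_moment_rec[of m s \<xi> 0] unfolding z_def[symmetric] by (simp add: mult.left_commute)

lemma spline_moment_rec_1: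
  "m < s \<Longrightarrow> z * (c * spline_moment s 1 (Suc m) \<xi>)
     = c * (spline_moment s 1 m \<xi> + spline_moment s 0 (Suc m) \<xi>)"
  using spline_moment_rec[of m s \<xi> 1] unfolding z_def[symmetric] by (simp add: mult.left_commute)

lemma spline_moment_iterate_0:
  "r \<le> s \<Longrightarrow> z ^ r * spline_moment s 0 s \<xi> = spline_moment s 0 (s - r) \<xi>"
proof (induction r)
  case (Suc r)
  obtain n where n: "s - r = Suc n" "s - Suc r = n" "n < s" using Suc.prems that[of "s - Suc r"] by auto
  have "z ^ Suc r * spline_moment s 0 s \<xi> = z * (1 * spline_moment s 0 (Suc n) \<xi>)"
    using Suc n by (simp add: mult.assoc)
  then show ?case unfolding spline_moment_rec_0[OF n(3)] n(2) by simp
qed simp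

lemma spline_moment_iterate_1:
  "r \<le> s \<Longrightarrow> z ^ r * spline_moment s 1 s \<xi>
     = spline_moment s 1 (s - r) \<xi> + of_nat r * spline_moment s 0 (Suc (s - r)) \<xi>"
proof (induction r)
  case (Suc r)
  define n where "n = s - Suc r"
  have n: "s - r = Suc n" "s - Suc r = n" "n < s" using Suc.prems by (auto simp: n_def)
  have r0: "z * (of_nat r * spline_moment s 0 (Suc (Suc n)) \<xi>) = of_nat r * spline_moment s 0 (Suc n) \<xi>"
  proof (cases "r = 0")
    case False
    then show ?thesis using Suc.prems by (intro spline_moment_rec_0) (simp add: n_def)
  qed simp
  have "z ^ Suc r * spline_moment s 1 s \<xi>
      = z * (1 * spline_moment s 1 (Suc n) \<xi>) + z * (of_nat r * spline_moment s 0 (Suc (Suc n)) \<xi>)"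
    using Suc n by (simp add: mult.assoc distrib_left)
  then show ?case unfolding r0 spline_moment_rec_1[OF n(3)] n(2) by (simp add: algebra_simps)
qed simp

text \<open>The coefficients are those of the Leibniz rule for the derivative of order
  \<open>r\<close> of \<open>x\<^sup>2\<close> times a function: \<open>r\<close> times
  \<open>2 x\<close>, and \<open>r * (r - 1) / 2\<close> times 2.\<close>

lemma spline_moment_iterate_2:
  "r \<le> s \<Longrightarrow> z ^ r * spline_moment s 2 s \<xi>
     = spline_moment s 2 (s - r) \<xi> + 2 * of_nat r * spline_moment s 1 (Suc (s - r)) \<xi>
       + of_nat r * (of_nat r - 1) * spline_moment s 0 (Suc (Suc (s - r))) \<xi>"
proof (induction r)
  case (Suc r)
  define n where "n = s - Suc r"
  have n: "s - r = Suc n" "s - Suc r = n" "n < s" using Suc.prems by (auto simp: n_def)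
  have r0: "z * (of_nat r * (of_nat r - 1) * spline_moment s 0 (Suc (Suc (Suc n))) \<xi>)
      = of_nat r * (of_nat r - 1) * spline_moment s 0 (Suc (Suc n)) \<xi>"
  proof (cases "r = 0 \<or> r = 1")
    case False
    then show ?thesis using Suc.prems by (intro spline_moment_rec_0) (auto simp: n_def)
  qed auto
  have r1: "z * (2 * of_nat r * spline_moment s 1 (Suc (Suc n)) \<xi>)
      = 2 * of_nat r * (spline_moment s 1 (Suc n) \<xi> + spline_moment s 0 (Suc (Suc n)) \<xi>)"
  proof (cases "r = 0")
    case False
    then show ?thesis using Suc.prems by (intro spline_moment_rec_1) (simp add: n_def)
  qed simp
  have r2: "z * spline_moment s 2 (Suc n) \<xi> = spline_moment s 2 n \<xi> + 2 * spline_moment s 1 (Suc n) \<xi>"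
    using spline_moment_rec[OF n(3), of \<xi> 2] unfolding z_def[symmetric] by simp
  have "z ^ Suc r * spline_moment s 2 s \<xi> = z * spline_moment s 2 (Suc n) \<xi>
      + z * (2 * of_nat r * spline_moment s 1 (Suc (Suc n)) \<xi>)
      + z * (of_nat r * (of_nat r - 1) * spline_moment s 0 (Suc (Suc (Suc n))) \<xi>)"
    using Suc n by (simp add: mult.assoc distrib_left)
  then show ?case unfolding r0 r1 r2 n(2) by (simp add: algebra_simps)
qed simp

end

text \<open>With \<open>r = s\<close> the leading term is the transform of \<open>2 * s\<close>
  weighted point masses, and the Leibniz terms involve only the splines of degree 0 and 1. Since the
  tangent is of order \<open>1 / s\<close>, all three bounds grow linearly in
  \<open>s\<close>.\<close>

lemma norm_spline_moment_bounds:
  assumes s: "s \<ge> 2"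
  shows "\<bar>\<xi>\<bar> ^ s * cmod (spline_moment s 0 s \<xi>) \<le> 2 * real s"
    and "\<bar>\<xi>\<bar> ^ s * cmod (spline_moment s 1 s \<xi>) \<le> 4 * real s"
    and "\<bar>\<xi>\<bar> ^ s * cmod (spline_moment s 2 s \<xi>) \<le> 4 * real s + real s * (real s - 1) * (2 * tan (pi / (2 * real s)))"
proof -
  let ?z = "- \<i> * complex_of_real \<xi>"
  have nz: "\<bar>\<xi>\<bar> ^ s * cmod w = cmod (?z ^ s * w)" for w
    by (simp add: norm_mult norm_power)
  note it = spline_moment_iterate_0[of s s \<xi>, OF order_refl] spline_moment_iterate_1[of s s \<xi>, OF order_refl]
    spline_moment_iterate_2[of s s \<xi>, OF order_refl]
  show "\<bar>\<xi>\<bar> ^ s * cmod (spline_moment s 0 s \<xi>) \<le> 2 * real s"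
    unfolding nz it(1) diff_self_eq_0 by (rule norm_spline_moment_0)
  have s0: "s > 0" using s by simp
  have "cmod (?z ^ s * spline_moment s 1 s \<xi>)
     \<le> cmod (spline_moment s 1 0 \<xi>) + cmod (of_nat s * spline_moment s 0 1 \<xi>)"
    unfolding it(2) diff_self_eq_0 One_nat_def[symmetric] by (rule norm_triangle_ineq)
  also have "\<dots> \<le> 2 * real s + real s * 2"
    unfolding norm_mult norm_of_nat
    by (intro add_mono norm_spline_moment_0 mult_left_mono norm_spline_moment_0_1[OF s0]) auto
  finally show "\<bar>\<xi>\<bar> ^ s * cmod (spline_moment s 1 s \<xi>) \<le> 4 * real s"
    unfolding nz by simp
  have norm_s: "cmod (of_nat s - 1) = real s - 1"
    using s by (metis Suc_1 Suc_leD norm_of_nat of_nat_1 of_nat_diff)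
  have "cmod (?z ^ s * spline_moment s 2 s \<xi>)
     \<le> cmod (spline_moment s 2 0 \<xi>) + cmod (2 * of_nat s * spline_moment s 1 1 \<xi>)
       + cmod (of_nat s * (of_nat s - 1) * spline_moment s 0 2 \<xi>)"
    unfolding it(3) diff_self_eq_0 One_nat_def[symmetric] Suc_1 by (rule norm_triangle_le, intro add_mono norm_triangle_ineq order_refl)
  also have "\<dots> \<le> 2 * real s + 2 * real s * 1 + real s * (real s - 1) * (2 * tan (pi / (2 * real s)))"
    unfolding norm_mult norm_of_nat norm_numeral norm_s
    by (intro add_mono norm_spline_moment_0 mult_left_mono norm_spline_moment_1_1[OF s0]
          norm_spline_moment_0_2[OF s]) (use s in auto)
  finally show "\<bar>\<xi>\<bar> ^ s * cmod (spline_moment s 2 s \<xi>)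
      \<le> 4 * real s + real s * (real s - 1) * (2 * tan (pi / (2 * real s)))"
    unfolding nz by simp
qed

section \<open>Identification with the B-spline kernel\<close>

lemma sum_lessThan_add:
  fixes g :: "nat \<Rightarrow> 'a::comm_monoid_add"
  shows "(\<Sum>k<a + b. g k) = (\<Sum>k<a. g k) + (\<Sum>k<b. g (a + k))"
  by (induction b) (auto simp: add.assoc)

lemma trunc_pow_differentiable: "trunc_pow (Suc (Suc m)) differentiable at y"
proof -
  consider "y > 0" | "y < 0" | "y = 0" by linarith
  then have "\<exists>D. (trunc_pow (Suc (Suc m)) has_real_derivative D) (at y)"
  proof cases
    case 1
    have "((\<lambda>y::real. y ^ Suc (Suc m) / fact (Suc (Suc m))) has_real_derivative
        real (Suc (Suc m)) * y ^ (Suc (Suc m) - Suc 0) / fact (Suc (Suc m))) (at y)"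
      by (intro DERIV_cdivide DERIV_pow)
    from has_field_derivative_transform_within_open[OF this, of "{0<..}" "trunc_pow (Suc (Suc m))"] 1
    show ?thesis by (auto simp: trunc_pow_def simp del: fact_Suc power_Suc)
  next
    case 2
    from has_field_derivative_transform_within_open[OF DERIV_const[of "0::real"], of "{..<0}" y "trunc_pow (Suc (Suc m))"] 2
    show ?thesis by (auto simp: trunc_pow_def)
  next
    case 3
    have "((\<lambda>h. trunc_pow (Suc (Suc m)) h / h) \<longlongrightarrow> 0) (at 0)"
    proof (rule Lim_null_comparison)
      show "\<forall>\<^sub>F h in at 0. norm (trunc_pow (Suc (Suc m)) h / h) \<le> \<bar>h\<bar> ^ Suc m"
      proof (rule always_eventually, rule allI)
        fix h :: real
        have "\<bar>h\<bar> ^ Suc m / fact (Suc (Suc m)) \<le> \<bar>h\<bar> ^ Suc m / 1"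
          by (intro divide_left_mono) (auto simp: fact_ge_1 simp del: fact_Suc)
        then show "norm (trunc_pow (Suc (Suc m)) h / h) \<le> \<bar>h\<bar> ^ Suc m"
          using zero_le_power_abs[of h "Suc m"]
          by (cases "h > 0") (auto simp: trunc_pow_def simp del: fact_Suc zero_le_power_abs)
      qed
      show "((\<lambda>h::real. \<bar>h\<bar> ^ Suc m) \<longlongrightarrow> 0) (at 0)"
        by (auto intro!: tendsto_eq_intros)
    qed
    then have "(trunc_pow (Suc (Suc m)) has_real_derivative 0) (at 0)"
      by (simp add: DERIV_def trunc_pow_def)
    then show ?thesis using 3 by auto
  qed
  then show ?thesis by (simp add: real_differentiable_def)
qed

lemma spline_differentiable: "spline s (Suc (Suc m)) differentiable at x"
proof -
  have "(\<lambda>x. (-1) ^ k * trunc_pow (Suc (Suc m)) (x - node s k)) differentiable at x" for k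
    by (intro derivative_intros differentiable_compose[OF trunc_pow_differentiable])
  then show ?thesis unfolding spline_def[abs_def] by (intro differentiable_sum) auto
qed

lemma spline_eq_0_right:
  assumes "x \<ge> 1" "0 < m" "m < s"
  shows "spline s m x = 0"
proof -
  have "trunc_pow m (x - node s k) = (x - node s k) ^ m / fact m" for k
    using assms node_le_1[of s k] by (auto simp: trunc_pow_def)
  then have "spline s m x = (\<Sum>k<2 * s. (-1) ^ k * (x - node s k) ^ m) / fact m"
    by (simp add: spline_def sum_divide_distrib)
  then show ?thesis using alternating_diff_node_power_eq_0[OF assms(3)] by simp
qed

lemma node_add: "s > 0 \<Longrightarrow> node s (s + k) = - node s k"
proof -
  assume s: "s > 0"
  have "real (s + k) * (pi / real s) = real k * (pi / real s) + pi" using s by (simp add: field_simps)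
  then show ?thesis unfolding node_def by (simp only: cos_periodic_pi)
qed

lemma sum_nodes_antipodal:
  assumes s: "s > 0" "even s"
  shows "(\<Sum>k<2 * s. (-1) ^ k * f (- node s k)) = (\<Sum>k<2 * s. (-1) ^ k * (f (node s k) :: real))"
proof -
  have "(-1::real) ^ s = 1" using s by simp
  then show ?thesis
    unfolding mult_2 sum_lessThan_add by (simp add: node_add[OF s(1)] power_add)
qed

text \<open>Reflection permutes the nodes and, \<open>s\<close> being even, keeps their signs, but
  it reverses the side of truncation. For the odd exponent \<open>s - 1\<close> the two truncations
  differ by a full power, whose alternating sum vanishes.\<close>

lemma spline_even:
  assumes s: "s \<ge> 2" "even s"
  shows "spline s (s - 1) (- x) = spline s (s - 1) x"
proof -
  have odd: "odd (s - 1)" using s by simp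
  have "spline s (s - 1) (- x) = (\<Sum>k<2 * s. (-1) ^ k * trunc_pow (s - 1) (node s k - x))"
    using sum_nodes_antipodal[of s "\<lambda>v. trunc_pow (s - 1) (v - x)"] s
    unfolding spline_def minus_diff_commute[of x] by simp
  moreover have "trunc_pow (s - 1) y - trunc_pow (s - 1) (- y) = y ^ (s - 1) / fact (s - 1)" for y
    using odd s by (cases y "0::real" rule: linorder_cases) (auto simp: trunc_pow_def)
  from this[of "x - node s k" for k] have "trunc_pow (s - 1) (node s k - x) = trunc_pow (s - 1) (x - node s k) - (x - node s k) ^ (s - 1) / fact (s - 1)" for k
    unfolding minus_diff_eq by (simp only: algebra_simps)
  ultimately have "spline s (s - 1) (- x) = spline s (s - 1) x -
      (\<Sum>k<2 * s. (-1) ^ k * (x - node s k) ^ (s - 1)) / fact (s - 1)"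
    by (simp add: spline_def right_diff_distrib sum_subtractf sum_divide_distrib)
  then show ?thesis using s alternating_diff_node_power_eq_0[of "s - 1" s x] by simp
qed

lemma fact_trunc_pow: "fact n * trunc_pow (Suc n) y = (if y > 0 then y ^ Suc n / real (Suc n) else 0)"
  by (simp add: trunc_pow_def)

lemma has_integral_indicator_power:
  assumes "-1 \<le> a" "a \<le> b" "-1 \<le> x"
  shows "((\<lambda>t. indicator {a<..b} t * (x - t) ^ n) has_integral
     fact n * (trunc_pow (Suc n) (x - a) - trunc_pow (Suc n) (x - b))) {-1..x}"
proof (cases "x \<le> a")
  case True
  have "((\<lambda>t. indicator {a<..b} t * (x - t) ^ n) has_integral 0) {-1..x}"
    by (rule has_integral_is_0) (use True in auto)
  then show ?thesis using True assms by (simp add: trunc_pow_def)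
next
  case False
  define c where "c = min b x"
  have c: "a \<le> c" "c \<le> x" using False assms by (auto simp: c_def)
  have deriv: "((\<lambda>t. - ((x - t) ^ Suc n / real (Suc n))) has_real_derivative (x - t) ^ n) (at t within A)" for t A
  proof -
    have "((\<lambda>t. x - t) has_real_derivative -1) (at t within A)" by (auto intro!: derivative_eq_intros)
    from DERIV_minus[OF DERIV_cdivide[OF DERIV_power_Suc[OF this, of n], of "real (Suc n)"]]
    have "((\<lambda>t. - ((x - t) ^ Suc n / real (Suc n))) has_real_derivative
        - ((1 + real n) * (-1 * (x - t) ^ n) / real (Suc n))) (at t within A)" by simp
    moreover have "- ((1 + real n) * (-1 * (x - t) ^ n) / real (Suc n)) = (x - t) ^ n"
      by (simp del: times_divide_eq_right add: divide_simps)
    ultimately show ?thesis by (simp only:)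
  qed
  have "((\<lambda>t. (x - t) ^ n) has_integral
      (- ((x - c) ^ Suc n / real (Suc n)) - - ((x - a) ^ Suc n / real (Suc n)))) {a..c}"
    by (rule fundamental_theorem_of_calculus[OF c(1)])
       (use deriv in \<open>simp flip: has_real_derivative_iff_has_vector_derivative\<close>)
  moreover have "- ((x - c) ^ Suc n / real (Suc n)) - - ((x - a) ^ Suc n / real (Suc n))
      = fact n * (trunc_pow (Suc n) (x - a) - trunc_pow (Suc n) (x - b))"
    using False by (auto simp: fact_trunc_pow right_diff_distrib c_def min_def)
  ultimately have "((\<lambda>t. if t \<in> {a..c} then (x - t) ^ n else 0) has_integral
      fact n * (trunc_pow (Suc n) (x - a) - trunc_pow (Suc n) (x - b))) {-1..x}"
    using c assms by (subst has_integral_restrict) auto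
  then show ?thesis
    by (rule has_integral_spike_finite[rotated 2, of _ _ _ "{a}"])
       (auto simp: c_def indicator_def)
qed

lemma pbspline_eq_spline:
  assumes s: "s \<ge> 2" "even s"
  shows "pbspline (s - 1) x = spline s (s - 1) x"
proof (cases "-1 \<le> x \<and> x \<le> 1")
  case False
  then show ?thesis
    using spline_eq_0_left[of x s "s - 1"] spline_eq_0_right[of x "s - 1" s] s
    by (auto simp: pbspline_def Let_def)
next
  case True
  have s2: "Suc (s - 2) = s - 1" using s by simp
  define T where "T k = trunc_pow (s - 1) (x - node s k)" for k
  have node_eq: "cos (real k * pi / real s) = node s k" for k by (simp add: node_def)
  have mono: "node s (k + 1) \<le> node s k" if "k < s" for k
    unfolding node_def
  proof (rule cos_monotone_0_pi_le)
    have "real (k + 1) * (pi / real s) \<le> real s * (pi / real s)"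
      using that by (intro mult_right_mono) auto
    then show "real (k + 1) * (pi / real s) \<le> pi" using that by simp
    show "real k * (pi / real s) \<le> real (k + 1) * (pi / real s)" by (intro mult_right_mono) auto
  qed auto
  have "((\<lambda>t. \<Sum>k<s. (-1) ^ k * (indicator {node s (k + 1)<..node s k} t * (x - t) ^ (s - 2))) has_integral
     (\<Sum>k<s. (-1) ^ k * (fact (s - 2) * (trunc_pow (Suc (s - 2)) (x - node s (k + 1))
         - trunc_pow (Suc (s - 2)) (x - node s k))))) {-1..x}"
    by (intro has_integral_sum finite_lessThan has_integral_mult_right has_integral_indicator_power node_ge_m1 mono)
       (use True in auto)
  from integral_unique[OF this]
  have "integral {-1..x} (\<lambda>t. \<Sum>k<s. (-1) ^ k * indicator {node s (k + 1)<..node s k} t * (x - t) ^ (s - 2))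
     = (\<Sum>k<s. (-1) ^ k * (fact (s - 2) * (T (k + 1) - T k)))"
    unfolding T_def s2 by (simp only: mult.assoc)
  also have "\<dots> = fact (s - 2) * (\<Sum>k<s. (-1) ^ k * (T (k + 1) - T k))"
    by (simp add: sum_distrib_left mult_ac)
  finally have int: "integral {-1..x} (\<lambda>t. \<Sum>k<s. (-1) ^ k * indicator {node s (k + 1)<..node s k} t * (x - t) ^ (s - 2)) = \<dots>" .
  have sgn: "(-1::real) ^ (s - 1) = -1" using s by simp
  have "pbspline (s - 1) x = - (\<Sum>k<s. (-1) ^ k * (T (k + 1) - T k))"
  proof -
    have s1: "s - 1 + 1 = s" using s by simp
    show ?thesis using True unfolding pbspline_def Let_def s1 node_eq int sgn by simp
  qed
  also have "\<dots> = (\<Sum>k<s. (-1) ^ k * T k) + (\<Sum>k<s. - ((-1) ^ k * T (k + 1)))"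
    by (simp add: right_diff_distrib sum_subtractf sum_negf)
  \<comment> \<open>The left ends of the cells are moved to the lower half circle: index
    \<open>2 * s - (k + 1)\<close> is the same node and has parity opposite to \<open>k\<close>. The
    two halves then join into one sum around the circle.\<close>
  also have "(\<Sum>k<s. - ((-1) ^ k * T (k + 1))) = (\<Sum>k<s. (-1) ^ (s + (s - Suc k)) * T (s + (s - Suc k)))"
  proof (rule sum.cong[OF refl])
    fix k assume k: "k \<in> {..<s}"
    have "real (s + (s - Suc k)) * (pi / real s) = 2 * pi - real (k + 1) * (pi / real s)"
      using k by (simp add: of_nat_diff field_simps)
    then have "node s (s + (s - Suc k)) = node s (k + 1)" unfolding node_def by (simp only: cos_2pi_minus)
    moreover have "(-1::real) ^ (s + (s - Suc k)) = - ((-1) ^ k)"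
      using k s by (cases "even k") auto
    ultimately show "- ((-1) ^ k * T (k + 1)) = (-1) ^ (s + (s - Suc k)) * T (s + (s - Suc k))"
      by (simp add: T_def)
  qed
  also have "\<dots> = (\<Sum>k<s. (-1) ^ (s + k) * T (s + k))"
    by (rule sum.nat_diff_reindex)
  also have "(\<Sum>k<s. (-1) ^ k * T k) + (\<Sum>k<s. (-1) ^ (s + k) * T (s + k)) = (\<Sum>k<s + s. (-1) ^ k * T k)"
    by (rule sum_lessThan_add[symmetric])
  finally show ?thesis by (simp add: spline_def T_def mult_2)
qed

text \<open>Scaling by \<open>M\<close> turns the sample points into integers, and the modulation by
  \<open>t\<close> shifts all frequencies. The condition on \<open>s\<close> makes the degree
  \<open>s - 1\<close> at least 2, so that the spline is differentiable.\<close>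

lemma spline_poisson:
  assumes s: "s \<ge> 3" and M: "M > 0"
  shows "(\<lambda>J. \<Sum>l\<in>{-int J..int J}. of_nat M * spline_moment s j s (real M * (t - 2 * pi * real_of_int l)))
     \<longlonglongrightarrow> (\<Sum>n<2 * M. of_real (((real n - real M) / real M) ^ j * spline s (s - 1) ((real n - real M) / real M))
            * cis (t * (real n - real M)))"
proof -
  define f where "f x = complex_of_real ((x / real M) ^ j * spline s (s - 1) (x / real M)) * cis (t * x)" for x
  have s1: "s - 1 = Suc (Suc (s - 3))" using s by simp
  have d1: "spline s (s - 1) differentiable at x" for x
    unfolding s1 by (rule spline_differentiable)
  have d2: "(\<lambda>x. (x / real M) ^ j * spline s (s - 1) (x / real M)) differentiable at x" for x
    using M by (intro derivative_intros differentiable_compose[OF d1]) auto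
  have diff: "f differentiable at x" for x
    unfolding f_def
    by (intro differentiable_mult differentiable_compose[OF _ d2] differentiableI_vector[OF has_vector_derivative_cis])
       (auto intro!: bounded_linear_imp_differentiable bounded_linear_of_real)
  have ends: "f (- real M) = 0" "f (real M) = 0"
    using M s spline_eq_0_left[of "-1" s "s - 1"] spline_eq_0_right[of 1 "s - 1" s] by (auto simp: f_def)
  have "integral {- real M..real M} (\<lambda>x. f x * cis (-(2 * pi * l) * x))
     = of_nat M * spline_moment s j s (real M * (t - 2 * pi * real_of_int l))" for l :: int
  proof -
    have img: "(\<lambda>x. x / real M) ` {- real M..real M} = {-1..1}"
      using M by (subst image_divide_atLeastAtMost) auto
    have "integral {-1..1} (\<lambda>x. f (real M * x) * cis (-(2 * pi * l) * (real M * x)))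
       = (1 / real M) *\<^sub>R integral {- real M..real M} (\<lambda>x. f x * cis (-(2 * pi * l) * x))"
      using integral_stretch_real[of "real M" "- real M" "real M" "\<lambda>x. f x * cis (-(2 * pi * l) * x)"] M
      unfolding img by simp
    moreover have "f (real M * x) * cis (-(2 * pi * l) * (real M * x))
       = of_real (x ^ j * spline s (s - 1) x) * cis (real M * (t - 2 * pi * l) * x)" for x
    proof -
      have "cis (t * (real M * x)) * cis (-(2 * pi * l) * (real M * x)) = cis (real M * (t - 2 * pi * l) * x)"
        unfolding cis_mult by (rule arg_cong[where f = cis]) (simp add: algebra_simps)
      then show ?thesis using M unfolding f_def by (simp add: mult.assoc)
    qed
    ultimately have "spline_moment s j (Suc (s - 1)) (real M * (t - 2 * pi * l))
       = (1 / real M) *\<^sub>R integral {- real M..real M} (\<lambda>x. f x * cis (-(2 * pi * l) * x))"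
      using integral_unique[OF spline_moment_has_integral, of j s "s - 1" "real M * (t - 2 * pi * l)"]
      by (simp only:)
    then show ?thesis using M s by (simp add: scaleR_conv_of_real)
  qed
  with poisson_summation[of f M, OF diff ends] show ?thesis
    unfolding f_def by simp
qed

section \<open>Bounds for the kernel and its derivatives\<close>

lemma sum_int_symmetric:
  fixes a :: "int \<Rightarrow> 'a::comm_monoid_add"
  shows "(\<Sum>l\<in>{-int J..int J}. a l) = a 0 + ((\<Sum>n=1..J. a (int n)) + (\<Sum>n=1..J. a (- int n)))"
proof (induction J)
  case (Suc J)
  have "{-int (Suc J)..int (Suc J)} = insert (int (Suc J)) (insert (- int (Suc J)) {-int J..int J})"
    by auto
  then have "(\<Sum>l\<in>{-int (Suc J)..int (Suc J)}. a l) = a (int (Suc J)) + (a (- int (Suc J)) + (\<Sum>l\<in>{-int J..int J}. a l))"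
    by simp
  then show ?case unfolding Suc by (simp add: add_ac)
qed simp

text \<open>A telescoping majorant: four of the factors contribute at most \<open>1 / 81\<close>,
  two more at most \<open>1 / (4 * n * (n + 1))\<close>, and \<open>324 = 81 * 4\<close>.\<close>

lemma inverse_odd_power_le:
  assumes n: "n \<ge> 1" and s: "s \<ge> 6"
  shows "(1 / (2 * real n + 1)) ^ s \<le> 1 / 324 * (1 / real n - 1 / real (Suc n))"
proof -
  define q where "q = 1 / (2 * real n + 1)"
  have q: "0 \<le> q" "q \<le> 1 / 3" using n by (auto simp: q_def field_simps)
  have "q ^ s \<le> q ^ 6" using q s by (intro power_decreasing) auto
  also have "\<dots> = q ^ 4 * q ^ 2" by (simp flip: power_add)
  also have "\<dots> \<le> (1 / 3) ^ 4 * q ^ 2" using q by (intro mult_right_mono power_mono) auto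
  also have "q ^ 2 \<le> 1 / (4 * real n * (real n + 1))"
  proof -
    have "4 * real n * (real n + 1) \<le> (2 * real n + 1) ^ 2" by (simp add: power2_eq_square algebra_simps)
    then have "1 / (2 * real n + 1) ^ 2 \<le> 1 / (4 * real n * (real n + 1))"
      using n by (intro divide_left_mono) auto
    then show ?thesis by (simp add: q_def power_divide)
  qed
  also have "(1 / 3) ^ 4 * (1 / (4 * real n * (real n + 1))) = 1 / 324 * (1 / real n - 1 / real (Suc n))"
    using n by (simp add: field_simps power4_eq_xxxx)
  finally show ?thesis by (simp add: q_def)
qed

text \<open>Each of the two tails telescopes to at most \<open>1 / 324\<close>. The positive one
  starts at 2, because the term at 1 is kept apart as the possibly large alias.\<close>

lemma sum_symmetric_le:
  fixes a :: "int \<Rightarrow> real"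
  assumes a0: "a 0 \<le> A0" and a1: "a 1 \<le> A1" and A1: "A1 \<ge> 0"
    and neg: "\<And>n::nat. n \<ge> 1 \<Longrightarrow> a (- int n) \<le> 1 / 324 * (1 / real n - 1 / real (Suc n))"
    and pos: "\<And>n::nat. n \<ge> 1 \<Longrightarrow> a (int (Suc n)) \<le> 1 / 324 * (1 / real n - 1 / real (Suc n))"
  shows "(\<Sum>l\<in>{-int J..int J}. a l) \<le> A0 + A1 + 1 / 162"
proof -
  have "(\<Sum>n=1..J. a (- int n)) \<le> 1 / 324 * (1 - 1 / real (Suc J))"
  proof (induction J)
    case (Suc J)
    have "(\<Sum>n=1..Suc J. a (- int n)) = (\<Sum>n=1..J. a (- int n)) + a (- int (Suc J))" by simp
    then show ?case using Suc neg[of "Suc J"] unfolding right_diff_distrib by linarith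
  qed simp
  also have "\<dots> \<le> 1 / 324" by simp
  finally have 1: "(\<Sum>n=1..J. a (- int n)) \<le> 1 / 324" .
  have "(\<Sum>n=1..Suc J. a (int n)) \<le> A1 + 1 / 324 * (1 - 1 / real (Suc J))" for J
  proof (induction J)
    case (Suc J)
    have "(\<Sum>n=1..Suc (Suc J). a (int n)) = (\<Sum>n=1..Suc J. a (int n)) + a (int (Suc (Suc J)))" by simp
    then show ?case using Suc pos[of "Suc J"] unfolding right_diff_distrib by linarith
  qed (use a1 in simp)
  then have "(\<Sum>n=1..Suc J. a (int n)) \<le> A1 + 1 / 324" for J
    by (rule order_trans) simp
  then have 2: "(\<Sum>n=1..J. a (int n)) \<le> A1 + 1 / 324"
    using A1 by (cases J) (simp_all del: sum.cl_ivl_Suc)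
  show ?thesis unfolding sum_int_symmetric using 1 2 a0 by linarith
qed

text \<open>The frequency \<open>t - 2 * pi\<close> contributes as much as \<open>t\<close> when \<open>t\<close> is near \<open>pi\<close>, hence the factor 2.\<close>
definition alias_factor :: "real \<Rightarrow> real" where
  "alias_factor t = (if t \<le> pi / 2 then 1.01 else 2.01)"

text \<open>Since \<open>t \<le> pi\<close>, the frequencies with \<open>l = - n\<close> and
  \<open>l = n + 1\<close> are at least \<open>(2 * n + 1) * t\<close> in modulus. For
  \<open>l = 1\<close> this gives only the ratio 1, but for \<open>t \<le> pi / 2\<close> the ratio
  is at most \<open>1 / 3\<close>.\<close>

lemma sum_alias_le:
  assumes t: "0 < t" "t \<le> pi" and s: "s \<ge> 6"
  shows "(\<Sum>l\<in>{-int J..int J}. (t / \<bar>t - 2 * pi * real_of_int l\<bar>) ^ s) \<le> alias_factor t"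
proof -
  define a where "a l = (t / \<bar>t - 2 * pi * real_of_int l\<bar>) ^ s" for l
  have neg: "a (- int n) \<le> 1 / 324 * (1 / real n - 1 / real (Suc n))" if "n \<ge> 1" for n :: nat
  proof -
    have "t * (2 * real n + 1) \<le> t + 2 * pi * real n"
      using t mult_right_mono[of t pi "2 * real n"] by (simp add: algebra_simps)
    then have "t / \<bar>t - 2 * pi * real_of_int (- int n)\<bar> \<le> 1 / (2 * real n + 1)"
      using t by (simp add: field_simps add_pos_nonneg)
    then have "a (- int n) \<le> (1 / (2 * real n + 1)) ^ s"
      unfolding a_def using t by (intro power_mono) auto
    then show ?thesis using inverse_odd_power_le[OF that s] by linarith
  qed
  have pos: "a (int (Suc n)) \<le> 1 / 324 * (1 / real n - 1 / real (Suc n))" if "n \<ge> 1" for n :: nat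
  proof -
    have *: "t * (2 * real n + 2) \<le> 2 * pi * real (Suc n)"
      using t mult_right_mono[of t pi "2 * real n + 2"] by (simp add: algebra_simps)
    then have "t * (2 * real n + 1) \<le> 2 * pi * real (Suc n) - t" by (simp add: algebra_simps)
    moreover have "0 < t * (2 * real n + 1)" using t by simp
    ultimately have "t / \<bar>t - 2 * pi * real_of_int (int (Suc n))\<bar> \<le> 1 / (2 * real n + 1)"
      by (simp add: field_simps abs_if)
    then have "a (int (Suc n)) \<le> (1 / (2 * real n + 1)) ^ s"
      unfolding a_def using t by (intro power_mono) auto
    then show ?thesis using inverse_odd_power_le[OF that s] by linarith
  qed
  have a0: "a 0 \<le> 1" using t by (simp add: a_def)
  show ?thesis
  proof (cases "t \<le> pi / 2")
    case True
    have "t / \<bar>t - 2 * pi * real_of_int 1\<bar> \<le> 1 / (2 * real 1 + 1)"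
      using t True by (simp add: field_simps abs_if)
    then have "a 1 \<le> (1 / (2 * real 1 + 1)) ^ s"
      unfolding a_def using t by (intro power_mono) auto
    also have "\<dots> \<le> 1 / 324 * (1 / real 1 - 1 / real (Suc 1))"
      by (rule inverse_odd_power_le) (use s in auto)
    finally have "a 1 \<le> 1 / 648" by simp
    from sum_symmetric_le[OF a0 this _ neg pos, of J] True
    show ?thesis by (simp add: alias_factor_def a_def)
  next
    case False
    have "t / \<bar>t - 2 * pi * real_of_int 1\<bar> \<le> 1"
      using t by (simp add: field_simps abs_if)
    then have "a 1 \<le> 1 ^ s"
      unfolding a_def using t by (intro power_mono) auto
    then have "a 1 \<le> 1" by simp
    from sum_symmetric_le[OF a0 this _ neg pos, of J] False
    show ?thesis by (simp add: alias_factor_def a_def)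
  qed
qed

text \<open>Factoring out the decay at the frequency with \<open>l = 0\<close> leaves the ratios of
  \<open>sum_alias_le\<close>, whose bound is uniform in \<open>J\<close> and so passes to the
  limit.\<close>

lemma aliased_limit_le:
  fixes F :: "real \<Rightarrow> complex"
  assumes F: "\<And>\<xi>. \<bar>\<xi>\<bar> ^ s * cmod (F \<xi>) \<le> K" and M: "M > (0::nat)" and t: "0 < t" "t \<le> pi" and s: "s \<ge> 6"
    and lim: "(\<lambda>J. \<Sum>l\<in>{-int J..int J}. of_nat M * F (real M * (t - 2 * pi * real_of_int l))) \<longlonglongrightarrow> S"
  shows "cmod S \<le> real M * K / (real M * t) ^ s * alias_factor t"
proof -
  have K: "K \<ge> 0" using order_trans[OF norm_ge_zero, of "F 1" K] F[of 1] by simp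
  have "cmod (\<Sum>l\<in>{-int J..int J}. of_nat M * F (real M * (t - 2 * pi * real_of_int l)))
      \<le> real M * K / (real M * t) ^ s * alias_factor t" for J
  proof -
    have "cmod (\<Sum>l\<in>{-int J..int J}. of_nat M * F (real M * (t - 2 * pi * real_of_int l)))
       \<le> (\<Sum>l\<in>{-int J..int J}. real M * K / (real M * t) ^ s * (t / \<bar>t - 2 * pi * real_of_int l\<bar>) ^ s)"
    proof (rule sum_norm_le)
      fix l :: int
      define d where "d = t - 2 * pi * real_of_int l"
      have d: "d \<noteq> 0"
      proof
        assume "d = 0"
        then have "t = 2 * pi * real_of_int l" by (simp add: d_def)
        with t have "0 < real_of_int l" "2 * real_of_int l \<le> 1" by (auto simp: zero_less_mult_iff)
        then have "0 < l" "2 * l \<le> 1" by linarith+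
        then show False by linarith
      qed
      have "cmod (F (real M * d)) \<le> K / (real M * \<bar>d\<bar>) ^ s"
        using F[of "real M * d"] d M by (simp add: abs_mult pos_le_divide_eq mult.commute)
      then have "real M * cmod (F (real M * d)) \<le> real M * (K / (real M * \<bar>d\<bar>) ^ s)"
        by (rule mult_left_mono) simp
      also have "\<dots> = real M * K / (real M * t) ^ s * (t / \<bar>d\<bar>) ^ s"
        using t d M by (simp add: power_mult_distrib power_divide)
      finally show "cmod (of_nat M * F (real M * (t - 2 * pi * real_of_int l)))
         \<le> real M * K / (real M * t) ^ s * (t / \<bar>t - 2 * pi * real_of_int l\<bar>) ^ s"
        by (simp add: norm_mult d_def)
    qed
    also have "\<dots> = real M * K / (real M * t) ^ s * (\<Sum>l\<in>{-int J..int J}. (t / \<bar>t - 2 * pi * real_of_int l\<bar>) ^ s)"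
      by (rule sum_distrib_left[symmetric])
    also have "\<dots> \<le> real M * K / (real M * t) ^ s * alias_factor t"
      using K t by (intro mult_left_mono sum_alias_le s) auto
    finally show ?thesis .
  qed
  with lim show ?thesis by (intro Lim_bounded[OF tendsto_norm[OF lim], of 0]) auto
qed

lemma spline_moment_at_0:
  assumes "s > 0" "even s"
  shows "spline_moment s 0 s 0 = of_real (4 * real s / (2 ^ s * fact s))"
proof -
  obtain m where m: "s = Suc m" using assms by (cases s) auto
  have "node_moment 0 m 0 a = of_real ((1 - a) ^ s / fact s)" if "a \<le> 1" for a
    \<comment> \<open>At \<open>j = 0\<close> and frequency 0 the left side of the integration by
      parts vanishes and the right side evaluates the integral.\<close>
    using node_moment_Suc[OF that, of 0 m 0] by (simp add: m del: fact_Suc power_Suc)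
  then have "spline_moment s 0 (Suc m) 0 = (\<Sum>k<2 * s. (-1) ^ k * of_real ((1 - node s k) ^ s / fact s))"
    unfolding spline_moment.simps by (simp add: node_le_1)
  also have "\<dots> = of_real ((\<Sum>k<2 * s. (-1) ^ k * (1 - node s k) ^ s) / fact s)"
    by (simp add: sum_divide_distrib)
  finally show ?thesis
    using alternating_one_diff_node_power_self[OF assms] by (simp add: m[symmetric])
qed

text \<open>Poisson summation at \<open>t = 0\<close>: the term \<open>l = 0\<close> is
  \<open>M\<close> times the integral of the spline and the rest is at most \<open>4 * C\<close>.
  Relative to the main term this is \<open>2 * s! / (pi * M) ^ s\<close>; from
  \<open>s! \<le> s ^ s\<close> and \<open>2 * s \<le> M\<close> it is at most twice
  \<open>6 ^ (-s)\<close>, which is below \<open>0.0001\<close>.\<close>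

lemma norm_sum_lower_bound:
  assumes s: "s \<ge> 6" "even s" and M: "M \<ge> 2 * s"
    and lim: "(\<lambda>J. \<Sum>l\<in>{-int J..int J}. of_nat M * spline_moment s 0 s (real M * (0 - 2 * pi * real_of_int l)))
        \<longlonglongrightarrow> of_real S"
  shows "S \<ge> real M * (4 * real s / (2 ^ s * fact s)) * 0.9999"
proof -
  define I where "I = 4 * real s / (2 ^ s * fact s)"
  define F where "F l = of_nat M * spline_moment s 0 s (real M * (0 - 2 * pi * real_of_int l))" for l
  define C where "C = real M * (2 * real s) / (2 * pi * real M) ^ s"
  have M0: "M > 0" "real M > 0" using M s by auto
  have F0: "F 0 = of_real (real M * I)"
    using spline_moment_at_0[of s] s by (simp add: F_def I_def)
  have Fn: "cmod (F l) \<le> C * (1 / real n ^ 2)" if "\<bar>l\<bar> = int n" "n \<ge> 1" for l n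
  proof -
    have l: "\<bar>real_of_int l\<bar> = real n" using that by linarith
    have "(2 * pi * real M * real n) ^ s * cmod (spline_moment s 0 s (real M * (0 - 2 * pi * real_of_int l))) \<le> 2 * real s"
      using norm_spline_moment_bounds(1)[of s "real M * (0 - 2 * pi * real_of_int l)"] s
      by (simp add: abs_mult l mult_ac)
    then have "cmod (spline_moment s 0 s (real M * (0 - 2 * pi * real_of_int l))) \<le> 2 * real s / (2 * pi * real M * real n) ^ s"
      using M0 that by (simp add: pos_le_divide_eq mult.commute)
    then have "cmod (F l) \<le> real M * (2 * real s / (2 * pi * real M * real n) ^ s)"
      unfolding F_def norm_mult norm_of_nat by (rule mult_left_mono) simp
    also have "\<dots> = C * (1 / real n ^ s)" by (simp add: C_def power_mult_distrib)
    also have "\<dots> \<le> C * (1 / real n ^ 2)"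
      using that s by (intro mult_left_mono divide_left_mono power_increasing) (auto simp: C_def)
    finally show ?thesis .
  qed
  have sq: "(\<Sum>n=1..J. 1 / real n ^ 2) \<le> 2" for J
  proof (cases J)
    case (Suc J')
    have "(\<Sum>n=1..Suc J. 1 / real n ^ 2) \<le> 2 - 1 / real (Suc J)" for J
    proof (induction J)
      case (Suc J)
      have "1 / real (Suc (Suc J)) ^ 2 \<le> 1 / (real (Suc J) * real (Suc (Suc J)))"
        by (intro divide_left_mono) (auto simp: power2_eq_square)
      also have "\<dots> = 1 / real (Suc J) - 1 / real (Suc (Suc J))"
        by (simp add: divide_simps)
      finally have "1 / real (Suc (Suc J)) ^ 2 \<le> 1 / real (Suc J) - 1 / real (Suc (Suc J))" .
      moreover have "(\<Sum>n=1..Suc (Suc J). 1 / real n ^ 2) = (\<Sum>n=1..Suc J. 1 / real n ^ 2) + 1 / real (Suc (Suc J)) ^ 2"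
        by simp
      ultimately show ?case using Suc by linarith
    qed simp
    from this[of J'] have "(\<Sum>n=1..J. 1 / real n ^ 2) \<le> 2 - 1 / real J" using Suc by simp
    also have "\<dots> \<le> 2" by simp
    finally show ?thesis .
  qed simp
  have bd: "cmod ((\<Sum>l\<in>{-int J..int J}. F l) - of_real (real M * I)) \<le> 4 * C" for J
  proof -
    have C0: "C \<ge> 0" by (simp add: C_def)
    have "cmod (\<Sum>n=1..J. F (int n)) \<le> C * 2" "cmod (\<Sum>n=1..J. F (- int n)) \<le> C * 2"
    proof -
      have le: "(\<Sum>n=1..J. C * (1 / real n ^ 2)) \<le> C * 2"
        unfolding sum_distrib_left[symmetric] using C0 sq[of J] by (intro mult_left_mono)
      show "cmod (\<Sum>n=1..J. F (int n)) \<le> C * 2"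
        by (rule order_trans[OF sum_norm_le le]) (rule Fn, auto)
      show "cmod (\<Sum>n=1..J. F (- int n)) \<le> C * 2"
        by (rule order_trans[OF sum_norm_le le]) (rule Fn, auto)
    qed
    then show ?thesis
      unfolding sum_int_symmetric F0 
      using norm_triangle_ineq[of "\<Sum>n=1..J. F (int n)" "\<Sum>n=1..J. F (- int n)"] by simp
  qed
  have "cmod (of_real S - of_real (real M * I)) \<le> 4 * C"
    using bd by (intro Lim_bounded[OF tendsto_norm[OF tendsto_diff[OF lim[folded F_def] tendsto_const]], of 0]) auto
  then have "\<bar>S - real M * I\<bar> \<le> 4 * C"
    unfolding of_real_diff[symmetric] norm_of_real .
  moreover have "4 * C \<le> real M * I * 0.0001"
  proof -
    have "real s / (pi * real M) \<le> 1 / 6"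
    proof -
      have "6 * real s \<le> 3 * real M" using M by simp
      also have "\<dots> \<le> pi * real M" using pi_gt3 by (intro mult_right_mono) auto
      finally show ?thesis using M0 by (simp add: field_simps)
    qed
    then have "(real s / (pi * real M)) ^ s \<le> (1 / 6) ^ s" by (intro power_mono) auto
    also have "\<dots> \<le> (1 / 6) ^ 6" using s by (intro power_decreasing) auto
    also have "\<dots> \<le> 0.00005" by (simp add: power_divide)
    finally have small: "real s ^ s / (pi * real M) ^ s \<le> 0.00005" by (simp add: power_divide)
    have "fact s / (pi * real M) ^ s \<le> real s ^ s / (pi * real M) ^ s"
      using fact_le_power[of s] M0 by (intro divide_right_mono) (auto simp flip: of_nat_power)
    with small have small': "fact s / (pi * real M) ^ s \<le> 0.00005" by linarith
    have "4 * C = real M * I * 2 * (fact s / (pi * real M) ^ s)"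
      by (simp add: C_def I_def power_mult_distrib field_simps)
    also have "\<dots> \<le> real M * I * 2 * 0.00005"
      using small' by (intro mult_left_mono) (auto simp: I_def)
    finally show ?thesis by (simp add: mult.commute)
  qed
  ultimately show ?thesis unfolding I_def[symmetric] by (simp add: abs_le_iff)
qed

section \<open>Numerical bounds for pi and the tangent\<close>

lemma le_tan:
  assumes "0 \<le> x" "x < pi / 2"
  shows "x \<le> tan x"
proof -
  have "0 - 0 * cos 0 \<le> sin x - x * cos x"
  proof -
    have "\<exists>y. ((\<lambda>x. sin x - x * cos x) has_real_derivative y) (at u) \<and> 0 \<le> y" if "0 \<le> u" "u \<le> x" for u
      by (rule exI[of _ "u * sin u"])
         (use that assms in \<open>auto intro!: derivative_eq_intros mult_nonneg_nonneg sin_ge_zero\<close>)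
    from DERIV_nonneg_imp_nondecreasing[OF assms(1) this] show ?thesis by simp
  qed
  moreover have "cos x > 0" using assms by (intro cos_gt_zero_pi) auto
  ultimately show ?thesis by (simp add: tan_def pos_le_divide_eq)
qed

text \<open>The inequality \<open>x \<le> tan x\<close> at \<open>pi / 6\<close> gives
  \<open>pi \<le> 2 * sqrt 3\<close>, which is precise enough here.\<close>

lemma pi_le: "pi \<le> 3.4642"
proof -
  have "pi / 6 \<le> 1 / sqrt 3" using le_tan[of "pi / 6"] by (simp add: tan_30)
  moreover have "sqrt 3 * sqrt 3 = 3" by simp
  then have "1 / sqrt 3 = sqrt 3 / 3" by (simp add: field_simps)
  moreover have "sqrt 3 \<le> 1.7321" by (rule real_le_lsqrt) (auto simp: power2_eq_square)
  ultimately show ?thesis by simp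
qed

text \<open>\<open>1.81\<close> is \<open>1.7321 / 0.9583\<close> rounded up: half the bound for
  \<open>pi\<close>, divided by a lower bound for the cosine when \<open>s \<ge> 6\<close>.\<close>

lemma tan_small_le:
  assumes "s \<ge> (6::nat)"
  shows "tan (pi / (2 * real s)) \<le> 1.81 / real s"
proof -
  define u where "u = pi / (2 * real s)"
  have u0: "u > 0" using assms by (simp add: u_def)
  have us: "u \<le> 1.7321 / real s" using assms pi_le by (simp add: u_def field_simps)
  also have "\<dots> \<le> 1.7321 / 6" using assms by (intro divide_left_mono) auto
  finally have u1: "u \<le> 0.2887" by simp
  have "sin (u / 2) \<le> u / 2" "0 \<le> sin (u / 2)" using u0 u1 pi_gt3 sin_x_le_x[of "u / 2"] sin_ge_zero[of "u / 2"] by auto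
  then have "sin (u / 2) ^ 2 \<le> (u / 2) ^ 2" by (intro power_mono)
  also have "\<dots> \<le> (0.2887 / 2) ^ 2" using u0 u1 by (intro power_mono) auto
  also have "\<dots> \<le> 0.02084" by (simp add: power2_eq_square)
  finally have "sin (u / 2) ^ 2 \<le> 0.02084" .
  moreover have "cos u = 1 - 2 * sin (u / 2) ^ 2" using cos_double_sin[of "u / 2"] by simp
  ultimately have cu: "cos u \<ge> 0.9583" by simp
  have "sin u \<le> u" using u0 by (intro sin_x_le_x) auto
  then have "tan u \<le> u / cos u" using cu by (simp add: tan_def divide_right_mono)
  also have "\<dots> \<le> (1.7321 / real s) / cos u" using us cu by (intro divide_right_mono) auto
  also have "\<dots> \<le> (1.7321 / real s) / 0.9583" using cu assms by (intro divide_left_mono) auto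
  also have "\<dots> \<le> 1.81 / real s" using assms by (simp add: field_simps)
  finally show ?thesis by (simp add: u_def)
qed

section \<open>The kernel as a function of the angle\<close>

definition sampled :: "nat \<Rightarrow> nat \<Rightarrow> nat \<Rightarrow> real \<Rightarrow> complex" where
  "sampled s N j t = (\<Sum>k\<in>{-int N..int N}.
     of_real ((real_of_int k / (real N + 1)) ^ j * spline s (s - 1) (real_of_int k / (real N + 1))) * cis (t * real_of_int k))"

lemma sampled_limit:
  assumes s: "s \<ge> 3"
  shows "(\<lambda>J. \<Sum>l\<in>{-int J..int J}. of_nat (Suc N) * spline_moment s j s (real (Suc N) * (t - 2 * pi * real_of_int l)))
     \<longlonglongrightarrow> sampled s N j t"
proof -
  define h where "h k = complex_of_real ((real_of_int k / real (Suc N)) ^ j * spline s (s - 1) (real_of_int k / real (Suc N)))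
      * cis (t * real_of_int k)" for k
  have "(\<Sum>n<2 * Suc N. h (int n - int (Suc N))) = (\<Sum>k\<in>{- int (Suc N)..<int (Suc N)}. h k)"
    by (rule sum.reindex_bij_witness[of _ "\<lambda>k. nat (k + int (Suc N))" "\<lambda>n. int n - int (Suc N)"]) auto
  also have "{- int (Suc N)..<int (Suc N)} = insert (- int (Suc N)) {-int N..int N}" by auto
  also have "(\<Sum>k\<in>insert (- int (Suc N)) {-int N..int N}. h k) = h (- int (Suc N)) + (\<Sum>k\<in>{-int N..int N}. h k)"
    by (rule sum.insert) auto
  \<comment> \<open>Poisson summation with \<open>M = N + 1\<close> has one sample more than the
    kernel; it sits at -1, where the spline vanishes.\<close>
  also have "h (- int (Suc N)) = 0"
  proof -
    have "real_of_int (- int (Suc N)) / real (Suc N) = -1" by (simp add: field_simps)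
    then show ?thesis using spline_eq_0_left[of "-1" s "s - 1"] unfolding h_def by simp
  qed
  finally have "(\<Sum>n<2 * Suc N. h (int n - int (Suc N))) = sampled s N j t"
    by (simp add: sampled_def h_def add.commute)
  with spline_poisson[OF s, of "Suc N" j t] show ?thesis
    by (simp add: h_def)
qed

definition grid :: "nat \<Rightarrow> real" where "grid N = real N + 1"

text \<open>Four divided by the integral of the B-spline.\<close>

definition amp :: "nat \<Rightarrow> real" where "amp s = fact (s - 1) * 2 ^ s"

definition kern :: "nat \<Rightarrow> nat \<Rightarrow> real \<Rightarrow> real" where
  "kern s N t = (\<Sum>k\<in>{-int N..int N}. spline s (s - 1) (real_of_int k / grid N) * cos (real_of_int k * t))
     / pbnorm (s - 1) N"

definition kern' :: "nat \<Rightarrow> nat \<Rightarrow> real \<Rightarrow> real" where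
  "kern' s N t = (\<Sum>k\<in>{-int N..int N}. spline s (s - 1) (real_of_int k / grid N)
     * (- sin (real_of_int k * t) * real_of_int k)) / pbnorm (s - 1) N"

definition kern'' :: "nat \<Rightarrow> nat \<Rightarrow> real \<Rightarrow> real" where
  "kern'' s N t = (\<Sum>k\<in>{-int N..int N}. spline s (s - 1) (real_of_int k / grid N)
     * (- (cos (real_of_int k * t) * real_of_int k) * real_of_int k)) / pbnorm (s - 1) N"

lemma kern_deriv: "(kern s N has_real_derivative kern' s N t) (at t)"
  unfolding kern_def[abs_def] kern'_def by (auto intro!: derivative_eq_intros DERIV_cdivide simp: mult_ac)

lemma kern'_deriv: "(kern' s N has_real_derivative kern'' s N t) (at t)"
  unfolding kern'_def[abs_def] kern''_def by (auto intro!: derivative_eq_intros DERIV_cdivide simp: mult_ac)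

context
  fixes s N :: nat
  assumes s: "even s" "s \<ge> 6" and N: "N \<ge> 2 * s"
begin

lemma pbspline_t_eq: "pbspline_t (s - 1) (real_of_int k / (2 * (real N + 1))) = spline s (s - 1) (real_of_int k / grid N)"
proof -
  have "2 * (a / (2 * b)) = a / b" for a b :: real by simp
  then show ?thesis unfolding pbspline_t_def grid_def using s by (subst pbspline_eq_spline) (simp_all only:)
qed

lemma pbnorm_eq: "complex_of_real (pbnorm (s - 1) N) = sampled s N 0 0"
  unfolding pbnorm_def sampled_def pbspline_t_eq grid_def by simp

lemma grid_ge: "grid N \<ge> 13" and amp_pos: "amp s > 0"
  using s N by (auto simp: grid_def amp_def)

lemma pbnorm_ge: "pbnorm (s - 1) N \<ge> grid N * (4 / amp s) * 0.9999"
proof -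
  have "pbnorm (s - 1) N \<ge> real (Suc N) * (4 * real s / (2 ^ s * fact s)) * 0.9999"
    by (rule norm_sum_lower_bound[OF s(2,1)]) (unfold pbnorm_eq, use s N in simp, rule sampled_limit, use s in simp)
  moreover have "fact s = real s * fact (s - 1)" using s by (simp add: fact_reduce)
  then have "4 * real s / (2 ^ s * fact s) = 4 / amp s" using s by (simp add: amp_def)
  ultimately show ?thesis by (simp add: grid_def add.commute)
qed

lemma pbnorm_pos: "pbnorm (s - 1) N > 0"
proof -
  have "0 < grid N * (4 / amp s) * 0.9999" using grid_ge amp_pos by simp
  then show ?thesis using pbnorm_ge by linarith
qed

lemma sigma_t_eq: "sigma_t s N t = of_real (kern s N t)"
proof -
  let ?g = "\<lambda>k. spline s (s - 1) (real_of_int k / grid N)"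
  have "(\<Sum>k\<in>{-int N..int N}. ?g k * sin (real_of_int k * t)) = (\<Sum>k\<in>{-int N..int N}. ?g (- k) * sin (real_of_int (- k) * t))"
    by (rule sum.reindex_bij_witness[of _ uminus uminus]) auto
  also have "\<dots> = - (\<Sum>k\<in>{-int N..int N}. ?g k * sin (real_of_int k * t))"
    using spline_even[of s] s by (simp add: sum_negf)
  finally have 0: "(\<Sum>k\<in>{-int N..int N}. ?g k * sin (real_of_int k * t)) = 0" by simp
  have "(\<Sum>k\<in>{-int N..int N}. complex_of_real (?g k) * exp (\<i> * complex_of_real (real_of_int k * t)))
    = (\<Sum>k\<in>{-int N..int N}. complex_of_real (?g k * cos (real_of_int k * t)) + \<i> * complex_of_real (?g k * sin (real_of_int k * t)))"
    by (intro sum.cong refl) (simp only: cis_conv_exp[symmetric], simp add: complex_eq_iff)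
  also have "\<dots> = complex_of_real (\<Sum>k\<in>{-int N..int N}. ?g k * cos (real_of_int k * t))
      + \<i> * complex_of_real (\<Sum>k\<in>{-int N..int N}. ?g k * sin (real_of_int k * t))"
    by (simp only: sum.distrib of_real_sum sum_distrib_left)
  finally show ?thesis
    unfolding sigma_t_def pbspline_t_eq kern_def 0 by simp
qed

text \<open>Differentiation brings down \<open>k\<close>, which is \<open>grid N\<close> times the
  sample point: hence the moment with \<open>j = 1\<close> and one more factor
  \<open>grid N\<close>.\<close>

lemma abs_kern'_le:
  assumes t: "0 < t" "t \<le> pi"
  shows "\<bar>kern' s N t\<bar> \<le> amp s * real s * grid N / (grid N * t) ^ s * (alias_factor t / 0.9999)"
proof -
  have "kern' s N t * pbnorm (s - 1) N = (\<Sum>k\<in>{-int N..int N}.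
      spline s (s - 1) (real_of_int k / grid N) * (- sin (real_of_int k * t) * real_of_int k))"
    using pbnorm_pos unfolding kern'_def by simp
  also have "\<dots> = - grid N * Im (sampled s N 1 t)"
    unfolding sampled_def grid_def[symmetric] Im_sum sum_distrib_left
    by (intro sum.cong refl) (use grid_ge in \<open>simp add: mult_ac\<close>)
  finally have "\<bar>kern' s N t * pbnorm (s - 1) N\<bar> = \<bar>- grid N * Im (sampled s N 1 t)\<bar>" by (simp only:)
  then have "\<bar>kern' s N t\<bar> * pbnorm (s - 1) N = grid N * \<bar>Im (sampled s N 1 t)\<bar>"
    using pbnorm_pos grid_ge by (simp add: abs_mult)
  also have "\<dots> \<le> grid N * cmod (sampled s N 1 t)"
    using grid_ge abs_Im_le_cmod by (intro mult_left_mono) auto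
  also have "\<dots> \<le> grid N * (grid N * (4 * real s) / (grid N * t) ^ s * alias_factor t)"
    using aliased_limit_le[OF norm_spline_moment_bounds(2) _ t s(2) sampled_limit, of N] s grid_ge
    by (intro mult_left_mono) (auto simp: grid_def add.commute)
  finally have 1: "\<bar>kern' s N t\<bar> * pbnorm (s - 1) N \<le> grid N * (grid N * (4 * real s) / (grid N * t) ^ s * alias_factor t)" .
  have "\<bar>kern' s N t\<bar> * (grid N * (4 / amp s) * 0.9999) \<le> \<bar>kern' s N t\<bar> * pbnorm (s - 1) N"
    by (intro mult_left_mono pbnorm_ge) auto
  also note 1
  finally have "\<bar>kern' s N t\<bar> \<le> grid N * (grid N * (4 * real s) / (grid N * t) ^ s * alias_factor t) / (grid N * (4 / amp s) * 0.9999)"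
    using grid_ge amp_pos by (subst pos_le_divide_eq) auto
  also have "\<dots> = amp s * real s * grid N / (grid N * t) ^ s * (alias_factor t / 0.9999)"
    using grid_ge amp_pos by simp
  finally show ?thesis .
qed

lemma abs_kern''_le:
  assumes t: "0 < t" "t \<le> pi"
  shows "\<bar>kern'' s N t\<bar> \<le> amp s * (1.905 * real s) * grid N ^ 2 / (grid N * t) ^ s * (alias_factor t / 0.9999)"
proof -
  define K where "K = 4 * real s + real s * (real s - 1) * (2 * tan (pi / (2 * real s)))"
  \<comment> \<open>The bound is \<open>4 * s + 3.62 * (s - 1)\<close>, and
    \<open>4 + 3.62 = 4 * 1.905\<close>.\<close>
  have K: "K \<le> 4 * (1.905 * real s)"
  proof -
    have "real s * (real s - 1) * (2 * tan (pi / (2 * real s))) \<le> real s * (real s - 1) * (2 * (1.81 / real s))"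
      using s by (intro mult_left_mono tan_small_le) auto
    also have "\<dots> = (real s - 1) * 3.62" using s by simp
    finally show ?thesis by (simp add: K_def)
  qed
  have "kern'' s N t * pbnorm (s - 1) N = (\<Sum>k\<in>{-int N..int N}.
      spline s (s - 1) (real_of_int k / grid N) * (- (cos (real_of_int k * t) * real_of_int k) * real_of_int k))"
    using pbnorm_pos unfolding kern''_def by simp
  also have "\<dots> = - (grid N ^ 2) * Re (sampled s N 2 t)"
    unfolding sampled_def grid_def[symmetric] Re_sum sum_distrib_left
    by (intro sum.cong refl) (use grid_ge in \<open>simp add: power2_eq_square mult_ac\<close>)
  finally have "\<bar>kern'' s N t * pbnorm (s - 1) N\<bar> = \<bar>- (grid N ^ 2) * Re (sampled s N 2 t)\<bar>" by (simp only:)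
  then have "\<bar>kern'' s N t\<bar> * pbnorm (s - 1) N = grid N ^ 2 * \<bar>Re (sampled s N 2 t)\<bar>"
    using pbnorm_pos by (simp add: abs_mult)
  also have "\<dots> \<le> grid N ^ 2 * cmod (sampled s N 2 t)"
    using abs_Re_le_cmod by (intro mult_left_mono) auto
  also have "\<dots> \<le> grid N ^ 2 * (grid N * K / (grid N * t) ^ s * alias_factor t)"
    using aliased_limit_le[OF norm_spline_moment_bounds(3) _ t s(2) sampled_limit, of N] s
    by (intro mult_left_mono) (auto simp: grid_def K_def add.commute)
  also have "\<dots> \<le> grid N ^ 2 * (grid N * (4 * (1.905 * real s)) / (grid N * t) ^ s * alias_factor t)"
    using K grid_ge t by (intro mult_left_mono mult_right_mono divide_right_mono) (auto simp: alias_factor_def)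
  finally have 1: "\<bar>kern'' s N t\<bar> * pbnorm (s - 1) N \<le> grid N ^ 2 * (grid N * (4 * (1.905 * real s)) / (grid N * t) ^ s * alias_factor t)" .
  have "\<bar>kern'' s N t\<bar> * (grid N * (4 / amp s) * 0.9999) \<le> \<bar>kern'' s N t\<bar> * pbnorm (s - 1) N"
    by (intro mult_left_mono pbnorm_ge) auto
  also note 1
  finally have "\<bar>kern'' s N t\<bar> \<le> grid N ^ 2 * (grid N * (4 * (1.905 * real s)) / (grid N * t) ^ s * alias_factor t) / (grid N * (4 / amp s) * 0.9999)"
    using grid_ge amp_pos by (subst pos_le_divide_eq) auto
  also have "\<dots> = amp s * (1.905 * real s) * grid N ^ 2 / (grid N * t) ^ s * (alias_factor t / 0.9999)"
    using grid_ge amp_pos by simp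
  finally show ?thesis .
qed

lemma kern'_bound:
  assumes t: "0 < t" "t \<le> pi"
  shows "\<bar>kern' s N t\<bar> \<le> c1 s / ((real N + 1) ^ (s - 1) * t ^ s)"
proof -
  have "\<bar>kern' s N t\<bar> \<le> amp s * real s * grid N / (grid N * t) ^ s * (alias_factor t / 0.9999)"
    by (rule abs_kern'_le[OF t])
  also have "\<dots> \<le> amp s * real s * grid N / (grid N * t) ^ s * 2.04"
    using grid_ge amp_pos t by (intro mult_left_mono) (auto simp: alias_factor_def)
  also have "(grid N * t) ^ s = grid N * (grid N ^ (s - 1) * t ^ s)"
    using s by (simp add: power_mult_distrib power_eq_if[of "grid N" s])
  also have "amp s * real s * grid N / (grid N * (grid N ^ (s - 1) * t ^ s)) * 2.04 = c1 s / (grid N ^ (s - 1) * t ^ s)"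
    using grid_ge by (simp add: c1_def amp_def mult_ac)
  finally show ?thesis by (simp add: grid_def)
qed

text \<open>\<open>E\<close> stands for the coefficient of the first derivative on the group. Up to
  \<open>pi / 2\<close> the alias factor is close to 1 and \<open>E \<le> grid N\<close> is enough,
  which is where the lower bound on \<open>t\<close> enters. Beyond \<open>pi / 2\<close> the alias
  factor doubles, but then \<open>E / grid N \<le> 1 / 13\<close>.\<close>

lemma kern''_bound:
  assumes t: "pi / (2 * grid N) \<le> t" "t \<le> pi" and E: "0 \<le> E" "E \<le> 1 / t + 1 / 2" "t > pi / 2 \<Longrightarrow> E \<le> 1"
  shows "\<bar>kern'' s N t\<bar> + \<bar>kern' s N t\<bar> * E \<le> c2 s / ((real N + 1) ^ (s - 2) * t ^ s)"
proof -
  have "pi / (2 * grid N) > 0" using grid_ge by simp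
  then have t0: "0 < t" using t by linarith
  define Q where "Q = amp s * real s * grid N ^ 2 / (grid N * t) ^ s"
  have Q: "Q \<ge> 0" using grid_ge amp_pos t0 by (simp add: Q_def)
  have af: "alias_factor t \<ge> 0" by (simp add: alias_factor_def)
  have k2: "\<bar>kern'' s N t\<bar> \<le> Q * (1.905 * (alias_factor t / 0.9999))"
    using abs_kern''_le[OF t0 t(2)] by (simp add: Q_def mult_ac)
  have "\<bar>kern' s N t\<bar> * E \<le> amp s * real s * grid N / (grid N * t) ^ s * (alias_factor t / 0.9999) * E"
    by (intro mult_right_mono abs_kern'_le t0 t E)
  also have "\<dots> = Q * ((E / grid N) * (alias_factor t / 0.9999))"
    using grid_ge by (simp add: Q_def power2_eq_square)
  finally have k1: "\<bar>kern' s N t\<bar> * E \<le> Q * ((E / grid N) * (alias_factor t / 0.9999))" .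
  have num: "(1.905 + E / grid N) * (alias_factor t / 0.9999) \<le> 4.08"
  proof (cases "t \<le> pi / 2")
    case True
    have "1 / t \<le> grid N * (2 / pi)" using t(1) t0 grid_ge by (simp add: field_simps)
    also have "\<dots> \<le> grid N * (2 / 3)" using pi_gt3 grid_ge by (intro mult_left_mono divide_left_mono) auto
    finally have "E \<le> grid N" using E(2) grid_ge by linarith
    then have "E / grid N \<le> 1" using grid_ge by simp
    then show ?thesis using True by (simp add: alias_factor_def)
  next
    case False
    then have "E \<le> 1" using E(3) by simp
    then have "E / grid N \<le> 1 / 13" using grid_ge E(1) by (intro frac_le) auto
    then show ?thesis using False by (simp add: alias_factor_def)
  qed
  have "\<bar>kern'' s N t\<bar> + \<bar>kern' s N t\<bar> * E \<le> Q * ((1.905 + E / grid N) * (alias_factor t / 0.9999))"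
    using k1 k2 by (simp only: distrib_right distrib_left)
  also have "\<dots> \<le> Q * 4.08" using num Q by (intro mult_left_mono)
  also have "\<dots> \<le> (1.02 * amp s * (4 * real s + 1)) * grid N ^ 2 / (grid N * t) ^ s"
    unfolding Q_def times_divide_eq_left using grid_ge amp_pos t0
    by (intro divide_right_mono) (auto simp: algebra_simps)
  also have "(grid N * t) ^ s = grid N ^ 2 * (grid N ^ (s - 2) * t ^ s)"
  proof -
    have "2 + (s - 2) = s" using s by simp
    then have "grid N ^ s = grid N ^ 2 * grid N ^ (s - 2)" using power_add[of "grid N" 2 "s - 2"] by (simp only:)
    then show ?thesis by (simp only: power_mult_distrib mult.assoc)
  qed
  also have "(1.02 * amp s * (4 * real s + 1)) * grid N ^ 2 / (grid N ^ 2 * (grid N ^ (s - 2) * t ^ s)) = c2 s / (grid N ^ (s - 2) * t ^ s)"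
    using grid_ge by (simp add: c2_def amp_def)
  finally show ?thesis by (simp add: grid_def)
qed

end

section \<open>Invariant derivatives on the rotation group\<close>

text \<open>For a rotation the cofactor matrix is the matrix itself. Pairing the inner products of
  the columns with the cofactors of the first row leaves \<open>a\<close> times the determinant,
  because the other two rows are orthogonal to these cofactors.\<close>

lemma cofactor_eq_entry:
  fixes a b c d e f g h i :: real
  assumes "a * a + d * d + g * g = 1" "a * b + d * e + g * h = 0" "a * c + d * f + g * i = 0"
    and "a * (e * i - f * h) + b * (f * g - d * i) + c * (d * h - e * g) = 1"
  shows "e * i - f * h = a"
proof -
  have "e * i - f * h = (a * a + d * d + g * g) * (e * i - f * h) + (a * b + d * e + g * h) * (f * g - d * i)
      + (a * c + d * f + g * i) * (d * h - e * g)"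
    using assms(1-3) by simp
  also have "\<dots> = a * (a * (e * i - f * h) + b * (f * g - d * i) + c * (d * h - e * g))"
    by (simp add: algebra_simps)
  finally show ?thesis using assms(4) by simp
qed

text \<open>With a unit quaternion \<open>(w, v)\<close> for the rotation, one plus the trace is
  \<open>4 w^2\<close>, the differences are \<open>4 w v_i\<close>, and the other factors on the
  left are \<open>4 v_i v_j\<close>. The proof through cofactors avoids choosing a quaternion or an
  axis.\<close>

lemma rotation_entry_identities:
  fixes a b c d e f g h i :: real
  assumes col: "a * a + d * d + g * g = 1" "b * b + e * e + h * h = 1" "c * c + f * f + i * i = 1"
      "a * b + d * e + g * h = 0" "a * c + d * f + g * i = 0" "b * c + e * f + h * i = 0"
    and row: "a * a + b * b + c * c = 1" "d * d + e * e + f * f = 1" "g * g + h * h + i * i = 1"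
      "a * d + b * e + c * f = 0" "a * g + b * h + c * i = 0" "d * g + e * h + f * i = 0"
    and det: "a * (e * i - f * h) + b * (f * g - d * i) + c * (d * h - e * g) = 1"
  shows "(1 + (a + e + i)) * (1 + a - e - i) = (h - f) * (h - f)"
    and "(1 + (a + e + i)) * (1 + e - a - i) = (c - g) * (c - g)"
    and "(1 + (a + e + i)) * (1 + i - a - e) = (d - b) * (d - b)"
    and "(1 + (a + e + i)) * (b + d) = (h - f) * (c - g)"
    and "(1 + (a + e + i)) * (c + g) = (h - f) * (d - b)"
    and "(1 + (a + e + i)) * (f + h) = (c - g) * (d - b)"
proof -
  have cof: "e * i - f * h = a" "f * g - d * i = b" "d * h - e * g = c"
       "h * c - i * b = d" "i * a - g * c = e" "g * b - h * a = f"
       "b * f - c * e = g" "c * d - a * f = h" "a * e - b * d = i"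
    by (rule cofactor_eq_entry[of a d g b e h c f i] cofactor_eq_entry[of b e h c f i a d g]
          cofactor_eq_entry[of c f i a d g b e h] cofactor_eq_entry[of d g a e h b f i c]
          cofactor_eq_entry[of e h b f i c d g a] cofactor_eq_entry[of f i c d g a e h b]
          cofactor_eq_entry[of g a d h b e i c f] cofactor_eq_entry[of h b e i c f g a d]
          cofactor_eq_entry[of i c f g a d h b e];
        use col det in \<open>simp add: algebra_simps\<close>)+
  have "(1 + (a + e + i)) * (1 + a - e - i) = 1 + 2 * a + a * a - e * e - i * i - 2 * (e * i)"
    "(h - f) * (h - f) = h * h + f * f - 2 * (f * h)"
    by (simp_all add: algebra_simps)
  then show "(1 + (a + e + i)) * (1 + a - e - i) = (h - f) * (h - f)"
    using cof(1) row(2,3) col(1) by linarith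
  have "(1 + (a + e + i)) * (1 + e - a - i) = 1 + 2 * e + e * e - a * a - i * i - 2 * (i * a)"
    "(c - g) * (c - g) = c * c + g * g - 2 * (g * c)"
    by (simp_all add: algebra_simps)
  then show "(1 + (a + e + i)) * (1 + e - a - i) = (c - g) * (c - g)"
    using cof(5) row(1,3) col(2) by linarith
  have "(1 + (a + e + i)) * (1 + i - a - e) = 1 + 2 * i + i * i - a * a - e * e - 2 * (a * e)"
    "(d - b) * (d - b) = d * d + b * b - 2 * (b * d)"
    by (simp_all add: algebra_simps)
  then show "(1 + (a + e + i)) * (1 + i - a - e) = (d - b) * (d - b)"
    using cof(9) row(1,2) col(3) by linarith
  have "(1 + (a + e + i)) * (b + d) = b + d + a * b + a * d + b * e + d * e + i * b + d * i"
    "(h - f) * (c - g) = h * c - g * h - c * f + f * g"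
    by (simp_all add: algebra_simps)
  then show "(1 + (a + e + i)) * (b + d) = (h - f) * (c - g)"
    using cof(2,4) row(4) col(4) by linarith
  have "(1 + (a + e + i)) * (c + g) = c + g + a * c + a * g + c * e + e * g + c * i + g * i"
    "(h - f) * (d - b) = d * h - b * h - d * f + b * f"
    by (simp_all add: algebra_simps)
  then show "(1 + (a + e + i)) * (c + g) = (h - f) * (d - b)"
    using cof(3,7) row(5) col(5) by linarith
  have "(1 + (a + e + i)) * (f + h) = f + h + a * f + h * a + e * f + e * h + f * i + h * i"
    "(c - g) * (d - b) = c * d - b * c - d * g + g * b"
    by (simp_all add: algebra_simps)
  then show "(1 + (a + e + i)) * (f + h) = (c - g) * (d - b)"
    using cof(6,8) row(6) col(6) by linarith
qed

section \<open>The rotation group and the axial vector\<close>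

lemma SO3_D:
  assumes "z \<in> SO3"
  shows "transpose z ** z = mat 1" "z ** transpose z = mat 1" "det z = 1"
  using assms by (auto simp: SO3_def matrix_left_right_inverse)

lemma transpose_SO3: "z \<in> SO3 \<Longrightarrow> transpose z \<in> SO3"
  by (auto simp: SO3_def det_transpose matrix_left_right_inverse)

lemma mult_SO3: "x \<in> SO3 \<Longrightarrow> y \<in> SO3 \<Longrightarrow> x ** y \<in> SO3"
proof -
  assume x: "x \<in> SO3" and y: "y \<in> SO3"
  have "transpose (x ** y) ** (x ** y) = transpose y ** (transpose x ** x) ** y"
    by (simp add: matrix_transpose_mul matrix_mul_assoc)
  also have "\<dots> = mat 1" by (simp add: SO3_D[OF x] SO3_D[OF y])
  finally show ?thesis using SO3_D(3)[OF x] SO3_D(3)[OF y] by (simp add: SO3_def det_mul)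
qed

lemma rot_SO3: "rot n u \<in> SO3"
proof -
  have "cos u * cos u + sin u * sin u = 1" "sin u * sin u + cos u * cos u = 1"
    using sin_cos_squared_add3[of u] by (simp_all only: add.commute)
  then show ?thesis
    unfolding SO3_def rot_def
    by (simp add: det_3 matrix_matrix_mult_def transpose_def vec_eq_iff forall_3 sum_3 mat_def)
qed

lemma matrix_inv_SO3:
  assumes "y \<in> SO3"
  shows "matrix_inv y = transpose y"
proof -
  have "y ** matrix_inv y = mat 1 \<and> matrix_inv y ** y = mat 1"
    unfolding matrix_inv_def by (rule someI[of _ "transpose y"]) (use SO3_D[OF assms] in simp)
  then have "matrix_inv y ** (y ** transpose y) = transpose y" by (simp add: matrix_mul_assoc)
  then show ?thesis by (simp add: SO3_D(2)[OF assms])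
qed

definition half_trace :: "mat3 \<Rightarrow> real" where
  "half_trace z = (trace z - 1) / 2"

text \<open>\<open>axial n z\<close> is the \<open>n\<close>-th component of the rotation axis of \<open>z\<close> times the sine of its angle.\<close>
definition axial :: "nat \<Rightarrow> mat3 \<Rightarrow> real" where
  "axial n z = (if n = 1 then (z $ 3 $ 2 - z $ 2 $ 3) / 2 else if n = 2 then (z $ 1 $ 3 - z $ 3 $ 1) / 2
     else (z $ 2 $ 1 - z $ 1 $ 2) / 2)"

definition idx :: "nat \<Rightarrow> 3" where
  "idx n = (if n = 1 then 1 else if n = 2 then 2 else 3)"

text \<open>Rodrigues' formula, multiplied by one plus the cosine so that no division by the sine
  occurs and angle \<open>pi\<close> is included. The last claim holds because the antisymmetric
  part has the axial components, up to sign, as its entries.\<close>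

lemma SO3_identities:
  assumes z: "z \<in> SO3"
  shows "(axial 1 z)\<^sup>2 + (axial 2 z)\<^sup>2 + (axial 3 z)\<^sup>2 = 1 - (half_trace z)\<^sup>2"
    and "i \<in> {1, 2, 3} \<Longrightarrow> n \<in> {1, 2, 3} \<Longrightarrow>
      (1 + half_trace z) * ((z $ idx i $ idx n + z $ idx n $ idx i) / 2)
        = (if i = n then half_trace z * (1 + half_trace z) else 0) + axial i z * axial n z"
    and "\<bar>z $ idx i $ idx n\<bar> \<le> 1"
    and "i \<in> {1, 2, 3} \<Longrightarrow> n \<in> {1, 2, 3} \<Longrightarrow>
      \<exists>k\<in>{1, 2, 3}. \<bar>z $ idx i $ idx n - (z $ idx i $ idx n + z $ idx n $ idx i) / 2\<bar> \<le> \<bar>axial k z\<bar>"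
proof -
  define a b c d e f g h j where "a = z $ 1 $ 1" "b = z $ 1 $ 2" "c = z $ 1 $ 3"
    "d = z $ 2 $ 1" "e = z $ 2 $ 2" "f = z $ 2 $ 3" "g = z $ 3 $ 1" "h = z $ 3 $ 2" "j = z $ 3 $ 3"
  note defs = this
  have col: "a * a + d * d + g * g = 1" "b * b + e * e + h * h = 1" "c * c + f * f + j * j = 1"
      "a * b + d * e + g * h = 0" "a * c + d * f + g * j = 0" "b * c + e * f + h * j = 0"
    using SO3_D(1)[OF z] unfolding defs
    by (simp_all add: matrix_matrix_mult_def transpose_def vec_eq_iff forall_3 sum_3 mat_def)
  have row: "a * a + b * b + c * c = 1" "d * d + e * e + f * f = 1" "g * g + h * h + j * j = 1"
      "a * d + b * e + c * f = 0" "a * g + b * h + c * j = 0" "d * g + e * h + f * j = 0"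
    using SO3_D(2)[OF z] unfolding defs
    by (simp_all add: matrix_matrix_mult_def transpose_def vec_eq_iff forall_3 sum_3 mat_def)
  have det: "a * (e * j - f * h) + b * (f * g - d * j) + c * (d * h - e * g) = 1"
    using SO3_D(3)[OF z] unfolding defs by (simp add: det_3 algebra_simps)
  note ids = rotation_entry_identities[OF col row det]
  have tr: "half_trace z = (a + e + j - 1) / 2"
    by (simp add: half_trace_def trace_def sum_3 defs)
  have ax: "axial 1 z = (h - f) / 2" "axial 2 z = (c - g) / 2" "axial 3 z = (d - b) / 2"
    by (simp_all add: axial_def defs)
  show "(axial 1 z)\<^sup>2 + (axial 2 z)\<^sup>2 + (axial 3 z)\<^sup>2 = 1 - (half_trace z)\<^sup>2"
    \<comment> \<open>Adding the three diagonal identities gives \<open>(1 + T) * (3 - T)\<close>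
      for the trace \<open>T\<close>, which is four times the right side.\<close>
    unfolding tr ax using ids(1-3) by (simp add: power2_eq_square field_simps)
  show "(1 + half_trace z) * ((z $ idx i $ idx n + z $ idx n $ idx i) / 2)
        = (if i = n then half_trace z * (1 + half_trace z) else 0) + axial i z * axial n z"
    if "i \<in> {1, 2, 3}" "n \<in> {1, 2, 3}"
  proof -
    have diag: "(1 + (T - 1) / 2) * ((w + w) / 2) = (T - 1) / 2 * (1 + (T - 1) / 2) + v / 2 * (v / 2)"
      if "(1 + T) * (1 + (2 * w - T)) = v * v" for T w v :: real
      using that by (simp add: field_simps)
    have off: "(1 + (T - 1) / 2) * ((w + w') / 2) = 0 + v / 2 * (v' / 2)"
      if "(1 + T) * (w + w') = v * v'" for T w w' v v' :: real
      using that by (simp add: field_simps)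
    have E: "2 * a - (a + e + j) = a - e - j" "2 * e - (a + e + j) = e - a - j" "2 * j - (a + e + j) = j - a - e" by auto
    note D = diag[of "a + e + j" a "h - f", unfolded E add_diff_eq, OF ids(1)]
      diag[of "a + e + j" e "c - g", unfolded E add_diff_eq, OF ids(2)]
      diag[of "a + e + j" j "d - b", unfolded E add_diff_eq, OF ids(3)]
    note O = off[OF ids(4)] off[OF ids(5)] off[OF ids(6)]
    have O': "(1 + (a + e + j - 1) / 2) * ((d + b) / 2) = 0 + (c - g) / 2 * ((h - f) / 2)"
       "(1 + (a + e + j - 1) / 2) * ((g + c) / 2) = 0 + (d - b) / 2 * ((h - f) / 2)"
       "(1 + (a + e + j - 1) / 2) * ((h + f) / 2) = 0 + (d - b) / 2 * ((c - g) / 2)"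
      using O unfolding add.commute[of d b] add.commute[of g c] add.commute[of h f]
        mult.commute[of "(c - g) / 2" "(h - f) / 2"] mult.commute[of "(d - b) / 2" "(h - f) / 2"]
        mult.commute[of "(d - b) / 2" "(c - g) / 2"] by (simp_all only:)
    have idx: "idx 1 = 1" "idx 2 = 2" "idx 3 = 3" by (simp_all add: idx_def)
    have neq: "((1::nat) = 2) = False" "((1::nat) = 3) = False" "((2::nat) = 1) = False"
      "((2::nat) = 3) = False" "((3::nat) = 1) = False" "((3::nat) = 2) = False" by simp_all
    from that consider "i = 1" "n = 1" | "i = 1" "n = 2" | "i = 1" "n = 3" | "i = 2" "n = 1" | "i = 2" "n = 2"
      | "i = 2" "n = 3" | "i = 3" "n = 1" | "i = 3" "n = 2" | "i = 3" "n = 3" by auto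
    then show ?thesis
    proof cases
      case 1
      show ?thesis unfolding 1 idx tr ax defs[symmetric] using D(1) by (simp only: neq if_False if_True refl)
    next
      case 2
      show ?thesis unfolding 2 idx tr ax defs[symmetric] using O(1) by (simp only: neq if_False if_True refl)
    next
      case 3
      show ?thesis unfolding 3 idx tr ax defs[symmetric] using O(2) by (simp only: neq if_False if_True refl)
    next
      case 4
      show ?thesis unfolding 4 idx tr ax defs[symmetric] using O'(1) by (simp only: neq if_False if_True refl)
    next
      case 5
      show ?thesis unfolding 5 idx tr ax defs[symmetric] using D(2) by (simp only: neq if_False if_True refl)
    next
      case 6
      show ?thesis unfolding 6 idx tr ax defs[symmetric] using O(3) by (simp only: neq if_False if_True refl)
    next
      case 7
      show ?thesis unfolding 7 idx tr ax defs[symmetric] using O'(2) by (simp only: neq if_False if_True refl)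
    next
      case 8
      show ?thesis unfolding 8 idx tr ax defs[symmetric] using O'(3) by (simp only: neq if_False if_True refl)
    next
      case 9
      show ?thesis unfolding 9 idx tr ax defs[symmetric] using D(3) by (simp only: neq if_False if_True refl)
    qed
  qed
  have le1: "\<bar>x\<bar> \<le> 1" if "x * x + q = 1" "q \<ge> 0" for x q :: real
  proof -
    have "x\<^sup>2 \<le> 1" using that by (simp add: power2_eq_square)
    then show ?thesis by (simp add: abs_square_le_1)
  qed
  have "\<bar>a\<bar> \<le> 1" by (rule le1[of a "b * b + c * c"]) (use row(1) in linarith, simp)
  moreover have "\<bar>b\<bar> \<le> 1" by (rule le1[of b "a * a + c * c"]) (use row(1) in linarith, simp)
  moreover have "\<bar>c\<bar> \<le> 1" by (rule le1[of c "a * a + b * b"]) (use row(1) in linarith, simp)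
  moreover have "\<bar>d\<bar> \<le> 1" by (rule le1[of d "e * e + f * f"]) (use row(2) in linarith, simp)
  moreover have "\<bar>e\<bar> \<le> 1" by (rule le1[of e "d * d + f * f"]) (use row(2) in linarith, simp)
  moreover have "\<bar>f\<bar> \<le> 1" by (rule le1[of f "d * d + e * e"]) (use row(2) in linarith, simp)
  moreover have "\<bar>g\<bar> \<le> 1" by (rule le1[of g "h * h + j * j"]) (use row(3) in linarith, simp)
  moreover have "\<bar>h\<bar> \<le> 1" by (rule le1[of h "g * g + j * j"]) (use row(3) in linarith, simp)
  moreover have "\<bar>j\<bar> \<le> 1" by (rule le1[of j "g * g + h * h"]) (use row(3) in linarith, simp)
  ultimately have "\<forall>p q. \<bar>z $ p $ q\<bar> \<le> 1"
    unfolding forall_3 defs[symmetric] by (intro conjI)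
  then show "\<bar>z $ idx i $ idx n\<bar> \<le> 1" by blast
  show "\<exists>k\<in>{1, 2, 3}. \<bar>z $ idx i $ idx n - (z $ idx i $ idx n + z $ idx n $ idx i) / 2\<bar> \<le> \<bar>axial k z\<bar>"
    if "i \<in> {1, 2, 3}" "n \<in> {1, 2, 3}"
  proof -
    have eq: "x - (x + x') / 2 = (x - x') / 2" for x x' :: real by (simp add: field_simps)
    from that show ?thesis unfolding eq
      by (elim insertE emptyE) (auto simp: idx_def axial_def abs_minus_commute)
  qed
qed

text \<open>Entries of a product with \<open>rot i t\<close> are affine in \<open>cos t\<close> and
  \<open>sin t\<close>, so the derivative at 0 can be read off as the coefficient of the
  sine.\<close>

lemma trig_deriv_at_0:
  fixes p q r :: real
  assumes "\<And>t. f t = p + q * cos t + r * sin t"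
  shows "(f has_real_derivative r) (at 0)"
proof -
  have "((\<lambda>t. p + q * cos t + r * sin t) has_real_derivative r) (at 0)"
    by (auto intro!: derivative_eq_intros)
  moreover have "f = (\<lambda>t. p + q * cos t + r * sin t)" by (rule ext) (rule assms)
  ultimately show ?thesis by (simp only:)
qed

text \<open>The second variable enters through its transpose, so the rotation acts inversely; hence
  the sign opposite to \<open>half_trace_rot_deriv\<close>.\<close>

lemma half_trace_transpose_rot_deriv:
  assumes "n \<in> {1, 2, 3}"
  shows "((\<lambda>u. half_trace (transpose (rot n u) ** z)) has_real_derivative axial n z) (at 0)"
proof -
  have "((\<lambda>u. half_trace (transpose (rot 1 u) ** z)) has_real_derivative axial 1 z) (at 0)"
    by (rule trig_deriv_at_0[of _ "(z $ 1 $ 1 - 1) / 2" "(z $ 2 $ 2 + z $ 3 $ 3) / 2"]) (simp add: half_trace_def trace_def sum_3 rot_def axial_def matrix_matrix_mult_def transpose_def field_simps)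
  moreover
  have "((\<lambda>u. half_trace (transpose (rot 2 u) ** z)) has_real_derivative axial 2 z) (at 0)"
    by (rule trig_deriv_at_0[of _ "(z $ 2 $ 2 - 1) / 2" "(z $ 1 $ 1 + z $ 3 $ 3) / 2"]) (simp add: half_trace_def trace_def sum_3 rot_def axial_def matrix_matrix_mult_def transpose_def field_simps)
  moreover
  have "((\<lambda>u. half_trace (transpose (rot 3 u) ** z)) has_real_derivative axial 3 z) (at 0)"
    by (rule trig_deriv_at_0[of _ "(z $ 3 $ 3 - 1) / 2" "(z $ 1 $ 1 + z $ 2 $ 2) / 2"]) (simp add: half_trace_def trace_def sum_3 rot_def axial_def matrix_matrix_mult_def transpose_def field_simps)
  ultimately show ?thesis using assms by blast
qed

lemma half_trace_rot_deriv:
  assumes "i \<in> {1, 2, 3}"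
  shows "((\<lambda>t. half_trace (z ** rot i t)) has_real_derivative - axial i z) (at 0)"
proof -
  have "((\<lambda>t. half_trace (z ** rot 1 t)) has_real_derivative - axial 1 z) (at 0)"
    by (rule trig_deriv_at_0[of _ "(z $ 1 $ 1 - 1) / 2" "(z $ 2 $ 2 + z $ 3 $ 3) / 2"]) (simp add: half_trace_def trace_def sum_3 rot_def axial_def matrix_matrix_mult_def field_simps)
  moreover
  have "((\<lambda>t. half_trace (z ** rot 2 t)) has_real_derivative - axial 2 z) (at 0)"
    by (rule trig_deriv_at_0[of _ "(z $ 2 $ 2 - 1) / 2" "(z $ 1 $ 1 + z $ 3 $ 3) / 2"]) (simp add: half_trace_def trace_def sum_3 rot_def axial_def matrix_matrix_mult_def field_simps)
  moreover
  have "((\<lambda>t. half_trace (z ** rot 3 t)) has_real_derivative - axial 3 z) (at 0)"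
    by (rule trig_deriv_at_0[of _ "(z $ 3 $ 3 - 1) / 2" "(z $ 1 $ 1 + z $ 2 $ 2) / 2"]) (simp add: half_trace_def trace_def sum_3 rot_def axial_def matrix_matrix_mult_def field_simps)
  ultimately show ?thesis using assms by blast
qed

text \<open>As \<open>1 + 2 * half_trace z\<close> is the trace, these derivatives are the entries
  of half of trace times identity minus \<open>z\<close>.\<close>

lemma axial_rot_deriv:
  assumes "i \<in> {1, 2, 3}" "n \<in> {1, 2, 3}"
  shows "((\<lambda>t. axial n (z ** rot i t)) has_real_derivative
     ((if i = n then 1 + 2 * half_trace z else 0) - z $ idx i $ idx n) / 2) (at 0)"
proof -
  let ?d = "\<lambda>i n. ((if i = n then 1 + 2 * half_trace z else 0) - z $ idx i $ idx n) / 2"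
  have "((\<lambda>t. axial 1 (z ** rot 1 t)) has_real_derivative ?d 1 1) (at 0)"
    by (rule trig_deriv_at_0[of _ "0" "(z $ 3 $ 2 - z $ 2 $ 3) / 2"]) (simp add: half_trace_def trace_def sum_3 rot_def axial_def matrix_matrix_mult_def field_simps idx_def)
  moreover
  have "((\<lambda>t. axial 2 (z ** rot 1 t)) has_real_derivative ?d 1 2) (at 0)"
    by (rule trig_deriv_at_0[of _ "- z $ 3 $ 1 / 2" "z $ 1 $ 3 / 2"]) (simp add: half_trace_def trace_def sum_3 rot_def axial_def matrix_matrix_mult_def field_simps idx_def)
  moreover
  have "((\<lambda>t. axial 3 (z ** rot 1 t)) has_real_derivative ?d 1 3) (at 0)"
    by (rule trig_deriv_at_0[of _ "z $ 2 $ 1 / 2" "- z $ 1 $ 2 / 2"]) (simp add: half_trace_def trace_def sum_3 rot_def axial_def matrix_matrix_mult_def field_simps idx_def)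
  moreover
  have "((\<lambda>t. axial 1 (z ** rot 2 t)) has_real_derivative ?d 2 1) (at 0)"
    by (rule trig_deriv_at_0[of _ "z $ 3 $ 2 / 2" "- z $ 2 $ 3 / 2"]) (simp add: half_trace_def trace_def sum_3 rot_def axial_def matrix_matrix_mult_def field_simps idx_def)
  moreover
  have "((\<lambda>t. axial 2 (z ** rot 2 t)) has_real_derivative ?d 2 2) (at 0)"
    by (rule trig_deriv_at_0[of _ "0" "(z $ 1 $ 3 - z $ 3 $ 1) / 2"]) (simp add: half_trace_def trace_def sum_3 rot_def axial_def matrix_matrix_mult_def field_simps idx_def)
  moreover
  have "((\<lambda>t. axial 3 (z ** rot 2 t)) has_real_derivative ?d 2 3) (at 0)"
    by (rule trig_deriv_at_0[of _ "- z $ 1 $ 2 / 2" "z $ 2 $ 1 / 2"]) (simp add: half_trace_def trace_def sum_3 rot_def axial_def matrix_matrix_mult_def field_simps idx_def)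
  moreover
  have "((\<lambda>t. axial 1 (z ** rot 3 t)) has_real_derivative ?d 3 1) (at 0)"
    by (rule trig_deriv_at_0[of _ "- z $ 2 $ 3 / 2" "z $ 3 $ 2 / 2"]) (simp add: half_trace_def trace_def sum_3 rot_def axial_def matrix_matrix_mult_def field_simps idx_def)
  moreover
  have "((\<lambda>t. axial 2 (z ** rot 3 t)) has_real_derivative ?d 3 2) (at 0)"
    by (rule trig_deriv_at_0[of _ "z $ 1 $ 3 / 2" "- z $ 3 $ 1 / 2"]) (simp add: half_trace_def trace_def sum_3 rot_def axial_def matrix_matrix_mult_def field_simps idx_def)
  moreover
  have "((\<lambda>t. axial 3 (z ** rot 3 t)) has_real_derivative ?d 3 3) (at 0)"
    by (rule trig_deriv_at_0[of _ "0" "(z $ 2 $ 1 - z $ 1 $ 2) / 2"]) (simp add: half_trace_def trace_def sum_3 rot_def axial_def matrix_matrix_mult_def field_simps idx_def)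
  ultimately show ?thesis using assms by blast
qed

section \<open>The kernel as a polynomial in the cosine of the angle\<close>

lemma cos_multiple_poly: "\<exists>p :: real poly. \<forall>t. cos (real n * t) = poly p (cos t)"
proof (induction n rule: less_induct)
  case (less n)
  have "n = 0 \<or> n = 1 \<or> n = Suc (Suc (n - 2))" by arith
  then consider "n = 0" | "n = 1" | m where "n = Suc (Suc m)" by blast
  then show ?case
  proof cases
    case 1 then show ?thesis by (intro exI[of _ 1]) simp
  next
    case 2 then show ?thesis by (intro exI[of _ "[:0, 1:]"]) simp
  next
    case (3 m)
    obtain p where p: "\<And>t. cos (real m * t) = poly p (cos t)" using less[of m] 3 by auto
    obtain q where q: "\<And>t. cos (real (Suc m) * t) = poly q (cos t)" using less[of "Suc m"] 3 by auto
    have "cos (real n * t) = poly ([:0, 2:] * q - p) (cos t)" for t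
    proof -
      have "real n * t = real (Suc m) * t + t" "real m * t = real (Suc m) * t - t"
        using 3 by (simp_all add: algebra_simps)
      then have "cos (real n * t) + cos (real m * t) = 2 * cos t * cos (real (Suc m) * t)"
        by (simp only: cos_add cos_diff) (simp add: algebra_simps)
      then show ?thesis unfolding p q by simp
    qed
    then show ?thesis by blast
  qed
qed

lemma kern_poly: "\<exists>p :: real poly. \<forall>t. kern s N t = poly p (cos t)"
proof -
  have "\<forall>n. \<exists>p :: real poly. \<forall>t. cos (real n * t) = poly p (cos t)"
    using cos_multiple_poly by blast
  from choice[OF this] obtain P :: "nat \<Rightarrow> real poly"
    where P: "\<And>n t. cos (real n * t) = poly (P n) (cos t)" by blast
  have Pk: "cos (real_of_int k * t) = poly (P (nat \<bar>k\<bar>)) (cos t)" for k t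
  proof -
    have "cos (real_of_int k * t) = cos (real (nat \<bar>k\<bar>) * t)" by (cases "k \<ge> 0") auto
    then show ?thesis unfolding P .
  qed
  show ?thesis
    by (rule exI[of _ "smult (1 / pbnorm (s - 1) N)
        (\<Sum>k\<in>{-int N..int N}. smult (spline s (s - 1) (real_of_int k / grid N)) (P (nat \<bar>k\<bar>)))"])
       (simp add: kern_def poly_sum Pk)
qed

lemma abs_half_trace_le:
  assumes "z \<in> SO3"
  shows "\<bar>half_trace z\<bar> \<le> 1"
proof -
  have "(half_trace z)\<^sup>2 \<le> 1"
    using SO3_identities(1)[OF assms] zero_le_power2[of "axial 1 z"] zero_le_power2[of "axial 2 z"]
      zero_le_power2[of "axial 3 z"] by linarith
  then show ?thesis by (simp add: abs_square_le_1)
qed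

lemma cos_rot_angle:
  assumes "z \<in> SO3"
  shows "cos (rot_angle z) = half_trace z"
  using abs_half_trace_le[OF assms] unfolding rot_angle_def half_trace_def[symmetric]
  by (intro cos_arccos) auto

lemma axial_le_sin:
  assumes z: "z \<in> SO3" and n: "n \<in> {1, 2, 3}"
  shows "\<bar>axial n z\<bar> \<le> sin (rot_angle z)"
proof -
  have "0 \<le> rot_angle z" "rot_angle z \<le> pi"
    unfolding rot_angle_def half_trace_def[symmetric] using abs_half_trace_le[OF z]
    by (auto intro: arccos_lbound arccos_ubound)
  then have s0: "sin (rot_angle z) \<ge> 0" by (rule sin_ge_zero)
  have "(axial n z)\<^sup>2 \<le> (axial 1 z)\<^sup>2 + (axial 2 z)\<^sup>2 + (axial 3 z)\<^sup>2"
    using n by auto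
  also have "\<dots> = (sin (rot_angle z))\<^sup>2"
    using SO3_identities(1)[OF z] cos_rot_angle[OF z] by (simp add: sin_squared_eq)
  finally show ?thesis using s0 abs_le_square_iff[of "axial n z" "sin (rot_angle z)"] by simp
qed

lemma rot_0: "rot n 0 = mat 1"
  by (simp add: rot_def vec_eq_iff forall_3 mat_def)

context
  fixes s N :: nat and p :: "real poly"
  assumes s: "even s" "s \<ge> 6" and N: "N \<ge> 2 * s"
    and p: "\<And>t. kern s N t = poly p (cos t)"
begin

lemma sigma_poly:
  assumes "x \<in> SO3" "y \<in> SO3"
  shows "sigma s N x y = of_real (poly p (half_trace (transpose y ** x)))"
  unfolding sigma_def sigma_t_eq[OF s N] p matrix_inv_SO3[OF assms(2)]
  using cos_rot_angle[OF mult_SO3[OF transpose_SO3[OF assms(2)] assms(1)]] by simp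

lemma kern'_poly: "kern' s N t = - (poly (pderiv p) (cos t) * sin t)"
proof -
  have "((\<lambda>t. poly p (cos t)) has_real_derivative poly (pderiv p) (cos t) * - sin t) (at t)"
    by (rule DERIV_chain2[OF poly_DERIV DERIV_cos])
  moreover have "(\<lambda>t. poly p (cos t)) = kern s N" by (simp add: fun_eq_iff p)
  ultimately show ?thesis using DERIV_unique[OF kern_deriv] by simp
qed

lemma kern''_poly: "kern'' s N t = poly (pderiv (pderiv p)) (cos t) * (sin t)\<^sup>2 - poly (pderiv p) (cos t) * cos t"
proof -
  have d: "((\<lambda>t. poly (pderiv p) (cos t)) has_real_derivative poly (pderiv (pderiv p)) (cos t) * - sin t) (at t)"
    by (rule DERIV_chain2[OF poly_DERIV DERIV_cos])
  have "((\<lambda>t. - (poly (pderiv p) (cos t) * sin t)) has_real_derivative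
     - (poly (pderiv (pderiv p)) (cos t) * - sin t * sin t + cos t * poly (pderiv p) (cos t))) (at t)"
    by (intro DERIV_minus DERIV_mult d DERIV_sin)
  moreover have "(\<lambda>t. - (poly (pderiv p) (cos t) * sin t)) = kern' s N" by (simp add: fun_eq_iff kern'_poly)
  ultimately show ?thesis
    using DERIV_unique[OF kern'_deriv] by (simp add: power2_eq_square algebra_simps)
qed

lemma Xy_sigma:
  assumes x: "x \<in> SO3" and y: "y \<in> SO3" and n: "n \<in> {1, 2, 3}"
  shows "Xy n (sigma s N) x y = of_real (poly (pderiv p) (half_trace (transpose y ** x)) * axial n (transpose y ** x))"
proof -
  let ?z = "transpose y ** x"
  have eq: "sigma s N x (y ** rot n u) = of_real (poly p (half_trace (transpose (rot n u) ** ?z)))" for u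
    using sigma_poly[OF x mult_SO3[OF y rot_SO3[of n u]]] by (simp add: matrix_transpose_mul matrix_mul_assoc)
  have "((\<lambda>u. poly p (half_trace (transpose (rot n u) ** ?z))) has_real_derivative
      poly (pderiv p) (half_trace (transpose (rot n 0) ** ?z)) * axial n ?z) (at 0)"
    by (rule DERIV_chain2[OF poly_DERIV half_trace_transpose_rot_deriv[OF n]])
  then have "((\<lambda>u. poly p (half_trace (transpose (rot n u) ** ?z))) has_real_derivative
      poly (pderiv p) (half_trace ?z) * axial n ?z) (at 0)"
    by (simp add: rot_0 transpose_mat)
  from has_vector_derivative_of_real[OF this]
  show ?thesis unfolding Xy_def eq by (rule vector_derivative_at)
qed

lemma Xx_Xy_sigma:
  assumes x: "x \<in> SO3" and y: "y \<in> SO3" and i: "i \<in> {1, 2, 3}" and n: "n \<in> {1, 2, 3}"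
  defines "z \<equiv> transpose y ** x"
  shows "Xx i (Xy n (sigma s N)) x y = of_real (- poly (pderiv (pderiv p)) (half_trace z) * axial i z * axial n z
     + poly (pderiv p) (half_trace z) * (((if i = n then 1 + 2 * half_trace z else 0) - z $ idx i $ idx n) / 2))"
proof -
  \<comment> \<open>The curve stays in the group, so the formula for the inner derivative holds
    along all of it and can be differentiated explicitly.\<close>
  have eq: "Xy n (sigma s N) (x ** rot i t) y
      = of_real (poly (pderiv p) (half_trace (z ** rot i t)) * axial n (z ** rot i t))" for t
    using Xy_sigma[OF mult_SO3[OF x rot_SO3[of i t]] y n] by (simp add: z_def matrix_mul_assoc)
  let ?d = "((if i = n then 1 + 2 * half_trace z else 0) - z $ idx i $ idx n) / 2"
  have "((\<lambda>t. poly (pderiv p) (half_trace (z ** rot i t)) * axial n (z ** rot i t)) has_real_derivative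
     poly (pderiv (pderiv p)) (half_trace (z ** rot i 0)) * - axial i z * axial n (z ** rot i 0)
     + ?d * poly (pderiv p) (half_trace (z ** rot i 0))) (at 0)"
    by (intro DERIV_mult DERIV_chain2[OF poly_DERIV half_trace_rot_deriv[OF i]] axial_rot_deriv[OF i n])
  then have "((\<lambda>t. poly (pderiv p) (half_trace (z ** rot i t)) * axial n (z ** rot i t)) has_real_derivative
     - poly (pderiv (pderiv p)) (half_trace z) * axial i z * axial n z + poly (pderiv p) (half_trace z) * ?d) (at 0)"
    unfolding rot_0 matrix_mul_rid
    by (simp only: mult_minus_left mult_minus_right mult.commute[of ?d])
  from has_vector_derivative_of_real[OF this]
  show ?thesis unfolding Xx_def eq by (rule vector_derivative_at)
qed

end

text \<open>\<open>c\<close> and \<open>S\<close> are the cosine and sine of the angle, \<open>p1\<close> and \<open>p2\<close> the first two derivatives of the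
  kernel with respect to \<open>c\<close>, and \<open>k1\<close> and \<open>k2\<close> those with respect to the angle.\<close>
lemma second_derivative_bound:
  fixes S c :: real
  assumes S: "S > 0" and c: "c\<^sup>2 + S\<^sup>2 = 1"
    and k1: "k1 = - (p1 * S)" and k2: "k2 = p2 * S\<^sup>2 - p1 * c"
    and v: "\<bar>vi\<bar> \<le> S" "\<bar>vn\<bar> \<le> S" and \<delta>: "\<delta> = 0 \<or> \<delta> = 1 \<and> vi = vn"
    and sym: "(1 + c) * m = \<delta> * (c * (1 + c)) + vi * vn" and w: "\<bar>w - m\<bar> \<le> S"
  shows "\<bar>- p2 * vi * vn + p1 * ((\<delta> * (1 + 2 * c) - w) / 2)\<bar>
     \<le> \<bar>k2\<bar> + \<bar>k1\<bar> * ((1 + c) / S / 2 + 1 / 2)"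
proof -
  \<comment> \<open>The product of two components of the unit rotation axis; on the diagonal it is a
    square, which keeps \<open>\<delta> - r\<close> in the unit interval.\<close>
  define r where "r = (vi / S) * (vn / S)"
  have vv: "vi * vn = r * S\<^sup>2" using S by (simp add: r_def power2_eq_square)
  have r1: "\<bar>r\<bar> \<le> 1"
  proof -
    have "\<bar>vi / S\<bar> \<le> 1" "\<bar>vn / S\<bar> \<le> 1" using v S by auto
    then have "\<bar>vi / S\<bar> * \<bar>vn / S\<bar> \<le> 1 * 1" by (intro mult_mono) auto
    then show ?thesis by (simp add: r_def abs_mult)
  qed
  have \<delta>r: "\<bar>\<delta> - r\<bar> \<le> 1"
  proof (cases "\<delta> = 0")
    case False
    then have "\<delta> = 1" "vi = vn" using \<delta> by auto
    then have "r \<ge> 0" by (simp add: r_def)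
    then show ?thesis using r1 \<open>\<delta> = 1\<close> by auto
  qed (use r1 in auto)
  have S2: "S\<^sup>2 = (1 - c) * (1 + c)" using c by (simp add: power2_eq_square algebra_simps)
  have "S\<^sup>2 > 0" using S by simp
  then have c1: "1 + c \<noteq> 0" unfolding S2 by auto
  have "c\<^sup>2 \<le> 1" using c zero_le_power2[of S] by linarith
  then have "\<bar>c\<bar> \<le> 1" by (simp add: abs_square_le_1)
  then have cpos: "1 + c \<ge> 0" by simp
  have "(1 + c) * m = (1 + c) * (\<delta> * c + (1 - c) * r)"
    unfolding sym vv S2 by (simp add: algebra_simps)
  \<comment> \<open>Rodrigues' formula for the symmetric part; \<open>q\<close> below is the
    antisymmetric remainder.\<close>
  then have m: "m = \<delta> * c + (1 - c) * r" using c1 by simp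
  define q where "q = w - m"
  have q: "\<bar>q\<bar> \<le> S" using w by (simp add: q_def)
  have p2: "p2 * S\<^sup>2 = k2 + p1 * c" using k2 by simp
  have "- p2 * vi * vn = - r * (p2 * S\<^sup>2)" using vv by (simp add: mult.assoc)
  also have "\<dots> = - r * k2 - p1 * (r * c)" unfolding p2 by (simp add: algebra_simps)
  finally have e1: "- p2 * vi * vn = - r * k2 - p1 * (r * c)" .
  \<comment> \<open>Trading \<open>p2\<close> for \<open>k2\<close> costs
    \<open>p1 * (r * c)\<close>. What then remains of the symmetric part carries the factor
    \<open>1 + c\<close>; divided by \<open>S\<close> this is the cotangent of half the angle, which
    stays bounded near \<open>pi\<close>.\<close>
  have e2: "(\<delta> * (1 + 2 * c) - w) / 2 - r * c = (1 + c) / 2 * (\<delta> - r) - q / 2"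
    unfolding q_def m by (simp add: field_simps)
  have "- p2 * vi * vn + p1 * ((\<delta> * (1 + 2 * c) - w) / 2) = - r * k2 + p1 * ((\<delta> * (1 + 2 * c) - w) / 2 - r * c)"
    unfolding e1 by (simp add: algebra_simps)
  also have "\<bar>\<dots>\<bar> \<le> \<bar>r * k2\<bar> + \<bar>p1 * ((\<delta> * (1 + 2 * c) - w) / 2 - r * c)\<bar>"
    by (rule order_trans[OF abs_triangle_ineq]) simp
  also have "\<bar>r * k2\<bar> \<le> \<bar>k2\<bar>" using r1 by (simp add: abs_mult mult_left_le_one_le)
  also have "\<bar>p1 * ((\<delta> * (1 + 2 * c) - w) / 2 - r * c)\<bar> \<le> \<bar>p1\<bar> * ((1 + c) / 2 + S / 2)"
  proof -
    have "\<bar>(1 + c) / 2 * (\<delta> - r) - q / 2\<bar> \<le> \<bar>(1 + c) / 2 * (\<delta> - r)\<bar> + \<bar>q / 2\<bar>"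
      by (rule abs_triangle_ineq4)
    also have "\<bar>(1 + c) / 2 * (\<delta> - r)\<bar> \<le> (1 + c) / 2"
      using \<delta>r cpos by (simp add: abs_mult mult_left_le)
    also have "\<bar>q / 2\<bar> \<le> S / 2" using q by simp
    finally show ?thesis unfolding e2 abs_mult by (intro mult_left_mono) auto
  qed
  also have "\<bar>p1\<bar> * ((1 + c) / 2 + S / 2) = \<bar>k1\<bar> * ((1 + c) / S / 2 + 1 / 2)"
    unfolding k1 using S by (simp add: abs_mult field_simps)
  finally show ?thesis by simp
qed

theorem theorem3p1:
  fixes s N :: nat and x y :: mat3
  assumes "even s" and "s \<ge> 6" and "N \<ge> 2 * s"
    and "x \<in> SO3" and "y \<in> SO3"
    and "rot_angle (matrix_inv y ** x) \<ge> pi / (2 * (real N + 1))"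
  shows "\<forall>i\<in>{1,2,3}. \<forall>n\<in>{1,2,3}.
      cmod (Xy n (sigma s N) x y)
        \<le> c1 s / ((real N + 1) ^ (s - 1) * rot_angle (matrix_inv y ** x) ^ s)
    \<and> cmod (Xx i (Xy n (sigma s N)) x y)
        \<le> c2 s / ((real N + 1) ^ (s - 2) * rot_angle (matrix_inv y ** x) ^ s)"
proof (intro ballI conjI)
  fix i n :: nat assume i: "i \<in> {1, 2, 3}" and n: "n \<in> {1, 2, 3}"
  note sN = assms(1-3)
  obtain p where p: "\<And>t. kern s N t = poly p (cos t)" using kern_poly[of s N] by blast
  define z where "z = transpose y ** x"
  define \<omega> where "\<omega> = rot_angle z"
  define c where "c = half_trace z"
  define S where "S = sin \<omega>"
  have inv: "matrix_inv y ** x = z" by (simp add: z_def matrix_inv_SO3[OF assms(5)])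
  have z: "z \<in> SO3" unfolding z_def by (intro mult_SO3 transpose_SO3 assms)
  have ang: "cos \<omega> = c" unfolding \<omega>_def c_def by (rule cos_rot_angle[OF z])
  have \<omega>lo: "pi / (2 * grid N) \<le> \<omega>" using assms(6) unfolding inv by (simp add: \<omega>_def grid_def)
  have "0 < pi / (2 * grid N)" using grid_ge[OF sN] by simp
  then have \<omega>0: "0 < \<omega>" using \<omega>lo by linarith
  have \<omega>\<pi>: "\<omega> \<le> pi"
    unfolding \<omega>_def rot_angle_def half_trace_def[symmetric] using abs_half_trace_le[OF z]
    by (auto intro: arccos_ubound)
  have S0: "S \<ge> 0" unfolding S_def using \<omega>0 \<omega>\<pi> by (intro sin_ge_zero) auto
  have ax: "\<bar>axial k z\<bar> \<le> S" if "k \<in> {1, 2, 3}" for k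
    unfolding S_def \<omega>_def by (rule axial_le_sin[OF z that])
  have k1: "kern' s N \<omega> = - (poly (pderiv p) c * S)"
    using kern'_poly[OF sN p, of \<omega>] by (simp add: ang S_def)
  have k2: "kern'' s N \<omega> = poly (pderiv (pderiv p)) c * S\<^sup>2 - poly (pderiv p) c * c"
    using kern''_poly[OF sN p, of \<omega>] by (simp add: ang S_def)
  have "cmod (Xy n (sigma s N) x y) = \<bar>poly (pderiv p) c\<bar> * \<bar>axial n z\<bar>"
    unfolding Xy_sigma[OF sN p assms(4,5) n] z_def[symmetric] c_def norm_of_real abs_mult ..
  also have "\<dots> \<le> \<bar>poly (pderiv p) c\<bar> * S" by (intro mult_left_mono ax n) auto
  also have "\<dots> = \<bar>kern' s N \<omega>\<bar>" unfolding k1 using S0 by (simp add: abs_mult)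
  also have "\<dots> \<le> c1 s / ((real N + 1) ^ (s - 1) * \<omega> ^ s)" by (rule kern'_bound[OF sN \<omega>0 \<omega>\<pi>])
  finally show "cmod (Xy n (sigma s N) x y)
      \<le> c1 s / ((real N + 1) ^ (s - 1) * rot_angle (matrix_inv y ** x) ^ s)"
    unfolding inv \<omega>_def .
  let ?\<delta> = "if i = n then 1 else 0 :: real"
  let ?w = "z $ idx i $ idx n"
  have norm_eq: "cmod (Xx i (Xy n (sigma s N)) x y)
     = \<bar>- poly (pderiv (pderiv p)) c * axial i z * axial n z + poly (pderiv p) c * ((?\<delta> * (1 + 2 * c) - ?w) / 2)\<bar>"
    unfolding Xx_Xy_sigma[OF sN p assms(4,5) i n] z_def[symmetric] c_def norm_of_real by simp
  have "cmod (Xx i (Xy n (sigma s N)) x y) \<le> c2 s / ((real N + 1) ^ (s - 2) * \<omega> ^ s)"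
  proof (cases "S = 0")
    \<comment> \<open>At angle \<open>pi\<close> the axial vector vanishes and \<open>\<tau>'' pi\<close> equals \<open>p'(-1)\<close>.\<close>
    case True
    have "\<omega> = pi"
    proof (rule ccontr)
      assume "\<omega> \<noteq> pi"
      then have "S > 0" unfolding S_def using \<omega>0 \<omega>\<pi> by (intro sin_gt_zero) auto
      with True show False by simp
    qed
    then have c: "c = -1" using ang by simp
    have "axial i z = 0" using ax[OF i] True by simp
    then have "cmod (Xx i (Xy n (sigma s N)) x y) = \<bar>poly (pderiv p) c\<bar> * \<bar>(?\<delta> * (1 + 2 * c) - ?w) / 2\<bar>"
      unfolding norm_eq by (simp add: abs_mult)
    also have "\<dots> \<le> \<bar>poly (pderiv p) c\<bar> * 1"
      \<comment> \<open>For \<open>c = -1\<close> the numerator is minus the sum of the Kronecker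
        delta and a matrix entry, each at most 1 in modulus.\<close>
      using SO3_identities(3)[OF z, of i n] by (intro mult_left_mono) (auto simp: c abs_le_iff)
    also have "\<dots> = \<bar>kern'' s N \<omega>\<bar> + \<bar>kern' s N \<omega>\<bar> * 0"
      unfolding k2 True c by simp
    also have "\<dots> \<le> c2 s / ((real N + 1) ^ (s - 2) * \<omega> ^ s)"
      using \<omega>0 by (intro kern''_bound[OF sN \<omega>lo \<omega>\<pi>]) auto
    finally show ?thesis .
  next
    case False
    then have Sp: "S > 0" using S0 by simp
    have cS: "c\<^sup>2 + S\<^sup>2 = 1" unfolding ang[symmetric] S_def by simp
    have "\<bar>c\<bar> \<le> 1" unfolding c_def by (rule abs_half_trace_le[OF z])
    then have cpos: "1 + c \<ge> 0" by simp
    let ?m = "(?w + z $ idx n $ idx i) / 2"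
    have sym: "(1 + c) * ?m = ?\<delta> * (c * (1 + c)) + axial i z * axial n z"
      using SO3_identities(2)[OF z i n] by (simp add: c_def)
    have w: "\<bar>?w - ?m\<bar> \<le> S"
    proof -
      obtain k where "k \<in> {1, 2, 3}" "\<bar>?w - ?m\<bar> \<le> \<bar>axial k z\<bar>"
        using SO3_identities(4)[OF z i n] by blast
      then show ?thesis using ax[of k] by linarith
    qed
    have "cmod (Xx i (Xy n (sigma s N)) x y) \<le> \<bar>kern'' s N \<omega>\<bar> + \<bar>kern' s N \<omega>\<bar> * ((1 + c) / S / 2 + 1 / 2)"
      unfolding norm_eq
      by (rule second_derivative_bound[OF Sp cS k1 k2 ax[OF i] ax[OF n] _ sym w]) auto
    also have "\<dots> \<le> c2 s / ((real N + 1) ^ (s - 2) * \<omega> ^ s)"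
    proof (rule kern''_bound[OF sN \<omega>lo \<omega>\<pi>])
      show "0 \<le> (1 + c) / S / 2 + 1 / 2" using cpos Sp by simp
      have h: "c = 2 * (cos (\<omega> / 2))\<^sup>2 - 1" "S = 2 * sin (\<omega> / 2) * cos (\<omega> / 2)"
        using cos_double_cos[of "\<omega> / 2"] sin_double[of "\<omega> / 2"] by (simp_all add: ang S_def)
      have "\<omega> \<noteq> pi" using Sp by (auto simp: S_def)
      then have w2: "0 < \<omega> / 2" "\<omega> / 2 < pi / 2" using \<omega>0 \<omega>\<pi> by auto
      then have ch: "cos (\<omega> / 2) > 0" and sh: "sin (\<omega> / 2) > 0"
        by (auto intro!: cos_gt_zero sin_gt_zero simp del: zero_less_divide_iff)
      \<comment> \<open>The half-angle form gives \<open>2 / \<omega>\<close> as an upper bound,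
        through \<open>x \<le> tan x\<close>.\<close>
      have "(1 + c) / S = 1 / tan (\<omega> / 2)"
        unfolding h tan_def using ch sh by (simp add: power2_eq_square)
      also have "\<dots> \<le> 1 / (\<omega> / 2)"
        using le_tan[of "\<omega> / 2"] w2 by (intro divide_left_mono) auto
      finally show "(1 + c) / S / 2 + 1 / 2 \<le> 1 / \<omega> + 1 / 2" by simp
      show "(1 + c) / S / 2 + 1 / 2 \<le> 1" if "pi / 2 < \<omega>"
      proof -
        have "c \<le> 0" unfolding ang[symmetric] using that \<omega>\<pi> cos_monotone_0_pi_le[of "pi / 2" \<omega>] by simp
        have "(1 + c)\<^sup>2 \<le> S\<^sup>2"
        proof -
          have "S\<^sup>2 - (1 + c)\<^sup>2 = - (2 * c) * (1 + c)" using cS by (simp add: power2_eq_square algebra_simps)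
          also have "\<dots> \<ge> 0" using \<open>c \<le> 0\<close> cpos by (intro mult_nonneg_nonneg) auto
          finally show ?thesis by simp
        qed
        then have "1 + c \<le> S" using power2_le_imp_le S0 by blast
        then have "(1 + c) / S \<le> 1" using Sp by simp
        then show ?thesis by simp
      qed
    qed
    finally show ?thesis .
  qed
  then show "cmod (Xx i (Xy n (sigma s N)) x y)
      \<le> c2 s / ((real N + 1) ^ (s - 2) * rot_angle (matrix_inv y ** x) ^ s)"
    unfolding inv \<omega>_def .
qed

end
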